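(* Let $\boldsymbol D_h\in\boldsymbol H(\mathrm{div},\Omega)$ and $\boldsymbol H_h\in\boldsymbol H(\mathbf{curl},\Omega)$ be any two fields such that $$i\omega\,\nabla\times\boldsymbol H_h=i\omega\boldsymbol J_h+\omega^2\boldsymbol D_h ,$$ and set $$\eta_{\mathrm{div}}:=\omega\|\boldsymbol E_h-\boldsymbol\varepsilon^{-1}\boldsymbol D_h\|_{\boldsymbol\varepsilon,\Omega},\qquad \eta_{\mathbf{curl}}:=\|\nabla\times\boldsymbol E_h-i\omega\boldsymbol\chi^{-1}\boldsymbol H_h\|_{\boldsymbol\chi,\Omega},\qquad \eta^2:=\eta_{\mathrm{div}}^2+\eta_{\mathbf{curl}}^2 .$$ Then $$|||\boldsymbol E-\boldsymbol E_h|||_{\omega,\Omega}\le\gamma_{\rm st}\,\eta$$ and $$|||\boldsymbol E-\boldsymbol E_h|||_{\omega,\Omega}\le\left(1+2\gamma_{\rm ba}+3\gamma_{\rm ba}^2\right)^{1/2}\eta .$$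
   Context: Setting. $\Omega\subset\mathbb R^3$ is a Lipschitz polyhedral domain and $\mathscr P$ is a finite family of pairwise disjoint open Lipschitz polyhedral subdomains with $\overline\Omega=\bigcup_{P\in\mathscr P}\overline P$. The coefficients $\boldsymbol\varepsilon,\boldsymbol\chi:\Omega\to\mathbb R^{3\times 3}$ take values in symmetric positive definite matrices and are constant on each $P\in\mathscr P$; $\boldsymbol\mu:=\boldsymbol\chi^{-1}$; $\omega>0$ is a fixed frequency. All functions (including polynomials) are complex-valued; $(u,v)_D=\int_D u\cdot\overline v$ is the $L^2(D)$ or $\boldsymbol L^2(D)=[L^2(D)]^3$ inner product, $\|\cdot\|_D$ its norm, and for a bounded, uniformly positive definite symmetric matrix field $\boldsymbol\rho$, $\|\boldsymbol v\|_{\boldsymbol\rho,D}^2:=\int_D\boldsymbol\rho\boldsymbol v\cdot\overline{\boldsymbol v}$. $\boldsymbol H(\mathbf{curl},D)$ and $\boldsymbol H(\mathrm{div},D)$ are the usual spaces of $\boldsymbol L^2(D)$ fields with square-integrable weak curl, resp. divergence; $\boldsymbol H_0(\mathbf{curl},\Omega)$ is the subspace of $\boldsymbol H(\mathbf{curl},\Omega)$ of fields with vanishing tangential trace on $\partial\Omega$. The energy norm is $|||\boldsymbol v|||_{\omega,D}^2:=\omega^2\|\boldsymbol v\|_{\boldsymbol\varepsilon,D}^2+\|\nabla\times\boldsymbol v\|_{\boldsymbol\chi,D}^2$, and $b(\boldsymbol u,\boldsymbol v):=-\omega^2(\boldsymbol\varepsilon\boldsymbol u,\boldsymbol v)_\Omega+(\boldsymbol\chi\nabla\times\boldsymbol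 u,\nabla\times\boldsymbol v)_\Omega$. Inf-sup assumption: there is a constant $\gamma_{\rm st}>0$ such that $\inf_{\boldsymbol e}\sup_{\boldsymbol v}|b(\boldsymbol e,\boldsymbol v)|\ge 1/\gamma_{\rm st}$, where $\boldsymbol e,\boldsymbol v$ range over the elements of $\boldsymbol H_0(\mathbf{curl},\Omega)$ with $|||\cdot|||_{\omega,\Omega}=1$. Mesh and discretization. $\mathcal T_h$ is a conforming tetrahedral mesh of $\Omega$ (open elements $K$; the closures of two distinct elements intersect in the empty set or a full common face, edge or vertex). $\mathcal P_q(K)$ is the space of polynomials of degree $\le q$ on $K$, $\boldsymbol{\mathcal P}_q(K)=[\mathcal P_q(K)]^3$, $\boldsymbol N_q(K)=\boldsymbol x\times\boldsymbol{\mathcal P}_q(K)+\boldsymbol{\mathcal P}_q(K)$, $\boldsymbol{RT}_q(K)=\boldsymbol x\mathcal P_q(K)+\boldsymbol{\mathcal P}_q(K)$; for $\mathcal T\subset\mathcal T_h$, $\boldsymbol{\mathcal P}_q(\mathcal T),\boldsymbol N_q(\mathcal T),\boldsymbol{RT}_q(\mathcal T)$ are the corresponding piecewise spaces without interelement continuity. $\boldsymbol W_h\subset\boldsymbol H_0(\mathbf{curl},\Omega)$ is a fixed finite element space with $\boldsymbol{\mathcal P}_1(\mathcal T_h)\cap\boldsymbol H_0(\mathbf{curl},\Omega)\subset\boldsymbol W_h$ and such that for each $K$ there is an integer $q_K\ge1$ with $\boldsymbol v_h|_K\in\boldsymbol N_{q_K}(K)$ for all $\boldsymbol v_h\in\boldsymbol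 W_h$; $p_K$ is the smallest such $q_K$ and $p:=\min_K p_K$. The right-hand side satisfies $\boldsymbol J_h\in\boldsymbol{RT}_p(\mathcal T_h)\cap\boldsymbol H(\mathrm{div},\Omega)$. $\boldsymbol E\in\boldsymbol H_0(\mathbf{curl},\Omega)$ is the unique solution of $b(\boldsymbol E,\boldsymbol v)=i\omega(\boldsymbol J_h,\boldsymbol v)_\Omega$ for all $\boldsymbol v\in\boldsymbol H_0(\mathbf{curl},\Omega)$, and $\boldsymbol E_h\in\boldsymbol W_h$ is a given element satisfying $b(\boldsymbol E_h,\boldsymbol v_h)=i\omega(\boldsymbol J_h,\boldsymbol v_h)_\Omega$ for all $\boldsymbol v_h\in\boldsymbol W_h$. Approximation factor. $\boldsymbol\Lambda_{\boldsymbol\varepsilon}(\Omega):=\{\boldsymbol\varepsilon^{-1}\nabla\times\boldsymbol\phi:\boldsymbol\phi\in\boldsymbol H(\mathbf{curl},\Omega)\}$. For $\boldsymbol\theta\in\boldsymbol\Lambda_{\boldsymbol\varepsilon}(\Omega)$ let $\boldsymbol\xi_{\boldsymbol\theta}\in\boldsymbol H_0(\mathbf{curl},\Omega)$ be the unique solution of $b(\boldsymbol\xi_{\boldsymbol\theta},\boldsymbol v)=\omega(\boldsymbol\varepsilon\boldsymbol\theta,\boldsymbol v)_\Omega$ for all $\boldsymbol v\in\boldsymbol H_0(\mathbf{curl},\Omega)$. Then $$\gamma_{\rm ba}:=\sup_{\boldsymbol\theta\in\boldsymbol\Lambda_{\boldsymbol\varepsilon}(\Omega),\ \|\boldsymbol\theta\|_{\boldsymbol\varepsilon,\Omega}=1}\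 \inf_{\boldsymbol v_h\in\boldsymbol W_h}|||\boldsymbol\xi_{\boldsymbol\theta}-\boldsymbol v_h|||_{\omega,\Omega}.$$ *)

theory Defs
  imports "HOL-Analysis.Analysis" "HOL-Library.Disjoint_Sets"
begin

type_synonym sfield = "real^3 \<Rightarrow> complex"
type_synonym vfield = "real^3 \<Rightarrow> complex^3"
type_synonym coeff = "real^3 \<Rightarrow> real^3^3"


section \<open>Lipschitz polyhedral domains and coefficients\<close>

text \<open>
  Coordinate-free strong Lipschitz condition: near each boundary point, \<open>D\<close> is the strict
  epigraph, in the direction \<open>e\<close>, of a Lipschitz function of the component orthogonal to \<open>e\<close>.
\<close>

definition lipschitz_boundary :: "(real^3) set \<Rightarrow> bool" where
  "lipschitz_boundary D \<longleftrightarrow>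
     (\<forall>z\<in>frontier D. \<exists>e r L (g :: real^3 \<Rightarrow> real).
        norm e = 1 \<and> r > 0 \<and> L-lipschitz_on UNIV g \<and>
        (\<forall>y\<in>ball z r. y \<in> D \<longleftrightarrow> g (y - (y \<bullet> e) *\<^sub>R e) < y \<bullet> e))"

text \<open>The boundary of a polyhedral domain is a finite union of (convex) plane polygons.\<close>

definition lipschitz_polyhedral_domain :: "(real^3) set \<Rightarrow> bool" where
  "lipschitz_polyhedral_domain D \<longleftrightarrow>
     open D \<and> connected D \<and> bounded D \<and> D \<noteq> {} \<and> lipschitz_boundary D \<and>
     (\<exists>\<F>. finite \<F> \<and> (\<forall>F\<in>\<F>. polytope F \<and> aff_dim F = 2) \<and> frontier D = \<Union>\<F>)"

definition polyhedral_partition :: "(real^3) set \<Rightarrow> (real^3) set set \<Rightarrow> bool" where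
  "polyhedral_partition \<Omega> \<P> \<longleftrightarrow>
     finite \<P> \<and> disjoint \<P> \<and> (\<forall>P\<in>\<P>. P \<subseteq> \<Omega> \<and> lipschitz_polyhedral_domain P) \<and>
     closure \<Omega> = (\<Union>P\<in>\<P>. closure P)"

definition sym_pos_def :: "real^3^3 \<Rightarrow> bool" where
  "sym_pos_def A \<longleftrightarrow> transpose A = A \<and> (\<forall>v. v \<noteq> 0 \<longrightarrow> v \<bullet> (A *v v) > 0)"

definition admissible_coeff :: "(real^3) set \<Rightarrow> (real^3) set set \<Rightarrow> coeff \<Rightarrow> bool" where
  "admissible_coeff \<Omega> \<P> \<rho> \<longleftrightarrow>
     (\<forall>x\<in>\<Omega>. sym_pos_def (\<rho> x)) \<and> (\<forall>P\<in>\<P>. \<rho> constant_on P)"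


section \<open>Complex vector algebra\<close>

definition rmat_mult :: "real^3^3 \<Rightarrow> complex^3 \<Rightarrow> complex^3" where
  "rmat_mult A v = (\<chi> i. \<Sum>j\<in>UNIV. complex_of_real (A $ i $ j) * v $ j)"

text \<open>\<open>hdot u v\<close> is u \<open>\<cdot>\<close> conj v; \<open>bdot\<close> is the same without conjugation.\<close>

definition hdot :: "complex^3 \<Rightarrow> complex^3 \<Rightarrow> complex" where
  "hdot u v = (\<Sum>i\<in>UNIV. u $ i * cnj (v $ i))"

definition bdot :: "complex^3 \<Rightarrow> complex^3 \<Rightarrow> complex" where
  "bdot u v = (\<Sum>i\<in>UNIV. u $ i * v $ i)"

definition ccross :: "complex^3 \<Rightarrow> complex^3 \<Rightarrow> complex^3" where
  "ccross u v = vector [u $ 2 * v $ 3 - u $ 3 * v $ 2,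
                        u $ 3 * v $ 1 - u $ 1 * v $ 3,
                        u $ 1 * v $ 2 - u $ 2 * v $ 1]"

definition cvec :: "real^3 \<Rightarrow> complex^3" where
  "cvec x = (\<chi> i. complex_of_real (x $ i))"


section \<open>Square-integrable fields\<close>

text \<open>
  Elements of function spaces are represented by functions on the whole space, of which only the
  values almost everywhere on the domain matter.
\<close>

definition L2 :: "(real^3) set \<Rightarrow> (real^3 \<Rightarrow> 'b::euclidean_space) set" where
  "L2 D = {u \<in> borel_measurable (lebesgue_on D). integrable (lebesgue_on D) (\<lambda>x. (norm (u x))\<^sup>2)}"

definition l2_inner :: "(real^3) set \<Rightarrow> vfield \<Rightarrow> vfield \<Rightarrow> complex" where
  "l2_inner D u v = integral\<^sup>L (lebesgue_on D) (\<lambda>x. hdot (u x) (v x))"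

definition coeff_mult :: "coeff \<Rightarrow> vfield \<Rightarrow> vfield" where
  "coeff_mult \<rho> v = (\<lambda>x. rmat_mult (\<rho> x) (v x))"

definition coeff_inv_mult :: "coeff \<Rightarrow> vfield \<Rightarrow> vfield" where
  "coeff_inv_mult \<rho> v = (\<lambda>x. rmat_mult (matrix_inv (\<rho> x)) (v x))"

definition wnorm :: "coeff \<Rightarrow> (real^3) set \<Rightarrow> vfield \<Rightarrow> real" where
  "wnorm \<rho> D v = sqrt (Re (l2_inner D (coeff_mult \<rho> v) v))"


section \<open>Weak derivatives\<close>

definition pderiv3 :: "3 \<Rightarrow> sfield \<Rightarrow> sfield" where
  "pderiv3 i f x = frechet_derivative f (at x) (axis i 1)"

fun C_k :: "nat \<Rightarrow> sfield \<Rightarrow> bool" where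
  "C_k 0 f \<longleftrightarrow> continuous_on UNIV f"
| "C_k (Suc k) f \<longleftrightarrow> f differentiable_on UNIV \<and> (\<forall>i. C_k k (pderiv3 i f))"

definition test_functions :: "(real^3) set \<Rightarrow> sfield set" where
  "test_functions D =
     {\<phi>. (\<forall>k. C_k k \<phi>) \<and> (\<exists>K. compact K \<and> K \<subseteq> D \<and> (\<forall>x. x \<notin> K \<longrightarrow> \<phi> x = 0))}"

definition test_fields :: "(real^3) set \<Rightarrow> vfield set" where
  "test_fields D = {\<psi>. \<forall>i. (\<lambda>x. \<psi> x $ i) \<in> test_functions D}"

definition grad :: "sfield \<Rightarrow> vfield" where
  "grad \<phi> x = (\<chi> i. pderiv3 i \<phi> x)"

definition classical_curl :: "vfield \<Rightarrow> vfield" where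
  "classical_curl \<psi> x =
     vector [pderiv3 2 (\<lambda>y. \<psi> y $ 3) x - pderiv3 3 (\<lambda>y. \<psi> y $ 2) x,
             pderiv3 3 (\<lambda>y. \<psi> y $ 1) x - pderiv3 1 (\<lambda>y. \<psi> y $ 3) x,
             pderiv3 1 (\<lambda>y. \<psi> y $ 2) x - pderiv3 2 (\<lambda>y. \<psi> y $ 1) x]"

definition has_weak_curl :: "(real^3) set \<Rightarrow> vfield \<Rightarrow> vfield \<Rightarrow> bool" where
  "has_weak_curl D u w \<longleftrightarrow>
     (\<forall>\<psi>\<in>test_fields D.
        integral\<^sup>L (lebesgue_on D) (\<lambda>x. bdot (u x) (classical_curl \<psi> x)) =
        integral\<^sup>L (lebesgue_on D) (\<lambda>x. bdot (w x) (\<psi> x)))"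

definition has_weak_div :: "(real^3) set \<Rightarrow> vfield \<Rightarrow> sfield \<Rightarrow> bool" where
  "has_weak_div D u d \<longleftrightarrow>
     (\<forall>\<phi>\<in>test_functions D.
        integral\<^sup>L (lebesgue_on D) (\<lambda>x. bdot (u x) (grad \<phi> x)) =
        - integral\<^sup>L (lebesgue_on D) (\<lambda>x. d x * \<phi> x))"

definition Hcurl :: "(real^3) set \<Rightarrow> vfield set" where
  "Hcurl D = {u \<in> L2 D. \<exists>w\<in>L2 D. has_weak_curl D u w}"

definition Hdiv :: "(real^3) set \<Rightarrow> vfield set" where
  "Hdiv D = {u \<in> L2 D. \<exists>d\<in>L2 D. has_weak_div D u d}"

text \<open>The weak curl is unique up to equality almost everywhere.\<close>

definition curl :: "(real^3) set \<Rightarrow> vfield \<Rightarrow> vfield" where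
  "curl D u = (SOME w. w \<in> L2 D \<and> has_weak_curl D u w)"

text \<open>
  The tangential trace \<open>n \<times> u\<close> of a field in H(curl) is not a function on the boundary; it is
  defined by Green's formula as a functional on (the tangential components of) H(curl):
  for fields smooth up to the boundary the expression below is the surface integral of
  (n \<open>\<times>\<close> u) \<open>\<cdot>\<close> conj \<open>\<phi>\<close>.
\<close>

definition tangential_trace :: "(real^3) set \<Rightarrow> vfield \<Rightarrow> vfield \<Rightarrow> complex" where
  "tangential_trace D u \<phi> = l2_inner D (curl D u) \<phi> - l2_inner D u (curl D \<phi>)"

definition Hcurl0 :: "(real^3) set \<Rightarrow> vfield set" where
  "Hcurl0 D = {u \<in> Hcurl D. \<forall>\<phi>\<in>Hcurl D. tangential_trace D u \<phi> = 0}"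


section \<open>Energy norm, sesquilinear form and inf-sup condition\<close>

definition energy_norm :: "coeff \<Rightarrow> coeff \<Rightarrow> real \<Rightarrow> (real^3) set \<Rightarrow> vfield \<Rightarrow> real" where
  "energy_norm eps chi \<omega> D v =
     sqrt (\<omega>\<^sup>2 * (wnorm eps D v)\<^sup>2 + (wnorm chi D (curl D v))\<^sup>2)"

definition bform :: "coeff \<Rightarrow> coeff \<Rightarrow> real \<Rightarrow> (real^3) set \<Rightarrow> vfield \<Rightarrow> vfield \<Rightarrow> complex" where
  "bform eps chi \<omega> \<Omega> u v =
     - (complex_of_real \<omega>)\<^sup>2 * l2_inner \<Omega> (coeff_mult eps u) v
     + l2_inner \<Omega> (coeff_mult chi (curl \<Omega> u)) (curl \<Omega> v)"

definition unit_sphere :: "coeff \<Rightarrow> coeff \<Rightarrow> real \<Rightarrow> (real^3) set \<Rightarrow> vfield set" where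
  "unit_sphere eps chi \<omega> \<Omega> = {v \<in> Hcurl0 \<Omega>. energy_norm eps chi \<omega> \<Omega> v = 1}"

text \<open>The real supremum is that of a set bounded by 1, by the Cauchy-Schwarz inequality.\<close>

definition inf_sup :: "coeff \<Rightarrow> coeff \<Rightarrow> real \<Rightarrow> (real^3) set \<Rightarrow> real" where
  "inf_sup eps chi \<omega> \<Omega> =
     (INF e\<in>unit_sphere eps chi \<omega> \<Omega>. SUP v\<in>unit_sphere eps chi \<omega> \<Omega>. cmod (bform eps chi \<omega> \<Omega> e v))"


section \<open>Meshes and piecewise polynomials\<close>

text \<open>
  Elements are open tetrahedra. In \<open>triangulation\<close>, the intersection of two distinct closed
  tetrahedra is a face of each in the sense of \<open>face_of\<close>, i.e. empty, or a common vertex, edge or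
  triangular face.
\<close>

definition conforming_tet_mesh :: "(real^3) set \<Rightarrow> (real^3) set set \<Rightarrow> bool" where
  "conforming_tet_mesh \<Omega> \<T> \<longleftrightarrow>
     finite \<T> \<and> (\<forall>K\<in>\<T>. 3 simplex (closure K) \<and> K = interior (closure K)) \<and>
     triangulation (closure ` \<T>) \<and> closure \<Omega> = (\<Union>K\<in>\<T>. closure K)"

definition Pol :: "nat \<Rightarrow> sfield set" where
  "Pol q = {f. \<exists>c :: nat \<Rightarrow> nat \<Rightarrow> nat \<Rightarrow> complex. \<forall>x.
     f x = (\<Sum>(i, j, k) \<in> {(i, j, k). i + j + k \<le> q}.
              c i j k * complex_of_real (x $ 1 ^ i * x $ 2 ^ j * x $ 3 ^ k))}"

definition VPol :: "nat \<Rightarrow> vfield set" where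
  "VPol q = {v. \<forall>i. (\<lambda>x. v x $ i) \<in> Pol q}"

definition Ned :: "nat \<Rightarrow> vfield set" where
  "Ned q = {\<lambda>x. ccross (cvec x) (a x) + b x | a b. a \<in> VPol q \<and> b \<in> VPol q}"

definition RT :: "nat \<Rightarrow> vfield set" where
  "RT q = {\<lambda>x. a x *s cvec x + b x | a b. a \<in> Pol q \<and> b \<in> VPol q}"

definition restricts_to :: "vfield \<Rightarrow> (real^3) set \<Rightarrow> vfield set \<Rightarrow> bool" where
  "restricts_to v K F \<longleftrightarrow> (\<exists>f\<in>F. AE x in lebesgue_on K. v x = f x)"

definition piecewise :: "vfield set \<Rightarrow> (real^3) set set \<Rightarrow> vfield set" where
  "piecewise F \<T> = {v. \<forall>K\<in>\<T>. restricts_to v K F}"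

definition complex_subspace :: "vfield set \<Rightarrow> bool" where
  "complex_subspace W \<longleftrightarrow>
     (\<lambda>x. 0) \<in> W \<and> (\<forall>u\<in>W. \<forall>v\<in>W. (\<lambda>x. u x + v x) \<in> W) \<and>
     (\<forall>c. \<forall>u\<in>W. (\<lambda>x. c *s u x) \<in> W)"

text \<open>
  The finite dimension of \<open>W\<close> (modulo equality almost everywhere) is a consequence of the last
  condition.
\<close>

definition fe_space :: "(real^3) set \<Rightarrow> (real^3) set set \<Rightarrow> vfield set \<Rightarrow> bool" where
  "fe_space \<Omega> \<T> W \<longleftrightarrow>
     complex_subspace W \<and> W \<subseteq> Hcurl0 \<Omega> \<and> piecewise (VPol 1) \<T> \<inter> Hcurl0 \<Omega> \<subseteq> W \<and>
     (\<forall>K\<in>\<T>. \<exists>q\<ge>1. \<forall>v\<in>W. restricts_to v K (Ned q))"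

definition elem_degree :: "vfield set \<Rightarrow> (real^3) set \<Rightarrow> nat" where
  "elem_degree W K = (LEAST q. q \<ge> 1 \<and> (\<forall>v\<in>W. restricts_to v K (Ned q)))"

definition min_degree :: "(real^3) set set \<Rightarrow> vfield set \<Rightarrow> nat" where
  "min_degree \<T> W = (MIN K\<in>\<T>. elem_degree W K)"


section \<open>Approximation factor\<close>

definition \<Lambda>_space :: "coeff \<Rightarrow> (real^3) set \<Rightarrow> vfield set" where
  "\<Lambda>_space eps \<Omega> = {coeff_inv_mult eps (curl \<Omega> \<phi>) | \<phi>. \<phi> \<in> Hcurl \<Omega>}"

text \<open>Under the inf-sup condition, \<open>\<xi>\<close> exists and is unique up to equality almost everywhere.\<close>

definition \<xi>_sol :: "coeff \<Rightarrow> coeff \<Rightarrow> real \<Rightarrow> (real^3) set \<Rightarrow> vfield \<Rightarrow> vfield" where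
  "\<xi>_sol eps chi \<omega> \<Omega> \<theta> =
     (SOME \<xi>. \<xi> \<in> Hcurl0 \<Omega> \<and>
        (\<forall>v\<in>Hcurl0 \<Omega>. bform eps chi \<omega> \<Omega> \<xi> v
            = complex_of_real \<omega> * l2_inner \<Omega> (coeff_mult eps \<theta>) v))"

text \<open>
  The supremum is finite: choosing \<open>v = 0\<close>, the inf-sup condition bounds each infimum by the
  inf-sup constant.
\<close>

definition \<gamma>_ba :: "coeff \<Rightarrow> coeff \<Rightarrow> real \<Rightarrow> (real^3) set \<Rightarrow> vfield set \<Rightarrow> real" where
  "\<gamma>_ba eps chi \<omega> \<Omega> W =
     (SUP \<theta>\<in>{\<theta> \<in> \<Lambda>_space eps \<Omega>. wnorm eps \<Omega> \<theta> = 1}.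
        INF v\<in>W. energy_norm eps chi \<omega> \<Omega> (\<lambda>x. \<xi>_sol eps chi \<omega> \<Omega> \<theta> x - v x))"


section \<open>Estimators\<close>

definition \<eta>_div :: "coeff \<Rightarrow> real \<Rightarrow> (real^3) set \<Rightarrow> vfield \<Rightarrow> vfield \<Rightarrow> real" where
  "\<eta>_div eps \<omega> \<Omega> Eh Dh = \<omega> * wnorm eps \<Omega> (\<lambda>x. Eh x - coeff_inv_mult eps Dh x)"

definition \<eta>_curl :: "coeff \<Rightarrow> real \<Rightarrow> (real^3) set \<Rightarrow> vfield \<Rightarrow> vfield \<Rightarrow> real" where
  "\<eta>_curl chi \<omega> \<Omega> Eh Hh =
     wnorm chi \<Omega> (\<lambda>x. curl \<Omega> Eh x - (\<i> * complex_of_real \<omega>) *s coeff_inv_mult chi Hh x)"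

definition \<eta>_tot :: "coeff \<Rightarrow> coeff \<Rightarrow> real \<Rightarrow> (real^3) set \<Rightarrow> vfield \<Rightarrow> vfield \<Rightarrow> vfield \<Rightarrow> real" where
  "\<eta>_tot eps chi \<omega> \<Omega> Eh Dh Hh = sqrt ((\<eta>_div eps \<omega> \<Omega> Eh Dh)\<^sup>2 + (\<eta>_curl chi \<omega> \<Omega> Eh Hh)\<^sup>2)"

end

theory Submission
  imports Defs "HOL-Library.Function_Algebras" "HOL-Computational_Algebra.Polynomial"
begin

text \<open>
  Put \<open>e = E - Eh\<close>. Everything rests on one identity for the residual: for \<open>v\<close> in the energy space,
  Ampere's law for \<open>Hh\<close> and Green's formula (which is the definition of the vanishing tangential trace
  of \<open>v\<close>) give
  \<open>b(e, v) = \<omega>\<^sup>2 (\<epsilon> f, v) - (\<chi> g, curl v)\<close> with \<open>f = Eh - \<epsilon>\<^sup>-\<^sup>1 Dh\<close> and \<open>g = curl Eh - \<i>\<omega> \<chi>\<^sup>-\<^sup>1 Hh\<close>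
  (\<open>residual_representation\<close>). By the Cauchy-Schwarz inequality \<open>|b(e, v)| \<le> \<eta> |||v|||\<close>, and the inf-sup
  condition turns this into the first estimate (\<open>inf_sup_stability\<close>).

  For the second estimate, \<open>e\<close> is projected orthogonally, in the \<open>\<epsilon>\<close>-weighted \<open>L\<^sup>2\<close> space, onto the
  closure of the fields \<open>\<epsilon>\<^sup>-\<^sup>1 curl \<phi>\<close>. This gives \<open>e = \<theta> + w\<close>, where \<open>w\<close> is orthogonal to all these
  fields, hence belongs to the energy space and is curl-free (\<open>orthogonal_Lambda_curl_free\<close>). Testing
  with \<open>z = \<theta> - w\<close>, which has the same energy norm as \<open>e\<close>, yields
  \<open>|||e|||\<^sup>2 = b(e, z) + 2 \<omega>\<^sup>2 \<parallel>\<theta>\<parallel>\<^sup>2 \<le> \<eta> |||e||| + 2 \<omega>\<^sup>2 \<parallel>\<theta>\<parallel>\<^sup>2\<close>. A duality argument in the manner of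
  Aubin and Nitsche, with Galerkin orthogonality, gives \<open>\<omega> \<parallel>\<theta>\<parallel> \<le> \<gamma>\<^sub>b\<^sub>a \<eta>\<close> (\<open>duality_bound\<close>), and the quadratic
  inequality is solved in \<open>quadratic_estimate\<close>.

  The duality argument needs the dual problems to be solvable. The form is Hermitian and satisfies an
  inf-sup condition, so this is a statement about Hilbert spaces (\<open>hermitian_infsup_solvable\<close>); it
  requires the completeness of \<open>L\<^sup>2\<close> and of the energy space. The curl being chosen among all weak
  curls, its linearity holds only almost everywhere and relies on the uniqueness of weak curls, that is,
  on the fundamental lemma of the calculus of variations and on the existence of smooth bump functions.
  Integration by parts shows that test fields, and one explicit linear field, have the expected curls.
\<close>

section \<open>Semi-Hilbert spaces\<close>

text \<open>
  Fields which agree almost everywhere are not identified, so all spaces of fields below carry only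
  semi-inner products. The arguments of Hilbert space theory survive: limits are unique up to vectors
  of seminorm zero, on which the inner product vanishes by the Cauchy-Schwarz inequality.
\<close>

definition snrm :: "('a \<Rightarrow> 'a \<Rightarrow> complex) \<Rightarrow> 'a \<Rightarrow> real" where
  "snrm ip x = sqrt (Re (ip x x))"

text \<open>
  Functions into a vector space form an additive group, but complex multiples of a function are not
  provided by a type class; hence the explicit operation \<open>sc\<close>.
\<close>

definition csubspace :: "(complex \<Rightarrow> 'a::ab_group_add \<Rightarrow> 'a) \<Rightarrow> 'a set \<Rightarrow> bool" where
  "csubspace sc M \<longleftrightarrow> M \<noteq> {} \<and> (\<forall>x\<in>M. \<forall>y\<in>M. x - y \<in> M) \<and> (\<forall>c. \<forall>x\<in>M. sc c x \<in> M)"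

lemma csubspace_diff: "csubspace sc M \<Longrightarrow> x \<in> M \<Longrightarrow> y \<in> M \<Longrightarrow> x - y \<in> M"
  and csubspace_scale: "csubspace sc M \<Longrightarrow> x \<in> M \<Longrightarrow> sc c x \<in> M"
  by (auto simp: csubspace_def)

lemma csubspace_zero: assumes "csubspace sc M" shows "0 \<in> M"
proof -
  obtain x where "x \<in> M" using assms by (auto simp: csubspace_def)
  then show ?thesis using csubspace_diff[OF assms, of x x] by simp
qed

lemma csubspace_add:
  assumes "csubspace sc M" "x \<in> M" "y \<in> M" shows "x + y \<in> M"
  using csubspace_diff[OF assms(1,2) csubspace_diff[OF assms(1) csubspace_zero[OF assms(1)] assms(3)]]
  by simp

text \<open>
  Multiples of vectors are only ever seen through the inner product, so linearity is required of the
  inner product and not of \<open>sc\<close>.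
\<close>

locale semi_inner =
  fixes H :: "'a::ab_group_add set" and sc :: "complex \<Rightarrow> 'a \<Rightarrow> 'a" and ip :: "'a \<Rightarrow> 'a \<Rightarrow> complex"
  assumes subspace: "csubspace sc H"
    and ip_diff_left: "x \<in> H \<Longrightarrow> y \<in> H \<Longrightarrow> z \<in> H \<Longrightarrow> ip (x - y) z = ip x z - ip y z"
    and ip_scale_left: "x \<in> H \<Longrightarrow> y \<in> H \<Longrightarrow> ip (sc c x) y = c * ip x y"
    and ip_sym: "x \<in> H \<Longrightarrow> y \<in> H \<Longrightarrow> ip y x = cnj (ip x y)"
    and ip_nonneg: "x \<in> H \<Longrightarrow> 0 \<le> Re (ip x x)"
begin

lemmas diff_mem = csubspace_diff[OF subspace]
lemmas add_mem = csubspace_add[OF subspace]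
lemmas scale_mem = csubspace_scale[OF subspace]
lemmas zero_mem = csubspace_zero[OF subspace]
lemmas mems = diff_mem add_mem scale_mem zero_mem

lemma ip_add_left: "x \<in> H \<Longrightarrow> y \<in> H \<Longrightarrow> z \<in> H \<Longrightarrow> ip (x + y) z = ip x z + ip y z"
  using ip_diff_left[of "x + y" y z] add_mem by simp

lemma ip_add_right: "x \<in> H \<Longrightarrow> y \<in> H \<Longrightarrow> z \<in> H \<Longrightarrow> ip z (x + y) = ip z x + ip z y"
  using ip_sym[of "x + y" z] ip_sym[of x z] ip_sym[of y z] add_mem by (simp add: ip_add_left)

lemma ip_diff_right: "x \<in> H \<Longrightarrow> y \<in> H \<Longrightarrow> z \<in> H \<Longrightarrow> ip z (x - y) = ip z x - ip z y"
  using ip_sym[of "x - y" z] ip_sym[of x z] ip_sym[of y z] diff_mem by (simp add: ip_diff_left)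

lemma ip_scale_right: "x \<in> H \<Longrightarrow> y \<in> H \<Longrightarrow> ip y (sc c x) = cnj c * ip y x"
  using ip_sym[of "sc c x" y] ip_sym[of x y] scale_mem by (simp add: ip_scale_left)

lemmas ip_rules = ip_add_left ip_add_right ip_diff_left ip_diff_right ip_scale_left ip_scale_right

lemma semi_inner_subspace:
  assumes "csubspace sc M" "M \<subseteq> H" shows "semi_inner M sc ip"
proof
  note mem = subsetD[OF assms(2)]
  show "csubspace sc M" by (rule assms(1))
  show "ip (x - y) z = ip x z - ip y z" if "x \<in> M" "y \<in> M" "z \<in> M" for x y z
    by (rule ip_diff_left) (rule mem, rule that)+
  show "ip (sc c x) y = c * ip x y" if "x \<in> M" "y \<in> M" for c x y
    by (rule ip_scale_left) (rule mem, rule that)+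
  show "ip y x = cnj (ip x y)" if "x \<in> M" "y \<in> M" for x y
    by (rule ip_sym) (rule mem, rule that)+
  show "0 \<le> Re (ip x x)" if "x \<in> M" for x
    by (rule ip_nonneg) (rule mem, rule that)
qed

lemma snrm_nonneg: "x \<in> H \<Longrightarrow> 0 \<le> snrm ip x"
  by (simp add: snrm_def ip_nonneg)

lemma snrm_sq: "x \<in> H \<Longrightarrow> (snrm ip x)\<^sup>2 = Re (ip x x)"
  by (simp add: snrm_def ip_nonneg)

lemma ip_self: "x \<in> H \<Longrightarrow> ip x x = of_real ((snrm ip x)\<^sup>2)"
  using ip_sym[of x x] by (simp add: snrm_sq complex_eq_iff)

lemma Re_ip_swap: "x \<in> H \<Longrightarrow> y \<in> H \<Longrightarrow> Re (ip y x) = Re (ip x y)"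
  using ip_sym[of x y] by simp

lemma snrm_diff_sq:
  "x \<in> H \<Longrightarrow> y \<in> H \<Longrightarrow> (snrm ip (x - y))\<^sup>2 = (snrm ip x)\<^sup>2 - 2 * Re (ip x y) + (snrm ip y)\<^sup>2"
  using Re_ip_swap[of x y] by (simp add: snrm_sq mems ip_rules)

lemma snrm_add_sq:
  "x \<in> H \<Longrightarrow> y \<in> H \<Longrightarrow> (snrm ip (x + y))\<^sup>2 = (snrm ip x)\<^sup>2 + 2 * Re (ip x y) + (snrm ip y)\<^sup>2"
  using Re_ip_swap[of x y] by (simp add: snrm_sq mems ip_rules)

lemma snrm_scale: assumes "x \<in> H" shows "snrm ip (sc c x) = cmod c * snrm ip x"
proof -
  have "ip (sc c x) (sc c x) = (c * cnj c) * ip x x"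
    using assms by (simp add: ip_rules mems)
  then have "Re (ip (sc c x) (sc c x)) = (cmod c)\<^sup>2 * Re (ip x x)"
    by (simp only: complex_norm_square[symmetric] flip: of_real_power) simp
  then show ?thesis by (simp add: snrm_def real_sqrt_mult)
qed

text \<open>
  Moving \<open>x\<close> along \<open>y\<close> by the multiple \<open>s \<langle>x, y\<rangle>\<close>, \<open>s\<close> real, changes the square of the seminorm by a
  real quadratic in \<open>s\<close>; both the Cauchy-Schwarz inequality and the orthogonality of a nearest point
  come from the sign of this quadratic.
\<close>

lemma snrm_diff_multiple_sq:
  assumes "x \<in> H" "y \<in> H"
  shows "(snrm ip (x - sc (of_real s * ip x y) y))\<^sup>2 =
    (snrm ip x)\<^sup>2 - 2 * s * (cmod (ip x y))\<^sup>2 + s\<^sup>2 * (cmod (ip x y))\<^sup>2 * (snrm ip y)\<^sup>2"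
proof -
  have "Re (cnj (ip x y) * ip x y) = (cmod (ip x y))\<^sup>2"
    by (simp only: mult.commute[of "cnj _"] complex_norm_square[symmetric] Re_complex_of_real)
  then show ?thesis
    using assms by (simp add: snrm_diff_sq mems ip_rules snrm_scale norm_mult power_mult_distrib mult.assoc)
qed

lemma cauchy_schwarz:
  assumes "x \<in> H" "y \<in> H" shows "cmod (ip x y) \<le> snrm ip x * snrm ip y"
proof -
  let ?c = "(cmod (ip x y))\<^sup>2" and ?Y = "(snrm ip y)\<^sup>2" and ?X = "(snrm ip x)\<^sup>2"
  have q: "0 \<le> ?X - 2 * s * ?c + s\<^sup>2 * ?c * ?Y" for s
    by (subst snrm_diff_multiple_sq[OF assms, symmetric]) simp
  have "?c \<le> ?X * ?Y"
  proof (cases "?Y = 0")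
    case True
    have "?c = 0"
    proof (rule ccontr)
      assume "?c \<noteq> 0"
      then have "2 * ((?X + 1) / (2 * ?c)) * ?c = ?X + 1" by simp
      then show False using q[of "(?X + 1) / (2 * ?c)"] True by simp
    qed
    then show ?thesis by simp
  next
    case False
    then have "?Y > 0" by simp
    have "(1 / ?Y)\<^sup>2 * ?c * ?Y = ?c / ?Y" using False by (simp add: power2_eq_square)
    then have "0 \<le> ?X - ?c / ?Y" using q[of "1 / ?Y"] by simp
    then show ?thesis using \<open>?Y > 0\<close> by (simp add: field_simps)
  qed
  then have "?c \<le> (snrm ip x * snrm ip y)\<^sup>2" by (simp add: power_mult_distrib)
  then show ?thesis using assms by (meson power2_le_imp_le mult_nonneg_nonneg snrm_nonneg)
qed

lemma triangle:
  assumes "x \<in> H" "y \<in> H" shows "snrm ip (x + y) \<le> snrm ip x + snrm ip y"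
proof (rule power2_le_imp_le)
  have "Re (ip x y) \<le> snrm ip x * snrm ip y"
    using cauchy_schwarz[OF assms] complex_Re_le_cmod order_trans by blast
  then show "(snrm ip (x + y))\<^sup>2 \<le> (snrm ip x + snrm ip y)\<^sup>2"
    using assms by (simp add: snrm_add_sq power2_sum)
qed (use assms snrm_nonneg in auto)

lemma snrm_minus_commute: "x \<in> H \<Longrightarrow> y \<in> H \<Longrightarrow> snrm ip (x - y) = snrm ip (y - x)"
  using snrm_diff_sq[of x y] snrm_diff_sq[of y x] Re_ip_swap[of x y]
  by (smt (verit) diff_mem power2_eq_imp_eq snrm_nonneg)

lemma triangle_diff:
  assumes "x \<in> H" "y \<in> H" "z \<in> H" shows "snrm ip (x - z) \<le> snrm ip (x - y) + snrm ip (y - z)"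
  using triangle[of "x - y" "y - z"] assms diff_mem by simp

lemma reverse_triangle:
  assumes "x \<in> H" "y \<in> H" shows "\<bar>snrm ip x - snrm ip y\<bar> \<le> snrm ip (x - y)"
  using triangle[of "x - y" y] triangle[of "y - x" x] snrm_minus_commute[of x y] assms diff_mem by auto

lemma snrm_tendsto:
  assumes "\<And>n. u n \<in> H" "l \<in> H" "(\<lambda>n. snrm ip (u n - l)) \<longlonglongrightarrow> 0"
  shows "(\<lambda>n. snrm ip (u n)) \<longlonglongrightarrow> snrm ip l"
proof -
  have "(\<lambda>n. snrm ip (u n) - snrm ip l) \<longlonglongrightarrow> 0"
    by (rule Lim_null_comparison[OF _ assms(3)])
       (use reverse_triangle[OF assms(1,2)] in auto)
  then show ?thesis by (simp add: LIM_zero_iff)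
qed

lemma bounded_antilinear_tendsto:
  assumes "\<And>x y. x \<in> H \<Longrightarrow> y \<in> H \<Longrightarrow> f (x - y) = f x - f y"
    and "\<And>x. x \<in> H \<Longrightarrow> cmod (f x) \<le> C * snrm ip x"
    and "\<And>n. u n \<in> H" "l \<in> H" "(\<lambda>n. snrm ip (u n - l)) \<longlonglongrightarrow> 0"
  shows "(\<lambda>n. f (u n)) \<longlonglongrightarrow> f l"
proof -
  have *: "(\<lambda>n. C * snrm ip (u n - l)) \<longlonglongrightarrow> 0" using tendsto_mult_left[OF assms(5), of C] by simp
  have "(\<lambda>n. f (u n) - f l) \<longlonglongrightarrow> 0"
    by (rule Lim_null_comparison[OF _ *])
       (use assms(1)[OF assms(3,4)] assms(2)[OF diff_mem[OF assms(3,4)]] in auto)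
  then show ?thesis by (simp add: LIM_zero_iff)
qed

lemma ip_tendsto_left:
  assumes "\<And>n. u n \<in> H" "l \<in> H" "(\<lambda>n. snrm ip (u n - l)) \<longlonglongrightarrow> 0" "v \<in> H"
  shows "(\<lambda>n. ip (u n) v) \<longlonglongrightarrow> ip l v"
  by (rule bounded_antilinear_tendsto[where f = "\<lambda>x. ip x v" and C = "snrm ip v"])
     (use assms cauchy_schwarz[OF _ assms(4)] in \<open>auto simp: ip_diff_left mult.commute\<close>)

end

locale semi_hilbert = semi_inner +
  assumes complete: "(\<And>n. u n \<in> H) \<Longrightarrow>
    (\<And>e. e > 0 \<Longrightarrow> \<exists>N. \<forall>m\<ge>N. \<forall>n\<ge>N. snrm ip (u m - u n) < e) \<Longrightarrow>
    \<exists>l\<in>H. (\<lambda>n. snrm ip (u n - l)) \<longlonglongrightarrow> 0"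
begin

text \<open>
  \<open>M\<close> need not be closed: the nearest point is a limit of elements of \<open>M\<close>. A minimizing sequence is
  Cauchy by the parallelogram identity.
\<close>

lemma projection_onto_closure:
  assumes M: "csubspace sc M" "M \<subseteq> H" and x: "x \<in> H"
  shows "\<exists>p\<in>H. \<exists>m. (\<forall>n::nat. m n \<in> M) \<and> (\<lambda>n. snrm ip (m n - p)) \<longlonglongrightarrow> 0 \<and> (\<forall>y\<in>M. ip (x - p) y = 0)"
proof -
  define d where "d = (INF y\<in>M. snrm ip (x - y))"
  have bdd: "bdd_below ((\<lambda>y. snrm ip (x - y)) ` M)"
    by (rule bdd_belowI[of _ 0]) (use M x snrm_nonneg diff_mem in auto)
  have ne: "M \<noteq> {}" using M(1) by (auto simp: csubspace_def)
  have d_le: "d \<le> snrm ip (x - y)" if "y \<in> M" for y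
    unfolding d_def by (rule cINF_lower[OF bdd that])
  have d0: "0 \<le> d"
    unfolding d_def by (rule cINF_greatest[OF ne]) (use M x snrm_nonneg diff_mem in auto)
  have "\<exists>y\<in>M. snrm ip (x - y) < d + 1 / Suc n" for n
    using cINF_less_iff[OF ne bdd, of "d + 1 / Suc n"] unfolding d_def by simp
  then obtain m where m: "\<And>n::nat. m n \<in> M" "\<And>n. snrm ip (x - m n) < d + 1 / Suc n"
    by metis
  have mH: "m n \<in> H" for n using m M by auto
  \<comment> \<open>By the parallelogram identity almost nearest points are close to each other, their midpoint
    being no nearer to \<open>x\<close> than \<open>d\<close>.\<close>
  have close: "(snrm ip (y - z))\<^sup>2 \<le> 4 * \<delta> * (2 * d + \<delta>)"
    if yz: "y \<in> M" "z \<in> M" and \<delta>: "snrm ip (x - y) \<le> d + \<delta>" "snrm ip (x - z) \<le> d + \<delta>" for y z \<delta>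
  proof -
    have H: "y \<in> H" "z \<in> H" using yz M by auto
    have mid: "sc (1/2) (y + z) \<in> M" using yz csubspace_add[OF M(1)] csubspace_scale[OF M(1)] by auto
    have "(snrm ip (y - z))\<^sup>2 = 2 * (snrm ip (x - y))\<^sup>2 + 2 * (snrm ip (x - z))\<^sup>2
        - 4 * (snrm ip (x - sc (1/2) (y + z)))\<^sup>2"
      using H x Re_ip_swap[of x y] Re_ip_swap[of x z] Re_ip_swap[of y z]
      by (simp add: snrm_diff_sq snrm_add_sq snrm_scale ip_rules mems norm_divide power_mult_distrib power_divide)
        (simp add: field_simps)
    also have "\<dots> \<le> 2 * (d + \<delta>)\<^sup>2 + 2 * (d + \<delta>)\<^sup>2 - 4 * d\<^sup>2"
      using power_mono[OF \<delta>(1), of 2] power_mono[OF \<delta>(2), of 2] power_mono[OF d_le[OF mid], of 2]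
        d0 snrm_nonneg diff_mem x H by auto
    also have "\<dots> = 4 * \<delta> * (2 * d + \<delta>)" by (simp add: power2_eq_square algebra_simps)
    finally show ?thesis .
  qed
  have "\<exists>N. \<forall>i\<ge>N. \<forall>j\<ge>N. snrm ip (m i - m j) < e" if "e > 0" for e
  proof -
    have "(\<lambda>n. 4 * (1 / Suc n) * (2 * d + 1 / Suc n)) \<longlonglongrightarrow> 4 * 0 * (2 * d + 0)"
      by (intro tendsto_intros LIMSEQ_inverse_real_of_nat[unfolded inverse_eq_divide])
    then have "eventually (\<lambda>n. 4 * (1 / Suc n) * (2 * d + 1 / Suc n) < e\<^sup>2) sequentially"
      by (rule order_tendstoD(2)) (use that in simp)
    then obtain N where N: "4 * (1 / Suc N) * (2 * d + 1 / Suc N) < e\<^sup>2"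
      by (auto simp: eventually_sequentially)
    have "snrm ip (m i - m j) < e" if "i \<ge> N" "j \<ge> N" for i j
    proof -
      have "1 / Suc i \<le> 1 / Suc N" "1 / Suc j \<le> 1 / Suc N"
        using that by (auto intro!: divide_left_mono)
      then have "(snrm ip (m i - m j))\<^sup>2 \<le> 4 * (1 / Suc N) * (2 * d + 1 / Suc N)"
        using m(2)[of i] m(2)[of j] by (intro close m) auto
      then have "(snrm ip (m i - m j))\<^sup>2 < e\<^sup>2" using N by linarith
      then show ?thesis using \<open>e > 0\<close> by (meson less_imp_le power2_less_imp_less)
    qed
    then show ?thesis by blast
  qed
  then obtain p where p: "p \<in> H" "(\<lambda>n. snrm ip (m n - p)) \<longlonglongrightarrow> 0"
    using complete[of m] mH by blast
  have lim: "(\<lambda>n. snrm ip (m n - p) + c) \<longlonglongrightarrow> c" for c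
    using tendsto_add[OF p(2) tendsto_const[of c]] by simp
  have ge: "d \<le> snrm ip (x - p - y)" if "y \<in> M" for y
  proof (rule LIMSEQ_le_const[OF lim], intro exI allI impI)
    fix n
    have yH: "y \<in> H" using that M by auto
    have "d \<le> snrm ip (x - (m n + y))" using d_le csubspace_add[OF M(1) m(1) that] by blast
    also have "x - (m n + y) = (p - m n) + (x - p - y)" by simp
    also have "snrm ip \<dots> \<le> snrm ip (p - m n) + snrm ip (x - p - y)"
      using p x yH mH by (intro triangle mems)
    finally show "d \<le> snrm ip (m n - p) + snrm ip (x - p - y)"
      using snrm_minus_commute[OF p(1) mH[of n]] by simp
  qed
  have le: "snrm ip (x - p) \<le> d"
  proof (rule LIMSEQ_le_const)
    have "(\<lambda>n. snrm ip (m n - p) + (d + 1 / Suc n)) \<longlonglongrightarrow> 0 + (d + 0)"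
      by (intro tendsto_intros p LIMSEQ_inverse_real_of_nat[unfolded inverse_eq_divide])
    then show "(\<lambda>n. snrm ip (m n - p) + (d + 1 / Suc n)) \<longlonglongrightarrow> d" by simp
    show "\<exists>N. \<forall>n\<ge>N. snrm ip (x - p) \<le> snrm ip (m n - p) + (d + 1 / Suc n)"
    proof (intro exI allI impI)
      fix n
      show "snrm ip (x - p) \<le> snrm ip (m n - p) + (d + 1 / Suc n)"
        using triangle_diff[OF x mH[of n] p(1)] m(2)[of n] by linarith
    qed
  qed
  have "ip (x - p) y = 0" if "y \<in> M" for y
  proof (rule ccontr)
    assume c: "ip (x - p) y \<noteq> 0"
    have yH: "y \<in> H" using that M by auto
    let ?c = "(cmod (ip (x - p) y))\<^sup>2" and ?Y = "(snrm ip y)\<^sup>2"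
    \<comment> \<open>The step length must be at most \<open>1 / ?Y\<close>, where \<open>?Y\<close> may be zero.\<close>
    define s where "s = 1 / (?Y + 1)"
    have s: "s > 0" "s * ?Y \<le> 1" unfolding s_def by (auto simp: add_nonneg_pos divide_simps)
    have "snrm ip (x - p) \<le> snrm ip (x - p - sc (of_real s * ip (x - p) y) y)"
      using le ge csubspace_scale[OF M(1) that] order_trans by blast
    then have "(snrm ip (x - p))\<^sup>2 \<le> (snrm ip (x - p - sc (of_real s * ip (x - p) y) y))\<^sup>2"
      using x p by (intro power_mono snrm_nonneg mems)
    also have "\<dots> = (snrm ip (x - p))\<^sup>2 - 2 * s * ?c + s\<^sup>2 * ?c * ?Y"
      using x p yH by (intro snrm_diff_multiple_sq mems)
    finally have "2 * (s * ?c) \<le> (s * ?c) * (s * ?Y)" by (simp add: power2_eq_square algebra_simps)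
    also have "\<dots> \<le> s * ?c * 1" using s by (intro mult_left_mono) auto
    finally have "s * ?c \<le> 0" by simp
    then show False using s c by (simp add: mult_le_0_iff)
  qed
  then show ?thesis using p m(1) by blast
qed

text \<open>
  A vector orthogonal to the kernel of the functional represents it up to a factor; it is found by
  projecting any vector on which the functional does not vanish.
\<close>

lemma riesz_representation:
  assumes lin: "\<And>x y. x \<in> H \<Longrightarrow> y \<in> H \<Longrightarrow> f (x - y) = f x - f y"
    "\<And>c x. x \<in> H \<Longrightarrow> f (sc c x) = cnj c * f x"
    and bd: "\<And>x. x \<in> H \<Longrightarrow> cmod (f x) \<le> C * snrm ip x"
  shows "\<exists>r\<in>H. \<forall>v\<in>H. ip r v = f v"
proof (cases "\<exists>z\<in>H. f z \<noteq> 0")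
  case False
  have "ip (sc 0 0) v = f v" if "v \<in> H" for v
    using that False by (simp add: ip_rules zero_mem)
  then show ?thesis using scale_mem[OF zero_mem] by blast
next
  case True
  then obtain z where z: "z \<in> H" "f z \<noteq> 0" by blast
  define M where "M = {x \<in> H. f x = 0}"
  have "f 0 = 0" using lin(1)[of 0 0] zero_mem by simp
  then have M: "csubspace sc M" "M \<subseteq> H"
    unfolding csubspace_def M_def using zero_mem by (auto simp: lin intro: diff_mem scale_mem)
  obtain p m where p: "p \<in> H" "\<And>n::nat. m n \<in> M" "(\<lambda>n. snrm ip (m n - p)) \<longlonglongrightarrow> 0"
    "\<And>y. y \<in> M \<Longrightarrow> ip (z - p) y = 0"
    using projection_onto_closure[OF M z(1)] by blast
  have "(\<lambda>n. f (m n)) \<longlonglongrightarrow> f p"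
    by (rule bounded_antilinear_tendsto[OF lin(1) bd _ p(1,3)]) (use p M in auto)
  moreover have "(\<lambda>n. f (m n)) = (\<lambda>n. 0)" using p(2) by (simp add: M_def)
  ultimately have "f p = 0" by (simp add: LIMSEQ_const_iff)
  define y where "y = z - p"
  have y: "y \<in> H" "f y \<noteq> 0" unfolding y_def using z p(1) \<open>f p = 0\<close> by (simp_all add: lin diff_mem)
  have "snrm ip y \<noteq> 0" using bd[OF y(1)] y(2) by auto
  have key: "ip y v = f v / f y * ip y y" if v: "v \<in> H" for v
  proof -
    define c where "c = cnj (f v / f y)"
    have "f (v - sc c y) = 0" using v y by (simp add: c_def lin mems)
    then have "ip y (v - sc c y) = 0" using p(4)[of "v - sc c y"] v y(1) unfolding M_def y_def[symmetric] by (simp add: mems)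
    then show ?thesis using v y by (simp add: ip_rules mems c_def)
  qed
  show ?thesis
  proof (intro bexI ballI)
    show "sc (f y / ip y y) y \<in> H" using y by (simp add: mems)
    show "ip (sc (f y / ip y y) y) v = f v" if v: "v \<in> H" for v
      using y v key[OF v] \<open>snrm ip y \<noteq> 0\<close> by (simp add: ip_rules ip_self)
  qed
qed

text \<open>
  A Hermitian form which is bounded below in the inf-sup sense is solvable: the data for which a
  solution exists form a closed subspace since a solution depends continuously on its datum, and a
  vector orthogonal to this subspace is, the form being Hermitian, in the kernel of the form.
\<close>

lemma hermitian_infsup_solvable:
  assumes b_diff: "\<And>x y v. x \<in> H \<Longrightarrow> y \<in> H \<Longrightarrow> v \<in> H \<Longrightarrow> b (x - y) v = b x v - b y v"
    and b_scale: "\<And>c x v. x \<in> H \<Longrightarrow> v \<in> H \<Longrightarrow> b (sc c x) v = c * b x v"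
    and b_sym: "\<And>x y. x \<in> H \<Longrightarrow> y \<in> H \<Longrightarrow> b y x = cnj (b x y)"
    and b_bd: "\<And>x y. x \<in> H \<Longrightarrow> y \<in> H \<Longrightarrow> cmod (b x y) \<le> B * snrm ip x * snrm ip y"
    and infsup: "\<And>u \<beta>. u \<in> H \<Longrightarrow> 0 \<le> \<beta> \<Longrightarrow> (\<And>v. v \<in> H \<Longrightarrow> cmod (b u v) \<le> \<beta> * snrm ip v) \<Longrightarrow> snrm ip u \<le> \<gamma> * \<beta>"
    and lin: "\<And>x y. x \<in> H \<Longrightarrow> y \<in> H \<Longrightarrow> f (x - y) = f x - f y"
      "\<And>c x. x \<in> H \<Longrightarrow> f (sc c x) = cnj c * f x"
    and bd: "\<And>x. x \<in> H \<Longrightarrow> cmod (f x) \<le> C * snrm ip x"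
  shows "\<exists>u\<in>H. \<forall>v\<in>H. b u v = f v"
proof -
  obtain r where r: "r \<in> H" "\<And>v. v \<in> H \<Longrightarrow> ip r v = f v"
    using riesz_representation[of f C, OF lin bd] by blast
  define M where "M = {w \<in> H. \<exists>u\<in>H. \<forall>v\<in>H. ip w v = b u v}"
  have "b 0 v = 0" if "v \<in> H" for v using b_diff[of 0 0 v] that zero_mem by simp
  moreover have "ip 0 v = 0" if "v \<in> H" for v using ip_diff_left[of 0 0 v] that zero_mem by simp
  ultimately have "0 \<in> M" unfolding M_def using zero_mem by force
  moreover have "w - w' \<in> M" if w: "w \<in> M" "w' \<in> M" for w w'
  proof -
    obtain u u' where "u \<in> H" "u' \<in> H" "\<forall>v\<in>H. ip w v = b u v" "\<forall>v\<in>H. ip w' v = b u' v"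
      using w unfolding M_def by blast
    then show ?thesis unfolding M_def using w
      by (auto simp: M_def ip_rules b_diff mems intro!: bexI[of _ "u - u'"])
  qed
  moreover have "sc c w \<in> M" if w: "w \<in> M" for w c
  proof -
    obtain u where "u \<in> H" "\<forall>v\<in>H. ip w v = b u v" using w unfolding M_def by blast
    then show ?thesis unfolding M_def using w
      by (auto simp: M_def ip_rules b_scale mems intro!: bexI[of _ "sc c u"])
  qed
  ultimately have M: "csubspace sc M" "M \<subseteq> H" unfolding csubspace_def by (auto simp: M_def)
  obtain p w where p: "p \<in> H" "\<And>n::nat. w n \<in> M" "(\<lambda>n. snrm ip (w n - p)) \<longlonglongrightarrow> 0"
    "\<And>y. y \<in> M \<Longrightarrow> ip (r - p) y = 0"
    using projection_onto_closure[OF M r(1)] by blast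
  have wH: "w n \<in> H" for n using p M by auto
  have "\<forall>n. \<exists>u. u \<in> H \<and> (\<forall>v\<in>H. ip (w n) v = b u v)" using p(2) unfolding M_def by blast
  then obtain u where u: "\<And>n. u n \<in> H" "\<And>n v. v \<in> H \<Longrightarrow> ip (w n) v = b (u n) v" by metis
  \<comment> \<open>Solutions depend continuously on the data, so those for the data \<open>w n\<close> form a Cauchy sequence.\<close>
  have stab: "snrm ip (u m - u n) \<le> \<gamma> * snrm ip (w m - w n)" for m n
  proof (rule infsup)
    fix v assume v: "v \<in> H"
    have "b (u m - u n) v = ip (w m - w n) v" using u v wH by (simp add: b_diff ip_rules)
    then show "cmod (b (u m - u n) v) \<le> snrm ip (w m - w n) * snrm ip v"
      using cauchy_schwarz[of "w m - w n" v] v wH by (simp add: diff_mem)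
  qed (simp_all add: u wH snrm_nonneg diff_mem)
  have stab': "snrm ip (u m - u n) \<le> (\<bar>\<gamma>\<bar> + 1) * snrm ip (w m - w n)" for m n
  proof -
    have "\<gamma> * snrm ip (w m - w n) \<le> (\<bar>\<gamma>\<bar> + 1) * snrm ip (w m - w n)"
      by (intro mult_right_mono snrm_nonneg mems wH) auto
    then show ?thesis using stab order_trans by blast
  qed
  have "\<exists>N. \<forall>m\<ge>N. \<forall>n\<ge>N. snrm ip (u m - u n) < e" if "e > 0" for e
  proof -
    define \<delta> where "\<delta> = e / (2 * (\<bar>\<gamma>\<bar> + 1))"
    have \<delta>: "\<delta> > 0" "(\<bar>\<gamma>\<bar> + 1) * (2 * \<delta>) = e"
      unfolding \<delta>_def using that by (auto simp: field_simps)
    have "eventually (\<lambda>n. snrm ip (w n - p) < \<delta>) sequentially"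
      by (rule order_tendstoD(2)[OF p(3) \<delta>(1)])
    then obtain N where N: "\<And>n. n \<ge> N \<Longrightarrow> snrm ip (w n - p) < \<delta>"
      by (auto simp: eventually_sequentially)
    have "snrm ip (u m - u n) < e" if "m \<ge> N" "n \<ge> N" for m n
    proof -
      have "snrm ip (w m - w n) < 2 * \<delta>"
        using triangle_diff[OF wH p(1) wH, of m n] N[OF that(1)] N[OF that(2)]
          snrm_minus_commute[OF p(1) wH[of n]] by linarith
      then have "(\<bar>\<gamma>\<bar> + 1) * snrm ip (w m - w n) < (\<bar>\<gamma>\<bar> + 1) * (2 * \<delta>)"
        by (intro mult_strict_left_mono) auto
      then show ?thesis using stab'[of m n] \<delta>(2) by linarith
    qed
    then show ?thesis by blast
  qed
  then obtain l where l: "l \<in> H" "(\<lambda>n. snrm ip (u n - l)) \<longlonglongrightarrow> 0"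
    using complete[of u] u(1) by blast
  have bl: "b l v = ip p v" if v: "v \<in> H" for v
  proof (rule LIMSEQ_unique)
    show "(\<lambda>n. ip (w n) v) \<longlonglongrightarrow> ip p v" by (rule ip_tendsto_left[OF wH p(1,3) v])
    have "(\<lambda>n. b (u n) v) \<longlonglongrightarrow> b l v"
      by (rule bounded_antilinear_tendsto[where f = "\<lambda>x. b x v" and C = "B * snrm ip v"])
         (use b_bd v u l in \<open>auto simp: b_diff mult_ac\<close>)
    then show "(\<lambda>n. ip (w n) v) \<longlonglongrightarrow> b l v" using u(2)[OF v] by simp
  qed
  \<comment> \<open>The part of the datum outside the closure of \<open>M\<close> is in the kernel of the form, hence negligible.\<close>
  define q where "q = r - p"
  have q: "q \<in> H" unfolding q_def using r p diff_mem by blast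
  have bq: "b q x = 0" if x: "x \<in> H" for x
  proof -
    have "\<exists>rx\<in>H. \<forall>v\<in>H. ip rx v = b x v"
    proof (rule riesz_representation[where f = "b x" and C = "B * snrm ip x"])
      fix y z assume yz: "y \<in> H" "z \<in> H"
      then show "b x (y - z) = b x y - b x z"
        using b_sym[of "y - z" x] b_sym[of y x] b_sym[of z x] x by (simp add: b_diff mems)
    next
      fix c y assume "y \<in> H"
      then show "b x (sc c y) = cnj c * b x y"
        using b_sym[of "sc c y" x] b_sym[of y x] x by (simp add: b_scale mems)
    next
      fix y assume "y \<in> H"
      then show "cmod (b x y) \<le> B * snrm ip x * snrm ip y" using b_bd x by blast
    qed
    then obtain rx where rx: "rx \<in> H" "\<And>v. v \<in> H \<Longrightarrow> ip rx v = b x v" by blast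
    then have "rx \<in> M" unfolding M_def using x by blast
    then have "ip q rx = 0" using p(4) unfolding q_def by blast
    then have "b x q = 0" using rx q ip_sym[of rx q] by simp
    then show ?thesis using b_sym[OF x q] by simp
  qed
  have "snrm ip q \<le> \<gamma> * 0" by (rule infsup[OF q]) (use bq in auto)
  then have "snrm ip q = 0" using snrm_nonneg[OF q] by simp
  have "b l v = f v" if v: "v \<in> H" for v
  proof -
    have "ip q v = 0" using cauchy_schwarz[OF q v] \<open>snrm ip q = 0\<close> by simp
    then show ?thesis using bl[OF v] r v p unfolding q_def by (simp add: ip_rules)
  qed
  then show ?thesis using l(1) by blast
qed

end

section \<open>Smooth functions and bump functions\<close>

lemma pderiv3_eq: "(f has_derivative f') (at x) \<Longrightarrow> pderiv3 i f x = f' (axis i 1)"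
  unfolding pderiv3_def using frechet_derivative_at by metis

lemma C_k_Suc_has_derivative:
  assumes "C_k (Suc k) f" shows "(f has_derivative frechet_derivative f (at x)) (at x)"
  using assms by (simp add: differentiable_on_def frechet_derivative_works)

lemma C_k_Suc_imp: "C_k (Suc k) f \<Longrightarrow> C_k k f"
proof (induction k arbitrary: f)
  case 0
  then show ?case by (simp add: differentiable_imp_continuous_on)
next
  case (Suc k)
  then show ?case by (metis C_k.simps(2))
qed

lemma C_k_continuous: "C_k k f \<Longrightarrow> continuous_on UNIV f"
  by (cases k) (auto intro: differentiable_imp_continuous_on)

lemma C_k_SucI:
  assumes "\<And>x. (f has_derivative f' x) (at x)" "\<And>i. C_k k (\<lambda>x. f' x (axis i 1))"
  shows "C_k (Suc k) f"
proof -
  have "pderiv3 i f = (\<lambda>x. f' x (axis i 1))" for i using pderiv3_eq[OF assms(1)] by auto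
  then show ?thesis using assms by (auto simp: differentiable_on_def differentiable_def)
qed

lemma C_k_const: "C_k k (\<lambda>x. c)"
proof (induction k arbitrary: c)
  case (Suc k)
  show ?case by (rule C_k_SucI[OF has_derivative_const]) (rule Suc)
qed simp

lemma C_k_add: "C_k k f \<Longrightarrow> C_k k g \<Longrightarrow> C_k k (\<lambda>x. f x + g x)"
proof (induction k arbitrary: f g)
  case (Suc k)
  show ?case
    by (rule C_k_SucI[OF has_derivative_add[OF C_k_Suc_has_derivative[OF Suc.prems(1)] C_k_Suc_has_derivative[OF Suc.prems(2)]]])
       (use Suc in \<open>simp flip: pderiv3_def\<close>)
qed (auto intro: continuous_intros)

lemma C_k_mult: "C_k k f \<Longrightarrow> C_k k g \<Longrightarrow> C_k k (\<lambda>x. f x * g x)"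
proof (induction k arbitrary: f g)
  case (Suc k)
  have "C_k k (\<lambda>x. f x * pderiv3 i g x + pderiv3 i f x * g x)" for i
    using Suc.prems by (intro C_k_add Suc.IH C_k_Suc_imp[OF Suc.prems(1)] C_k_Suc_imp[OF Suc.prems(2)]) auto
  then show ?case
    by (intro C_k_SucI[OF has_derivative_mult[OF C_k_Suc_has_derivative[OF Suc.prems(1)] C_k_Suc_has_derivative[OF Suc.prems(2)]]])
       (simp flip: pderiv3_def)
qed (auto intro: continuous_intros)

lemma pderiv3_mult:
  assumes "C_k (Suc k) f" "C_k (Suc k) g"
  shows "pderiv3 i (\<lambda>x. f x * g x) x = f x * pderiv3 i g x + pderiv3 i f x * g x"
  using pderiv3_eq[OF has_derivative_mult[OF C_k_Suc_has_derivative[OF assms(1)] C_k_Suc_has_derivative[OF assms(2)]]]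
  by (simp add: pderiv3_def)

lemma C_k_prod: "finite I \<Longrightarrow> (\<And>i. i \<in> I \<Longrightarrow> C_k k (f i)) \<Longrightarrow> C_k k (\<lambda>x. \<Prod>i\<in>I. f i x)"
  by (induction rule: finite_induct) (auto intro: C_k_const C_k_mult)

lemma pderiv3_cnj:
  assumes "C_k (Suc k) f" shows "pderiv3 i (\<lambda>x. cnj (f x)) x = cnj (pderiv3 i f x)"
  using pderiv3_eq[OF bounded_linear.has_derivative[OF bounded_linear_cnj C_k_Suc_has_derivative[OF assms]]]
  by (simp add: pderiv3_def)

lemma C_k_cnj: "C_k k f \<Longrightarrow> C_k k (\<lambda>x. cnj (f x))"
proof (induction k arbitrary: f)
  case (Suc k)
  show ?case
    by (rule C_k_SucI[OF bounded_linear.has_derivative[OF bounded_linear_cnj C_k_Suc_has_derivative[OF Suc.prems]]])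
       (use Suc in \<open>simp flip: pderiv3_def\<close>)
qed (auto intro: continuous_intros)

lemma has_derivative_coordinate:
  fixes i :: "'n::finite" shows "((\<lambda>x::real^'n. x $ i) has_derivative (\<lambda>h. h $ i)) F"
  by (rule bounded_linear_imp_has_derivative[OF bounded_linear_vec_nth])

lemma continuous_measurable_lebesgue_on:
  fixes f :: "'a::euclidean_space \<Rightarrow> 'b::euclidean_space"
  assumes "continuous_on UNIV f" shows "f \<in> borel_measurable (lebesgue_on D)"
  using borel_measurable_continuous_onI[OF assms]
  by (intro measurable_restrict_space1 measurable_completion) simp

lemma C_k_coordinate:
  fixes i :: 3 shows "C_k k (\<lambda>x. complex_of_real (x $ i))"
proof (cases k)
  case (Suc j)
  have "((\<lambda>x. complex_of_real (x $ i)) has_derivative (\<lambda>h. complex_of_real (h $ i))) (at x)" for x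
    by (intro has_derivative_of_real has_derivative_coordinate)
  then show ?thesis unfolding Suc by (rule C_k_SucI) (rule C_k_const)
qed (auto intro!: continuous_intros)

lemma C_k_affine_compose:
  assumes "\<And>n t. (G n has_real_derivative G (Suc n) t) (at t)"
  shows "C_k k (\<lambda>x. complex_of_real (G n (a * x $ i + b)))"
proof (induction k arbitrary: n)
  case 0
  have "continuous_on UNIV (G n)" for n
    using assms DERIV_isCont continuous_at_imp_continuous_on by blast
  then have "continuous_on UNIV (\<lambda>x::real^3. G n (a * x $ i + b))"
    by (rule continuous_on_compose2) (auto intro!: continuous_intros)
  then show ?case by (simp add: continuous_on_of_real)
next
  case (Suc k)
  have "((\<lambda>x. complex_of_real (G n (a * x $ i + b))) has_derivative
      (\<lambda>h. complex_of_real (G (Suc n) (a * x $ i + b)) * complex_of_real (a * h $ i))) (at x)" for x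
  proof -
    have "((\<lambda>x. G n (a * x $ i + b)) has_derivative (\<lambda>h. G (Suc n) (a * x $ i + b) * (a * h $ i))) (at x)"
      by (rule has_derivative_compose[OF _ assms[unfolded has_field_derivative_def], unfolded o_def])
         (auto intro!: derivative_eq_intros has_derivative_coordinate)
    from bounded_linear.has_derivative[OF bounded_linear_of_real this] show ?thesis by simp
  qed
  then show ?case by (rule C_k_SucI) (intro C_k_mult C_k_const Suc.IH)
qed

text \<open>The derivatives of \<open>exp (- 1 / t)\<close> are this function times polynomials in \<open>1 / t\<close>.\<close>

primrec flat_poly :: "nat \<Rightarrow> real poly" where
  "flat_poly 0 = 1"
| "flat_poly (Suc n) = [:0, 0, 1:] * (flat_poly n - pderiv (flat_poly n))"

definition flat :: "nat \<Rightarrow> real \<Rightarrow> real" where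
  "flat n t = (if t \<le> 0 then 0 else poly (flat_poly n) (inverse t) * exp (- inverse t))"

lemma poly_times_exp_neg_tendsto_0: "((\<lambda>t. poly p t * exp (- t)) \<longlongrightarrow> (0::real)) at_top"
proof -
  have "((\<lambda>t. \<Sum>i\<le>degree p. coeff p i * (t ^ i / exp t)) \<longlongrightarrow> (\<Sum>i\<le>degree p. coeff p i * 0)) at_top"
    by (intro tendsto_intros tendsto_power_div_exp_0)
  moreover have "(\<lambda>t. \<Sum>i\<le>degree p. coeff p i * (t ^ i / exp t)) = (\<lambda>t. poly p t * exp (- t))"
    by (auto simp: poly_altdef sum_distrib_right sum_divide_distrib exp_minus field_simps)
  ultimately show ?thesis by simp
qed

text \<open>All derivatives vanish at the origin, since the exponential decays faster than any power of \<open>1 / t\<close> grows.\<close>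

lemma flat_has_derivative: "(flat n has_real_derivative flat (Suc n) t) (at t)"
proof -
  consider "t < 0" | "t = 0" | "t > 0" by linarith
  then show ?thesis
  proof cases
    case 1
    have "(flat n has_real_derivative 0) (at t)"
      by (rule has_field_derivative_transform_within_open[of "\<lambda>_. 0" _ _ "{..<0}"])
         (use 1 in \<open>auto simp: flat_def\<close>)
    then show ?thesis using 1 by (simp add: flat_def)
  next
    case 3
    have "((\<lambda>t. poly (flat_poly n) (inverse t) * exp (- inverse t)) has_real_derivative flat (Suc n) t) (at t)"
      using 3 by (auto intro!: derivative_eq_intros simp: flat_def field_simps power2_eq_square)
    then show ?thesis
      by (rule has_field_derivative_transform_within_open[of _ _ _ "{0<..}"])
         (use 3 in \<open>auto simp: flat_def\<close>)
  next
    case 2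
    have "((\<lambda>h. (flat n (0 + h) - flat n 0) / h) \<longlongrightarrow> 0) (at 0)"
    proof (rule filterlim_split_at)
      have "eventually (\<lambda>h::real. h < 0) (at_left 0)" by (auto simp: eventually_at_filter)
      then have "eventually (\<lambda>h::real. (flat n (0 + h) - flat n 0) / h = 0) (at_left 0)"
        by eventually_elim (simp add: flat_def)
      then show "((\<lambda>h. (flat n (0 + h) - flat n 0) / h) \<longlongrightarrow> 0) (at_left 0)"
        by (rule tendsto_eventually)
      have "((\<lambda>h. poly (pCons 0 (flat_poly n)) (inverse h) * exp (- inverse h)) \<longlongrightarrow> 0) (at_right 0)"
        by (rule filterlim_compose[OF poly_times_exp_neg_tendsto_0 filterlim_inverse_at_top_right])
      moreover have "eventually (\<lambda>h::real. h > 0) (at_right 0)" by (auto simp: eventually_at_filter)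
      then have "eventually (\<lambda>h. poly (pCons 0 (flat_poly n)) (inverse h) * exp (- inverse h)
          = (flat n (0 + h) - flat n 0) / h) (at_right 0)"
        by eventually_elim (simp add: flat_def field_simps)
      ultimately show "((\<lambda>h. (flat n (0 + h) - flat n 0) / h) \<longlongrightarrow> 0) (at_right 0)"
        by (rule Lim_transform_eventually)
    qed
    then show ?thesis using 2 by (simp add: DERIV_def flat_def)
  qed
qed

text \<open>
  As \<open>m\<close> grows these smooth functions, supported in a fixed box, increase to its indicator function.
\<close>

definition box_bump :: "real^3 \<Rightarrow> real^3 \<Rightarrow> nat \<Rightarrow> real^3 \<Rightarrow> complex" where
  "box_bump a b m x = (\<Prod>i\<in>UNIV. of_real (flat 0 (m * x $ i + (- m * a $ i))) *
     of_real (flat 0 (- m * x $ i + m * b $ i)))"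

lemma flat_0_bounds: "0 \<le> flat 0 t" "flat 0 t \<le> 1"
  by (auto simp: flat_def)

lemma box_bump_eq_0: "x \<notin> box a b \<Longrightarrow> box_bump a b m x = 0"
proof -
  assume "x \<notin> box a b"
  then obtain i where "x $ i \<le> a $ i \<or> b $ i \<le> x $ i"
    by (auto simp: mem_box_cart not_less)
  then have "real m * x $ i \<le> real m * a $ i \<or> real m * b $ i \<le> real m * x $ i"
    by (auto intro: mult_left_mono)
  then show ?thesis unfolding box_bump_def by (intro prod_zero bexI[of _ i]) (auto simp: flat_def)
qed

lemma box_bump_le_1: "cmod (box_bump a b m x) \<le> 1"
  unfolding box_bump_def prod_norm[symmetric]
  by (rule prod_le_1) (auto simp: norm_mult flat_0_bounds intro!: mult_le_one)

lemma box_bump_smooth: "C_k k (box_bump a b m)"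
  unfolding box_bump_def[abs_def]
  by (intro C_k_prod C_k_mult C_k_affine_compose[of flat, OF flat_has_derivative]) auto

lemma box_bump_test_function: "cbox a b \<subseteq> D \<Longrightarrow> box_bump a b m \<in> test_functions D"
  unfolding test_functions_def using box_bump_smooth box_subset_cbox[of a b]
  by (auto intro!: exI[of _ "cbox a b"] box_bump_eq_0)

lemma box_bump_tendsto: "(\<lambda>m. box_bump a b m x) \<longlonglongrightarrow> indicator (box a b) x"
proof (cases "x \<in> box a b")
  case False
  then show ?thesis by (simp add: box_bump_eq_0)
next
  case True
  have *: "(\<lambda>m. flat 0 (real m * s)) \<longlonglongrightarrow> 1" if "s > 0" for s
  proof (rule Lim_transform_eventually)
    have "(\<lambda>m. exp (- inverse (real m) * inverse s)) \<longlonglongrightarrow> exp (- 0 * inverse s)"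
      by (intro tendsto_intros lim_inverse_n)
    then show "(\<lambda>m. exp (- inverse (real m) * inverse s)) \<longlonglongrightarrow> 1" by simp
    show "eventually (\<lambda>m. exp (- inverse (real m) * inverse s) = flat 0 (real m * s)) sequentially"
      using eventually_gt_at_top[of 0] by eventually_elim (use that in \<open>auto simp: flat_def mult_le_0_iff\<close>)
  qed
  have **: "real m * x $ i + (- real m * a $ i) = real m * (x $ i - a $ i)"
    "- real m * x $ i + real m * b $ i = real m * (b $ i - x $ i)" for m i
    by (auto simp: algebra_simps)
  have "(\<lambda>m. box_bump a b m x) \<longlonglongrightarrow> (\<Prod>i\<in>(UNIV::3 set). of_real 1 * of_real 1)"
    unfolding box_bump_def ** using True
    by (intro tendsto_prod tendsto_mult tendsto_of_real *) (auto simp: mem_box_cart)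
  then show ?thesis using True by simp
qed

section \<open>The fundamental lemma of the calculus of variations\<close>

text \<open>
  Testing with the bump functions of a box shows that \<open>g\<close> has integral zero over every box in \<open>D\<close>.
  Almost everywhere, the value of \<open>g\<close> is the limit of its averages over shrinking boxes.
\<close>

lemma fundamental_lemma:
  fixes g :: sfield
  assumes D: "open D" and g: "integrable (lebesgue_on D) g"
    and zero: "\<And>\<phi>. \<phi> \<in> test_functions D \<Longrightarrow> (LINT x|lebesgue_on D. g x * \<phi> x) = 0"
  shows "AE x in lebesgue_on D. g x = 0"
proof -
  define G where "G = (\<lambda>x. if x \<in> D then g x else 0)"
  have sD: "D \<in> sets lebesgue" using D by auto
  have G: "integrable lebesgue G" unfolding G_def using g sD by (simp add: Lebesgue_Measure.integrable_restrict_UNIV)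
  have box0: "integral (cbox a b) G = 0" if "cbox a b \<subseteq> D" for a b
  proof -
    have "(\<lambda>m. LINT x|lebesgue_on D. g x * box_bump a b m x) \<longlonglongrightarrow> (LINT x|lebesgue_on D. g x * indicator (box a b) x)"
    proof (rule integral_dominated_convergence[where w = "\<lambda>x. norm (g x)"])
      have bm: "box_bump a b m \<in> borel_measurable (lebesgue_on D)" for m
        by (rule continuous_measurable_lebesgue_on[OF C_k_continuous[OF box_bump_smooth]])
      then show "(\<lambda>x. g x * box_bump a b m x) \<in> borel_measurable (lebesgue_on D)" for m
        using g by (intro borel_measurable_times) auto
      have "box a b \<in> sets lebesgue" by auto
      then have "(indicator (box a b) :: _ \<Rightarrow> complex) \<in> borel_measurable (lebesgue_on D)"
        by (intro measurable_restrict_space1 borel_measurable_indicator)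
      then show "(\<lambda>x. g x * indicator (box a b) x) \<in> borel_measurable (lebesgue_on D)"
        using g by (intro borel_measurable_times) auto
      show "AE x in lebesgue_on D. (\<lambda>m. g x * box_bump a b m x) \<longlonglongrightarrow> g x * indicator (box a b) x"
        by (auto intro!: tendsto_intros box_bump_tendsto)
      show "AE x in lebesgue_on D. norm (g x * box_bump a b m x) \<le> norm (g x)" for m
        using box_bump_le_1[of a b m] by (intro AE_I2) (simp add: norm_mult mult_left_le)
    qed (use g in auto)
    then have *: "(LINT x|lebesgue_on D. g x * indicator (box a b) x) = 0"
      using zero[OF box_bump_test_function[OF that]] by (simp add: LIMSEQ_const_iff)
    have bD: "box a b \<subseteq> D" using that box_subset_cbox by blast
    have "integral\<^sup>L (lebesgue_on (box a b)) g = (LINT x|lebesgue_on D. (if x \<in> box a b then g x else 0))"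
      using Lebesgue_Measure.integral_restrict[OF bD, of g] sD by auto
    also have "\<dots> = (LINT x|lebesgue_on D. g x * indicator (box a b) x)"
      by (intro Bochner_Integration.integral_cong) auto
    finally have "integral\<^sup>L (lebesgue_on (box a b)) g = 0" using * by simp
    moreover have "integral\<^sup>L (lebesgue_on (box a b)) G = integral\<^sup>L (lebesgue_on (box a b)) g"
      using bD by (intro Bochner_Integration.integral_cong) (auto simp: G_def)
    moreover have "integrable (lebesgue_on (box a b)) G"
      using G by (auto simp: integrable_restrict_space intro: integrable_mult_indicator)
    then have "integral\<^sup>L (lebesgue_on (box a b)) G = integral (box a b) G"
      by (intro lebesgue_integral_eq_integral) auto
    ultimately show ?thesis by (simp add: integral_open_interval)
  qed
  have "G integrable_on cbox a b" for a b
    using G by (intro integrable_on_lebesgue_on) (auto simp: integrable_restrict_space intro: integrable_mult_indicator)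
  then obtain N where N: "negligible N"
    "\<And>x e. x \<notin> N \<Longrightarrow> 0 < e \<Longrightarrow> \<exists>d>0. \<forall>h. 0 < h \<and> h < d \<longrightarrow>
       norm (integral (cbox x (x + h *\<^sub>R One)) G /\<^sub>R h ^ DIM(real^3) - G x) < e"
    using integrable_ccontinuous_explicit by blast
  have "g x = 0" if x: "x \<in> D" "x \<notin> N" for x
  proof -
    obtain r where r: "r > 0" "cball x r \<subseteq> D" using D x open_contains_cball by blast
    have sub: "cbox x (x + h *\<^sub>R One) \<subseteq> D" if "0 < h" "h * norm (One::real^3) < r" for h
    proof
      fix y assume y: "y \<in> cbox x (x + h *\<^sub>R One)"
      have "norm (y - x) \<le> norm (h *\<^sub>R (One::real^3))"
      proof (rule norm_le_componentwise)
        fix i :: "real^3" assume "i \<in> Basis"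
        then show "\<bar>(y - x) \<bullet> i\<bar> \<le> \<bar>(h *\<^sub>R One) \<bullet> i\<bar>"
          using y \<open>0 < h\<close> by (auto simp: mem_box inner_diff_left inner_add_left)
      qed
      then show "y \<in> D" using r that by (auto simp: dist_norm norm_minus_commute)
    qed
    have "norm (g x) < e" if "e > 0" for e
    proof -
      obtain d where d: "d > 0" "\<And>h. 0 < h \<and> h < d \<Longrightarrow>
          norm (integral (cbox x (x + h *\<^sub>R One)) G /\<^sub>R h ^ DIM(real^3) - G x) < e"
        using N(2)[OF x(2) \<open>e > 0\<close>] by blast
      define h where "h = min (d / 2) (r / (2 * (norm (One::real^3) + 1)))"
      have p: "norm (One::real^3) + 1 > 0" by (simp add: add_nonneg_pos)
      have h: "0 < h" "h < d" using d(1) r(1) p by (auto simp: h_def)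
      have "h * norm (One::real^3) \<le> r / (2 * (norm (One::real^3) + 1)) * (norm (One::real^3) + 1)"
        using r(1) p by (intro mult_mono) (auto simp: h_def)
      also have "\<dots> = r / 2" using p by (simp add: field_simps)
      also have "\<dots> < r" using r by simp
      finally have "integral (cbox x (x + h *\<^sub>R One)) G = 0" using sub[OF h(1)] box0 by blast
      then show ?thesis using d(2)[of h] h x by (simp add: G_def)
    qed
    then show ?thesis by (metis less_irrefl zero_less_norm_iff)
  qed
  moreover have "AE x in lebesgue. x \<notin> N"
    using N(1) by (simp add: negligible_iff_null_sets AE_not_in)
  then have "AE x in lebesgue_on D. x \<notin> N"
    using sD by (auto simp: AE_restrict_space_iff)
  ultimately show ?thesis by (auto elim: lebesgue_on_mono)
qed

section \<open>Integration by parts\<close>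

lemma integrable_lebesgue_on_subset:
  fixes f :: "'a::euclidean_space \<Rightarrow> 'b::{banach, second_countable_topology}"
  assumes "integrable lebesgue f" "D \<in> sets lebesgue"
  shows "integrable (lebesgue_on D) f"
  using assms by (auto simp: integrable_restrict_space intro: integrable_mult_indicator)

lemma integrable_compact_support:
  fixes f :: "'a::euclidean_space \<Rightarrow> 'b::euclidean_space"
  assumes "continuous_on UNIV f" "compact K" "\<And>x. x \<notin> K \<Longrightarrow> f x = 0"
  shows "integrable lebesgue f"
proof -
  have "integrable lborel (\<lambda>x. indicator K x *\<^sub>R f x)"
    by (rule borel_integrable_compact[OF assms(2) continuous_on_subset[OF assms(1)]]) simp
  also have "(\<lambda>x. indicator K x *\<^sub>R f x) = f"
    using assms(3) by (auto simp: indicator_def)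
  finally show ?thesis
    by (subst integrable_completion) (auto intro: borel_measurable_continuous_onI assms)
qed

lemma pderiv3_eq_0:
  assumes "closed K" "\<And>x. x \<notin> K \<Longrightarrow> f x = 0" "x \<notin> K"
  shows "pderiv3 i f x = 0"
proof -
  have "(f has_derivative (\<lambda>_. 0)) (at x)"
    by (rule has_derivative_transform_within_open[of "\<lambda>_. 0" "\<lambda>_. 0" x UNIV "- K"]) (use assms in auto)
  from pderiv3_eq[OF this] show ?thesis by simp
qed

text \<open>
  The difference quotients of \<open>f\<close> have integral zero since the Lebesgue measure is invariant under
  translations; they converge boundedly to the partial derivative.
\<close>

lemma integral_pderiv3_compact_support:
  assumes f: "C_k (Suc 0) f" and K: "compact K" "\<And>x. x \<notin> K \<Longrightarrow> f x = 0"
  shows "integral\<^sup>L lebesgue (pderiv3 i f) = 0"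
proof -
  let ?e = "axis i 1 :: real^3"
  define s where "s n x = real (Suc n) *\<^sub>R (f (x + (1 / Suc n) *\<^sub>R ?e) - f x)" for n x
  have cf: "continuous_on UNIV f" and cd: "continuous_on UNIV (pderiv3 i f)"
    using C_k_continuous[OF f] f by auto
  have "bounded (pderiv3 i f ` K)"
    by (intro compact_imp_bounded compact_continuous_image continuous_on_subset[OF cd] K) simp
  then obtain B where B: "\<And>x. x \<in> K \<Longrightarrow> cmod (pderiv3 i f x) \<le> B" "B > 0"
    by (auto simp: bounded_pos)
  have B': "cmod (pderiv3 i f x) \<le> B" for x
    using B pderiv3_eq_0[OF compact_imp_closed[OF K(1)] K(2), of _ x i] by (cases "x \<in> K") auto
  obtain R where R: "\<And>x. x \<in> K \<Longrightarrow> norm x \<le> R"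
    using compact_imp_bounded[OF K(1)] by (auto simp: bounded_iff)
  have quotient_bound: "cmod (f (x + h *\<^sub>R ?e) - f x) \<le> B * \<bar>h\<bar>" for x h
  proof -
    define g where "g t = f (x + t *\<^sub>R ?e)" for t :: real
    have D: "(g has_derivative (\<lambda>r. frechet_derivative f (at (x + t *\<^sub>R ?e)) (r *\<^sub>R ?e))) (at t)" for t
      unfolding g_def
      by (rule has_derivative_compose[OF _ C_k_Suc_has_derivative[OF f], unfolded o_def])
         (auto intro!: derivative_eq_intros)
    have lin: "linear (frechet_derivative f (at y))" for y
      using C_k_Suc_has_derivative[OF f] has_derivative_linear by blast
    have "norm (g h - g 0) \<le> B * norm (h - 0)"
    proof (rule differentiable_bound[where S = UNIV])
      fix t
      show "(g has_derivative (\<lambda>r. frechet_derivative f (at (x + t *\<^sub>R ?e)) (r *\<^sub>R ?e))) (at t within UNIV)"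
        using D by simp
      show "onorm (\<lambda>r. frechet_derivative f (at (x + t *\<^sub>R ?e)) (r *\<^sub>R ?e)) \<le> B"
      proof (rule onorm_le)
        fix r
        show "norm (frechet_derivative f (at (x + t *\<^sub>R ?e)) (r *\<^sub>R ?e)) \<le> B * norm r"
          using B'[of "x + t *\<^sub>R ?e"] mult_left_mono[OF B'[of "x + t *\<^sub>R ?e"], of "\<bar>r\<bar>"]
          by (simp add: linear_cmul[OF lin] pderiv3_def mult.commute)
      qed
    qed auto
    then show ?thesis by (simp add: g_def)
  qed
  have f_int: "integrable lebesgue f" by (rule integrable_compact_support[OF cf K])
  have shift_cont: "continuous_on UNIV (\<lambda>x. f (x + c))" for c
    by (intro continuous_on_compose2[OF cf] continuous_intros) auto
  have shift_int: "integrable lebesgue (\<lambda>x. f (x + c))" for c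
  proof (rule integrable_compact_support[OF shift_cont])
    show "compact ((\<lambda>x. x - c) ` K)" by (intro compact_continuous_image K continuous_intros)
    show "f (x + c) = 0" if "x \<notin> (\<lambda>x. x - c) ` K" for x
    proof (rule K(2))
      show "x + c \<notin> K" using that by (metis add_diff_cancel_right' image_eqI)
    qed
  qed
  have shift: "integral\<^sup>L lebesgue (\<lambda>x. f (x + c)) = integral\<^sup>L lebesgue f" for c
  proof -
    have m: "f \<in> borel_measurable lborel" "(\<lambda>x. f (x + c)) \<in> borel_measurable lborel"
      using borel_measurable_continuous_onI[OF cf] borel_measurable_continuous_onI[OF shift_cont] by auto
    have "integral\<^sup>L lborel f = integral\<^sup>L (distr lborel borel ((+) c)) f"
      by (simp add: lborel_distr_plus)
    also have "\<dots> = integral\<^sup>L lborel (\<lambda>x. f (c + x))"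
      using m by (intro integral_distr) auto
    finally show ?thesis using m by (simp add: integral_completion add.commute)
  qed
  have s0: "integral\<^sup>L lebesgue (s n) = 0" for n
    unfolding s_def using f_int shift_int shift by simp
  have "(\<lambda>n. integral\<^sup>L lebesgue (s n)) \<longlonglongrightarrow> integral\<^sup>L lebesgue (pderiv3 i f)"
  proof (rule integral_dominated_convergence[where w = "\<lambda>x. B * indicator (cball 0 (R + 1)) x"])
    show "pderiv3 i f \<in> borel_measurable lebesgue"
      using continuous_measurable_lebesgue_on[OF cd, of UNIV] by (simp add: lebesgue_on_UNIV_eq)
    show "s n \<in> borel_measurable lebesgue" for n
      unfolding s_def using f_int shift_int by (intro borel_measurable_integrable) auto
    show "integrable lebesgue (\<lambda>x. B * indicator (cball 0 (R + 1)) x)"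
      using lmeasurable_cball[of 0 "R + 1"]
      by (intro integrable_mult_right integrable_real_indicator) (auto simp: fmeasurable_def)
    show "AE x in lebesgue. (\<lambda>n. s n x) \<longlonglongrightarrow> pderiv3 i f x"
    proof (intro AE_I2)
      fix x
      have "((\<lambda>t. f (x + t *\<^sub>R ?e)) has_vector_derivative pderiv3 i f x) (at 0)"
      proof -
        have "((\<lambda>t. f (x + t *\<^sub>R ?e)) has_derivative (\<lambda>r. frechet_derivative f (at (x + 0 *\<^sub>R ?e)) (r *\<^sub>R ?e))) (at 0)"
          by (rule has_derivative_compose[OF _ C_k_Suc_has_derivative[OF f], unfolded o_def])
             (auto intro!: derivative_eq_intros)
        moreover have "linear (frechet_derivative f (at x))"
          using C_k_Suc_has_derivative[OF f] has_derivative_linear by blast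
        ultimately show ?thesis
          by (simp add: has_vector_derivative_def linear_cmul pderiv3_def)
      qed
      then have *: "((\<lambda>t. norm (f (x + t *\<^sub>R ?e) - f x - t *\<^sub>R pderiv3 i f x) / norm t) \<longlongrightarrow> 0) (at 0)"
        by (simp add: has_vector_derivative_def has_derivative_at)
      have "((\<lambda>t. norm (inverse t *\<^sub>R (f (x + t *\<^sub>R ?e) - f x) - pderiv3 i f x)) \<longlongrightarrow> 0) (at 0)"
      proof (rule Lim_transform_eventually[OF *])
        have "norm (f (x + t *\<^sub>R ?e) - f x - t *\<^sub>R pderiv3 i f x) / norm t
          = norm (inverse t *\<^sub>R (f (x + t *\<^sub>R ?e) - f x) - pderiv3 i f x)" if "t \<noteq> 0" for t
        proof -
          have "inverse t *\<^sub>R (f (x + t *\<^sub>R ?e) - f x) - pderiv3 i f x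
            = inverse t *\<^sub>R (f (x + t *\<^sub>R ?e) - f x - t *\<^sub>R pderiv3 i f x)"
            using that by (simp add: scaleR_diff_right)
          then show ?thesis by (simp only: norm_scaleR) (simp add: divide_inverse mult.commute)
        qed
        then show "eventually (\<lambda>t. norm (f (x + t *\<^sub>R ?e) - f x - t *\<^sub>R pderiv3 i f x) / norm t
          = norm (inverse t *\<^sub>R (f (x + t *\<^sub>R ?e) - f x) - pderiv3 i f x)) (at 0)"
          by (auto simp: eventually_at_filter)
      qed
      then have lim: "((\<lambda>t. inverse t *\<^sub>R (f (x + t *\<^sub>R ?e) - f x)) \<longlongrightarrow> pderiv3 i f x) (at 0)"
        by (rule LIM_zero_cancel[OF tendsto_norm_zero_cancel])
      have "filterlim (\<lambda>n. 1 / real (Suc n)) (at 0) sequentially"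
        unfolding filterlim_at using LIMSEQ_inverse_real_of_nat
        by (auto simp: inverse_eq_divide simp del: of_nat_Suc)
      from filterlim_compose[OF lim this] show "(\<lambda>n. s n x) \<longlonglongrightarrow> pderiv3 i f x"
        by (simp add: s_def)
    qed
    show "AE x in lebesgue. norm (s n x) \<le> B * indicator (cball 0 (R + 1)) x" for n
    proof (intro AE_I2)
      fix x
      have "norm (s n x) \<le> real (Suc n) * (B * \<bar>1 / Suc n\<bar>)"
        unfolding s_def norm_scaleR by (intro mult_mono quotient_bound) auto
      then have le: "norm (s n x) \<le> B" by simp
      show "norm (s n x) \<le> B * indicator (cball 0 (R + 1)) x"
      proof (cases "x \<in> cball 0 (R + 1)")
        case True
        then show ?thesis using le by simp
      next
        case False
        have "norm x \<le> norm (x + (1 / Suc n) *\<^sub>R ?e) + norm ((1 / Suc n) *\<^sub>R ?e)"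
          by (metis norm_triangle_sub add_diff_cancel_left' norm_minus_commute add.commute)
        moreover have "norm ((1 / Suc n) *\<^sub>R ?e) \<le> 1" by simp
        ultimately have "norm x \<le> norm (x + (1 / Suc n) *\<^sub>R ?e) + 1" by linarith
        then have "x + (1 / Suc n) *\<^sub>R ?e \<notin> K" using False R by fastforce
        moreover have "x \<notin> K" using False R by fastforce
        ultimately show ?thesis using K(2) False by (simp add: s_def)
      qed
    qed
  qed
  then show ?thesis using s0 by (simp add: LIMSEQ_const_iff)
qed

lemma test_function_smooth: "\<phi> \<in> test_functions D \<Longrightarrow> C_k k \<phi>"
  by (simp add: test_functions_def)

lemma integral_lebesgue_on_support:
  fixes f :: "'a::euclidean_space \<Rightarrow> 'b::euclidean_space"
  assumes "\<And>x. x \<notin> D \<Longrightarrow> f x = 0" "D \<in> sets lebesgue"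
  shows "integral\<^sup>L (lebesgue_on D) f = integral\<^sup>L lebesgue f"
proof -
  have "(\<lambda>x. if x \<in> D then f x else 0) = f" using assms(1) by auto
  then show ?thesis using Lebesgue_Measure.integral_restrict_UNIV[OF assms(2), of f] by simp
qed

lemma integrable_times_test_function:
  assumes "continuous_on UNIV u" "\<phi> \<in> test_functions D" "D \<in> sets lebesgue"
  shows "integrable (lebesgue_on D) (\<lambda>x. u x * \<phi> x)" "integrable (lebesgue_on D) (\<lambda>x. u x * pderiv3 i \<phi> x)"
proof -
  obtain K where K: "compact K" "\<And>x. x \<notin> K \<Longrightarrow> \<phi> x = 0"
    using assms(2) by (auto simp: test_functions_def)
  have c: "continuous_on UNIV \<phi>" "continuous_on UNIV (pderiv3 i \<phi>)"
    using C_k_continuous[OF test_function_smooth[OF assms(2)]] test_function_smooth[OF assms(2), of "Suc 0"]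
    by simp_all
  show "integrable (lebesgue_on D) (\<lambda>x. u x * \<phi> x)"
    by (rule integrable_lebesgue_on_subset[OF integrable_compact_support[OF _ K(1)] assms(3)])
       (use K c assms(1) in \<open>auto intro!: continuous_intros\<close>)
  show "integrable (lebesgue_on D) (\<lambda>x. u x * pderiv3 i \<phi> x)"
    by (rule integrable_lebesgue_on_subset[OF integrable_compact_support[OF _ K(1)] assms(3)])
       (use c assms(1) pderiv3_eq_0[OF compact_imp_closed[OF K(1)] K(2)] in \<open>auto intro!: continuous_intros\<close>)
qed

text \<open>The product with a test function has compact support, so its partial derivatives have integral zero.\<close>

lemma integration_by_parts:
  assumes u: "C_k (Suc 0) u" and \<phi>: "\<phi> \<in> test_functions D" and D: "D \<in> sets lebesgue"
  shows "(LINT x|lebesgue_on D. u x * pderiv3 i \<phi> x) = - (LINT x|lebesgue_on D. pderiv3 i u x * \<phi> x)"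
proof -
  obtain K where K: "compact K" "K \<subseteq> D" "\<And>x. x \<notin> K \<Longrightarrow> \<phi> x = 0"
    using \<phi> by (auto simp: test_functions_def)
  have cu: "continuous_on UNIV u" "continuous_on UNIV (pderiv3 i u)"
    using C_k_continuous[OF u] u by auto
  have "integral\<^sup>L lebesgue (pderiv3 i (\<lambda>x. u x * \<phi> x)) = 0"
    by (rule integral_pderiv3_compact_support[OF C_k_mult[OF u test_function_smooth[OF \<phi>]] K(1)]) (simp add: K)
  moreover have "integral\<^sup>L (lebesgue_on D) (pderiv3 i (\<lambda>x. u x * \<phi> x)) = integral\<^sup>L lebesgue (pderiv3 i (\<lambda>x. u x * \<phi> x))"
    by (rule integral_lebesgue_on_support[OF _ D], rule pderiv3_eq_0[OF compact_imp_closed[OF K(1)]]) (use K in auto)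
  moreover have "pderiv3 i (\<lambda>x. u x * \<phi> x) = (\<lambda>x. u x * pderiv3 i \<phi> x + pderiv3 i u x * \<phi> x)"
    using pderiv3_mult[OF u test_function_smooth[OF \<phi>]] by auto
  ultimately have "(LINT x|lebesgue_on D. u x * pderiv3 i \<phi> x + pderiv3 i u x * \<phi> x) = 0"
    by simp
  then show ?thesis
    using integrable_times_test_function[OF _ \<phi> D] cu by (simp add: add_eq_0_iff2)
qed

lemma bdot_3: "bdot u v = u $ 1 * v $ 1 + u $ 2 * v $ 2 + u $ 3 * v $ 3"
  by (simp add: bdot_def sum_3)

lemma has_weak_curl_classical:
  assumes u: "\<And>i. C_k (Suc 0) (\<lambda>x. u x $ i)" and D: "D \<in> sets lebesgue"
  shows "has_weak_curl D u (classical_curl u)"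
  unfolding has_weak_curl_def
proof
  fix \<psi> assume "\<psi> \<in> test_fields D"
  then have \<psi>: "(\<lambda>x. \<psi> x $ i) \<in> test_functions D" for i by (auto simp: test_fields_def)
  have cu: "continuous_on UNIV (\<lambda>x. u x $ i)" "continuous_on UNIV (pderiv3 j (\<lambda>x. u x $ i))" for i j
    using C_k_continuous[OF u] u[of i] by auto
  note int = integrable_times_test_function[OF _ \<psi> D, OF cu(1)] integrable_times_test_function(1)[OF _ \<psi> D, OF cu(2)]
  note parts = integration_by_parts[OF u \<psi> D]
  show "integral\<^sup>L (lebesgue_on D) (\<lambda>x. bdot (u x) (classical_curl \<psi> x)) =
        integral\<^sup>L (lebesgue_on D) (\<lambda>x. bdot (classical_curl u x) (\<psi> x))"
    unfolding bdot_3 classical_curl_def vector_3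
    by (simp add: left_diff_distrib right_diff_distrib int parts)
qed

section \<open>Square-integrable fields\<close>

lemma L2_measurable: "u \<in> L2 D \<Longrightarrow> u \<in> borel_measurable (lebesgue_on D)"
  and L2_integrable: "u \<in> L2 D \<Longrightarrow> integrable (lebesgue_on D) (\<lambda>x. (norm (u x))\<^sup>2)"
  by (auto simp: L2_def)

lemma L2_dominated:
  assumes "u \<in> borel_measurable (lebesgue_on D)" "integrable (lebesgue_on D) g"
    "AE x in lebesgue_on D. (norm (u x))\<^sup>2 \<le> g x"
  shows "u \<in> L2 D"
proof -
  have "integrable (lebesgue_on D) (\<lambda>x. (norm (u x))\<^sup>2)"
    by (rule Bochner_Integration.integrable_bound[OF assms(2)]) (use assms in \<open>auto elim!: eventually_mono\<close>)
  then show ?thesis using assms(1) by (simp add: L2_def)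
qed

lemma norm_diff_sq_le: "(norm (a - b))\<^sup>2 \<le> 2 * (norm a)\<^sup>2 + 2 * (norm (b :: 'a::real_normed_vector))\<^sup>2"
proof -
  have "(norm (a - b))\<^sup>2 \<le> (norm a + norm b)\<^sup>2" by (intro power_mono norm_triangle_ineq4) simp
  also have "\<dots> \<le> 2 * (norm a)\<^sup>2 + 2 * (norm b)\<^sup>2"
    using sum_squares_bound[of "norm a" "norm b"] by (simp add: power2_sum)
  finally show ?thesis .
qed

lemma L2_diff: "u \<in> L2 D \<Longrightarrow> v \<in> L2 D \<Longrightarrow> u - v \<in> L2 D"
  by (rule L2_dominated[of _ _ "\<lambda>x. 2 * (norm (u x))\<^sup>2 + 2 * (norm (v x))\<^sup>2"])
     (auto simp: fun_diff_def norm_diff_sq_le L2_def)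

text \<open>
  Along a fast Cauchy sequence with increments \<open>d\<^sub>k\<close>, the series of \<open>2\<^sup>k |d\<^sub>k|\<^sup>2\<close> is integrable, hence
  finite almost everywhere, which makes the increments summable there. The pointwise limit is also
  the limit in the mean by Fatou's lemma.
\<close>

lemma L2_complete:
  fixes u :: "nat \<Rightarrow> real^3 \<Rightarrow> 'b::euclidean_space"
  assumes u: "\<And>n. u n \<in> L2 D"
    and cauchy: "\<And>e. e > 0 \<Longrightarrow> \<exists>N. \<forall>m\<ge>N. \<forall>n\<ge>N. (LINT x|lebesgue_on D. (norm (u m x - u n x))\<^sup>2) < e"
  shows "\<exists>l\<in>L2 D. (\<lambda>n. LINT x|lebesgue_on D. (norm (u n x - l x))\<^sup>2) \<longlonglongrightarrow> 0"
proof -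
  let ?M = "lebesgue_on D"
  have meas: "u n \<in> borel_measurable ?M" for n using L2_measurable[OF u] .
  have int: "integrable ?M (\<lambda>x. (norm (u m x - u n x))\<^sup>2)" for m n
    using L2_integrable[OF L2_diff[OF u[of m] u[of n]]] by (simp add: fun_diff_def)
  have "\<forall>k. \<exists>N. \<forall>m\<ge>N. \<forall>n\<ge>N. (LINT x|?M. (norm (u m x - u n x))\<^sup>2) < (1/4)^k"
    using cauchy by simp
  from choice[OF this] obtain N where
    N: "\<And>k m n. m \<ge> N k \<Longrightarrow> n \<ge> N k \<Longrightarrow> (LINT x|?M. (norm (u m x - u n x))\<^sup>2) < (1/4)^k"
    by blast
  \<comment> \<open>An increasing sequence of indices that dominates both \<open>k\<close> and \<open>N k\<close>.\<close>
  define r where "r k = k + (\<Sum>j\<le>k. N j)" for k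
  have rN: "r k \<ge> N k" for k unfolding r_def by (simp add: member_le_sum trans_le_add2)
  have rS: "r (Suc k) \<ge> r k" for k unfolding r_def by simp
  have rk: "r k \<ge> k" for k unfolding r_def by simp
  define d where "d k x = u (r (Suc k)) x - u (r k) x" for k x
  have d_int: "(LINT x|?M. (norm (d k x))\<^sup>2) \<le> (1/4)^k" for k
    unfolding d_def using N[of k "r (Suc k)" "r k"] rN[of k] rS[of k] by linarith
  have d_meas: "d k \<in> borel_measurable ?M" for k unfolding d_def using meas by measurable
  have nn_d: "(\<integral>\<^sup>+x. ennreal (2^k * (norm (d k x))\<^sup>2) \<partial>?M) \<le> ennreal ((1/2)^k)" for k
  proof -
    have "(\<integral>\<^sup>+x. ennreal (2^k * (norm (d k x))\<^sup>2) \<partial>?M) = ennreal (LINT x|?M. 2^k * (norm (d k x))\<^sup>2)"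
      by (rule nn_integral_eq_integral) (use int in \<open>auto simp: d_def\<close>)
    also have "(LINT x|?M. 2^k * (norm (d k x))\<^sup>2) \<le> 2^k * (1/4)^k"
      using d_int by simp
    also have "(2::real)^k * (1/4)^k = (1/2)^k" by (simp flip: power_mult_distrib)
    finally show ?thesis by (simp add: ennreal_leI)
  qed
  have "(\<integral>\<^sup>+x. (\<Sum>k. ennreal (2^k * (norm (d k x))\<^sup>2)) \<partial>?M) = (\<Sum>k. \<integral>\<^sup>+x. ennreal (2^k * (norm (d k x))\<^sup>2) \<partial>?M)"
    by (rule nn_integral_suminf) (use d_meas in measurable)
  also have "\<dots> \<le> (\<Sum>k. ennreal ((1/2)^k))"
    by (intro suminf_le nn_d) auto
  also have "\<dots> = ennreal (\<Sum>k. (1/2)^k)"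
    by (rule suminf_ennreal2) (auto intro: summable_geometric)
  finally have "(\<integral>\<^sup>+x. (\<Sum>k. ennreal (2^k * (norm (d k x))\<^sup>2)) \<partial>?M) \<noteq> \<infinity>"
    by (metis ennreal_less_top infinity_ennreal_def leD)
  then have "AE x in ?M. (\<Sum>k. ennreal (2^k * (norm (d k x))\<^sup>2)) \<noteq> \<infinity>"
    by (intro nn_integral_PInf_AE) (use d_meas in measurable)
  then have conv: "AE x in ?M. convergent (\<lambda>k. u (r k) x)"
  proof eventually_elim
    fix x assume fin: "(\<Sum>k. ennreal (2^k * (norm (d k x))\<^sup>2)) \<noteq> \<infinity>"
    have "summable (\<lambda>k. 2^k * (norm (d k x))\<^sup>2)"
      by (rule summable_suminf_not_top) (use fin in simp_all)
    then have "Bseq (\<lambda>k. 2^k * (norm (d k x))\<^sup>2)"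
      by (intro convergent_imp_Bseq) (auto dest: summable_LIMSEQ_zero simp: convergent_def)
    then obtain B where B: "B > 0" "\<And>k. norm (2^k * (norm (d k x))\<^sup>2) \<le> B"
      by (auto elim: BseqE)
    have le: "norm (d k x) \<le> sqrt B * (1 / sqrt 2)^k" for k
    proof (rule power2_le_imp_le)
      have "(norm (d k x))\<^sup>2 \<le> B * (1/2)^k"
        using B(2)[of k] by (simp add: field_simps power_one_over)
      also have "(1/2::real)^k = ((1 / sqrt 2)^k)\<^sup>2"
        by (simp add: power_mult[symmetric] mult.commute[of k 2] power_mult[of _ 2 k] power_one_over)
      also have "B * ((1 / sqrt 2)^k)\<^sup>2 = (sqrt B * (1 / sqrt 2)^k)\<^sup>2"
        using B(1) by (simp only: power_mult_distrib) simp
      finally show "(norm (d k x))\<^sup>2 \<le> (sqrt B * (1 / sqrt 2)^k)\<^sup>2" .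
    qed (use B(1) in simp)
    have "summable (\<lambda>k. sqrt B * (1 / sqrt 2)^k)"
      by (intro summable_mult summable_geometric) simp
    from summable_comparison_test'[OF this, of 0, OF le] have "summable (\<lambda>k. d k x)"
      by simp
    then have "convergent (\<lambda>k. \<Sum>j<k. d j x)" by (simp add: summable_iff_convergent)
    then have "convergent (\<lambda>k. u (r k) x - u (r 0) x)"
      unfolding d_def by (simp add: sum_lessThan_telescope[of "\<lambda>k. u (r k) x"])
    then show "convergent (\<lambda>k. u (r k) x)"
      by (simp add: convergent_diff_const_right_iff)
  qed
  define l where "l x = lim (\<lambda>k. u (r k) x)" for x
  have l_meas: "l \<in> borel_measurable ?M"
    unfolding l_def[abs_def] by (intro borel_measurable_lim_metric meas)
  have fatou: "(\<integral>\<^sup>+x. ennreal ((norm (u n x - l x))\<^sup>2) \<partial>?M) \<le> ennreal e"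
    if n: "\<And>m. m \<ge> n \<Longrightarrow> (LINT x|?M. (norm (u n x - u m x))\<^sup>2) \<le> e" and "e \<ge> 0" for n e
  proof -
    have "(\<integral>\<^sup>+x. ennreal ((norm (u n x - l x))\<^sup>2) \<partial>?M)
      = (\<integral>\<^sup>+x. liminf (\<lambda>k. ennreal ((norm (u n x - u (r k) x))\<^sup>2)) \<partial>?M)"
    proof (rule nn_integral_cong_AE)
      show "AE x in ?M. ennreal ((norm (u n x - l x))\<^sup>2) = liminf (\<lambda>k. ennreal ((norm (u n x - u (r k) x))\<^sup>2))"
        using conv
      proof eventually_elim
        fix x assume "convergent (\<lambda>k. u (r k) x)"
        then have "(\<lambda>k. u (r k) x) \<longlonglongrightarrow> l x" unfolding l_def by (simp add: convergent_LIMSEQ_iff)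
        then have "(\<lambda>k. ennreal ((norm (u n x - u (r k) x))\<^sup>2)) \<longlonglongrightarrow> ennreal ((norm (u n x - l x))\<^sup>2)"
          by (intro tendsto_ennrealI tendsto_intros)
        from lim_imp_Liminf[OF _ this]
        show "ennreal ((norm (u n x - l x))\<^sup>2) = liminf (\<lambda>k. ennreal ((norm (u n x - u (r k) x))\<^sup>2))" by simp
      qed
    qed
    also have "\<dots> \<le> liminf (\<lambda>k. \<integral>\<^sup>+x. ennreal ((norm (u n x - u (r k) x))\<^sup>2) \<partial>?M)"
      by (rule nn_integral_liminf) (use meas in measurable)
    also have "\<dots> \<le> ennreal e"
    proof (rule Liminf_le)
      have "(\<integral>\<^sup>+x. ennreal ((norm (u n x - u (r k) x))\<^sup>2) \<partial>?M) \<le> ennreal e" if "k \<ge> n" for k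
      proof -
        have "(\<integral>\<^sup>+x. ennreal ((norm (u n x - u (r k) x))\<^sup>2) \<partial>?M) = ennreal (LINT x|?M. (norm (u n x - u (r k) x))\<^sup>2)"
          by (rule nn_integral_eq_integral) (use int in auto)
        also have "\<dots> \<le> ennreal e" using n[of "r k"] rk[of k] that by (intro ennreal_leI) auto
        finally show ?thesis .
      qed
      then show "eventually (\<lambda>k. (\<integral>\<^sup>+x. ennreal ((norm (u n x - u (r k) x))\<^sup>2) \<partial>?M) \<le> ennreal e) sequentially"
        by (auto simp: eventually_sequentially)
    qed simp
    finally show ?thesis .
  qed
  have int_l: "integrable ?M (\<lambda>x. (norm (u n x - l x))\<^sup>2)" "(LINT x|?M. (norm (u n x - l x))\<^sup>2) \<le> e"
    if n: "\<And>m. m \<ge> n \<Longrightarrow> (LINT x|?M. (norm (u n x - u m x))\<^sup>2) \<le> e" and e: "e \<ge> 0" for n e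
  proof -
    have m: "(\<lambda>x. (norm (u n x - l x))\<^sup>2) \<in> borel_measurable ?M" using meas l_meas by measurable
    show i: "integrable ?M (\<lambda>x. (norm (u n x - l x))\<^sup>2)"
      by (rule integrableI_bounded[OF m])
         (use fatou[OF n e] in \<open>auto simp: ennreal_less_top intro: le_less_trans\<close>)
    have "ennreal (LINT x|?M. (norm (u n x - l x))\<^sup>2) \<le> ennreal e"
      using fatou[OF n e] nn_integral_eq_integral[OF i] by simp
    then show "(LINT x|?M. (norm (u n x - l x))\<^sup>2) \<le> e" using e by simp
  qed
  have close: "\<exists>K. \<forall>n\<ge>K. integrable ?M (\<lambda>x. (norm (u n x - l x))\<^sup>2) \<and> (LINT x|?M. (norm (u n x - l x))\<^sup>2) < e"
    if "e > 0" for e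
  proof -
    obtain K where K: "\<And>m n. m \<ge> K \<Longrightarrow> n \<ge> K \<Longrightarrow> (LINT x|?M. (norm (u m x - u n x))\<^sup>2) < e / 2"
      using cauchy[of "e / 2"] \<open>e > 0\<close> by auto
    have "integrable ?M (\<lambda>x. (norm (u n x - l x))\<^sup>2) \<and> (LINT x|?M. (norm (u n x - l x))\<^sup>2) < e" if "n \<ge> K" for n
    proof -
      have "\<And>m. m \<ge> n \<Longrightarrow> (LINT x|?M. (norm (u n x - u m x))\<^sup>2) \<le> e / 2"
        using K[of n] that by (meson less_imp_le order_trans)
      from int_l[OF this] show ?thesis using \<open>e > 0\<close> by auto
    qed
    then show ?thesis by blast
  qed
  obtain K where K: "integrable ?M (\<lambda>x. (norm (u K x - l x))\<^sup>2)" using close[of 1] by auto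
  \<comment> \<open>The limit is square-integrable as the difference of \<open>u K\<close> and \<open>u K - l\<close>.\<close>
  have "u K - l \<in> L2 D"
    using K borel_measurable_diff[OF meas[of K] l_meas] by (simp add: L2_def fun_diff_def)
  from L2_diff[OF u[of K] this] have "l \<in> L2 D" by simp
  moreover have "(\<lambda>n. LINT x|?M. (norm (u n x - l x))\<^sup>2) \<longlonglongrightarrow> 0"
  proof (rule LIMSEQ_I)
    fix e :: real assume "e > 0"
    then show "\<exists>no. \<forall>n\<ge>no. norm ((LINT x|?M. (norm (u n x - l x))\<^sup>2) - 0) < e"
      using close[of e] by auto
  qed
  ultimately show ?thesis by blast
qed

section \<open>Complex vectors and real matrices\<close>

lemma hdot_diff_left: "hdot (u - v) w = hdot u w - hdot v w"
  and hdot_scale_left: "hdot (c *s u) w = c * hdot u w"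
  by (simp_all add: hdot_def algebra_simps sum_subtractf sum.distrib sum_distrib_left)

lemma hdot_sym: "hdot v u = cnj (hdot u v)"
  by (simp add: hdot_def mult.commute)

lemma hdot_self: "hdot u u = of_real ((norm u)\<^sup>2)"
  by (simp add: hdot_def norm_vec_def L2_set_def sum_nonneg complex_norm_square flip: of_real_power)

lemma norm_hdot_le: "cmod (hdot u v) \<le> norm u * norm v"
proof -
  have "cmod (hdot u v) \<le> (\<Sum>i\<in>UNIV. \<bar>norm (u $ i)\<bar> * \<bar>norm (v $ i)\<bar>)"
    unfolding hdot_def by (rule order_trans[OF norm_sum]) (simp add: norm_mult)
  also have "\<dots> \<le> norm u * norm v"
    unfolding norm_vec_def by (rule L2_set_mult_ineq)
  finally show ?thesis .
qed

lemma norm_vector_scale: "norm (c *s (u :: complex^3)) = cmod c * norm u"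
  by (simp add: norm_vec_def L2_set_def norm_mult power_mult_distrib real_sqrt_mult flip: sum_distrib_left)

lemma rmat_mult_diff: "rmat_mult A (u - v) = rmat_mult A u - rmat_mult A v"
  and rmat_mult_add: "rmat_mult A (u + v) = rmat_mult A u + rmat_mult A v"
  and rmat_mult_scale: "rmat_mult A (c *s u) = c *s rmat_mult A u"
  by (simp_all add: rmat_mult_def vec_eq_iff algebra_simps sum_subtractf sum.distrib sum_distrib_left)

lemma rmat_mult_one: "rmat_mult (mat 1) u = u"
  by (simp add: rmat_mult_def mat_def vec_eq_iff if_distrib[of complex_of_real] if_distrib[of "\<lambda>x. x * _"] sum.delta cong: if_cong)

lemma rmat_mult_assoc: "rmat_mult A (rmat_mult B u) = rmat_mult (A ** B) u"
proof -
  have "(\<Sum>j\<in>UNIV. complex_of_real (A $ i $ j) * (\<Sum>k\<in>UNIV. complex_of_real (B $ j $ k) * u $ k))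
    = (\<Sum>k\<in>UNIV. complex_of_real (\<Sum>j\<in>UNIV. A $ i $ j * B $ j $ k) * u $ k)" for i
    unfolding sum_distrib_left of_real_sum sum_distrib_right
    by (subst sum.swap) (simp add: mult.assoc)
  then show ?thesis by (simp add: rmat_mult_def matrix_matrix_mult_def vec_eq_iff)
qed

lemma rmat_mult_bound: "\<exists>B\<ge>0. \<forall>v. norm (rmat_mult A v) \<le> B * norm v"
proof -
  have "linear (rmat_mult A)"
    by (rule linearI) (simp_all add: rmat_mult_add, simp add: rmat_mult_def vec_eq_iff scaleR_sum_right)
  then have "bounded_linear (rmat_mult A)" by (simp add: linear_conv_bounded_linear)
  then show ?thesis using bounded_linear.nonneg_bounded[of "rmat_mult A"] by (auto simp: mult.commute)
qed

lemma continuous_hdot: "continuous_on UNIV (\<lambda>p. hdot (fst p) (snd p))"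
  unfolding hdot_def by (intro continuous_intros)

lemma continuous_rmat_mult: "continuous_on UNIV (\<lambda>p. rmat_mult (fst p) (snd p))"
  unfolding rmat_mult_def by (intro continuous_intros)

lemma measurable_hdot:
  "u \<in> borel_measurable M \<Longrightarrow> v \<in> borel_measurable M \<Longrightarrow> (\<lambda>x. hdot (u x) (v x)) \<in> borel_measurable M"
  using borel_measurable_continuous_Pair[of u M v hdot] continuous_hdot by simp

lemma measurable_rmat_mult:
  "A \<in> borel_measurable M \<Longrightarrow> v \<in> borel_measurable M \<Longrightarrow> (\<lambda>x. rmat_mult (A x) (v x)) \<in> borel_measurable M"
  using borel_measurable_continuous_Pair[of A M v rmat_mult] continuous_rmat_mult by simp

definition vscale :: "complex \<Rightarrow> vfield \<Rightarrow> vfield" where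
  "vscale c u = (\<lambda>x. c *s u x)"

lemma measurable_vscale: "u \<in> borel_measurable M \<Longrightarrow> vscale c u \<in> borel_measurable M"
proof -
  assume "u \<in> borel_measurable M"
  moreover have "continuous_on UNIV (\<lambda>v::complex^3. c *s v)"
    unfolding vector_scalar_mult_def by (intro continuous_intros)
  ultimately show ?thesis unfolding vscale_def
    using borel_measurable_continuous_onI measurable_compose by blast
qed

lemma L2_vscale: "u \<in> L2 D \<Longrightarrow> vscale c u \<in> L2 D"
  by (rule L2_dominated[of _ _ "\<lambda>x. (cmod c)\<^sup>2 * (norm (u x))\<^sup>2"])
     (auto simp: L2_def measurable_vscale, auto simp: vscale_def norm_vector_scale power_mult_distrib)

lemma L2_zero: "(\<lambda>x. 0) \<in> L2 D"
  by (simp add: L2_def)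

lemma csubspace_L2: "csubspace vscale (L2 D)"
  unfolding csubspace_def using L2_zero L2_diff L2_vscale by blast

lemma L2_add: "u \<in> L2 D \<Longrightarrow> v \<in> L2 D \<Longrightarrow> u + v \<in> L2 D" for u v :: vfield
  by (rule csubspace_add[OF csubspace_L2])

lemma integrable_hdot:
  assumes "u \<in> L2 D" "v \<in> L2 D"
  shows "integrable (lebesgue_on D) (\<lambda>x. hdot (u x) (v x))"
proof (rule Bochner_Integration.integrable_bound[of _ "\<lambda>x. (norm (u x))\<^sup>2 + (norm (v x))\<^sup>2"])
  have "norm (hdot (u x) (v x)) \<le> (norm (u x))\<^sup>2 + (norm (v x))\<^sup>2" for x
  proof -
    have "2 * (norm (u x) * norm (v x)) \<le> (norm (u x))\<^sup>2 + (norm (v x))\<^sup>2"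
      using sum_squares_bound[of "norm (u x)" "norm (v x)"] by simp
    moreover have "0 \<le> norm (u x) * norm (v x)" by simp
    ultimately show ?thesis using norm_hdot_le[of "u x" "v x"] by linarith
  qed
  then show "AE x in lebesgue_on D. norm (hdot (u x) (v x)) \<le> norm ((norm (u x))\<^sup>2 + (norm (v x))\<^sup>2)"
    by (intro AE_I2) (simp add: abs_of_nonneg)
qed (use assms L2_measurable in \<open>auto intro: measurable_hdot L2_integrable\<close>)

section \<open>Weighted inner products\<close>

definition wip :: "coeff \<Rightarrow> (real^3) set \<Rightarrow> vfield \<Rightarrow> vfield \<Rightarrow> complex" where
  "wip \<rho> D u v = l2_inner D (coeff_mult \<rho> u) v"

lemma wnorm_eq_snrm: "wnorm \<rho> D u = snrm (wip \<rho> D) u"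
  by (simp add: wnorm_def snrm_def wip_def)

lemma wip_one: "wip (\<lambda>_. mat 1) D = l2_inner D"
  by (simp add: wip_def[abs_def] coeff_mult_def rmat_mult_one)

text \<open>
  What the weighted spaces need from a coefficient: it is Hermitian, coercive and bounded almost
  everywhere, with uniform constants. The weighted seminorm is then equivalent to the \<open>L\<^sup>2\<close> seminorm,
  from which it inherits completeness.
\<close>

locale weight =
  fixes D :: "(real^3) set" and \<rho> :: coeff and c C :: real
  assumes weight_measurable: "\<rho> \<in> borel_measurable (lebesgue_on D)"
    and c_pos: "c > 0" and C_pos: "C > 0"
    and weight_AE: "AE x in lebesgue_on D. (\<forall>u v. hdot (rmat_mult (\<rho> x) u) v = cnj (hdot (rmat_mult (\<rho> x) v) u)) \<and>
      (\<forall>v. c * (norm v)\<^sup>2 \<le> Re (hdot (rmat_mult (\<rho> x) v) v)) \<and> (\<forall>v. norm (rmat_mult (\<rho> x) v) \<le> C * norm v)"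
begin

lemma weight_hermitian: "AE x in lebesgue_on D. \<forall>u v. hdot (rmat_mult (\<rho> x) u) v = cnj (hdot (rmat_mult (\<rho> x) v) u)"
  and weight_coercive: "AE x in lebesgue_on D. \<forall>v. c * (norm v)\<^sup>2 \<le> Re (hdot (rmat_mult (\<rho> x) v) v)"
  and weight_bounded: "AE x in lebesgue_on D. \<forall>v. norm (rmat_mult (\<rho> x) v) \<le> C * norm v"
  using weight_AE by (simp_all only: AE_conj_iff)

lemma coeff_mult_L2:
  assumes "u \<in> L2 D" shows "coeff_mult \<rho> u \<in> L2 D"
proof (rule L2_dominated)
  show "coeff_mult \<rho> u \<in> borel_measurable (lebesgue_on D)"
    unfolding coeff_mult_def by (intro measurable_rmat_mult weight_measurable L2_measurable assms)
  show "AE x in lebesgue_on D. (norm (coeff_mult \<rho> u x))\<^sup>2 \<le> C\<^sup>2 * (norm (u x))\<^sup>2"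
    using weight_bounded
  proof eventually_elim
    case (elim x)
    then have "(norm (rmat_mult (\<rho> x) (u x)))\<^sup>2 \<le> (C * norm (u x))\<^sup>2" by (intro power_mono) auto
    then show ?case by (simp add: coeff_mult_def power_mult_distrib)
  qed
qed (use L2_integrable[OF assms] in simp)

lemma integrable_wip: "u \<in> L2 D \<Longrightarrow> v \<in> L2 D \<Longrightarrow> integrable (lebesgue_on D) (\<lambda>x. hdot (coeff_mult \<rho> u x) (v x))"
  by (intro integrable_hdot coeff_mult_L2)

lemma wip_bounds:
  assumes u: "u \<in> L2 D"
  shows "c * (LINT x|lebesgue_on D. (norm (u x))\<^sup>2) \<le> Re (wip \<rho> D u u)"
    and "Re (wip \<rho> D u u) \<le> C * (LINT x|lebesgue_on D. (norm (u x))\<^sup>2)"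
proof -
  have eq: "Re (wip \<rho> D u u) = (LINT x|lebesgue_on D. Re (hdot (coeff_mult \<rho> u x) (u x)))"
    unfolding wip_def l2_inner_def using integrable_wip[OF u u] by simp
  have int: "integrable (lebesgue_on D) (\<lambda>x. Re (hdot (coeff_mult \<rho> u x) (u x)))"
    using integrable_wip[OF u u] by (rule integrable_Re)
  have "(LINT x|lebesgue_on D. c * (norm (u x))\<^sup>2) \<le> (LINT x|lebesgue_on D. Re (hdot (coeff_mult \<rho> u x) (u x)))"
    by (rule integral_mono_AE) (use int L2_integrable[OF u] weight_coercive in \<open>auto simp: coeff_mult_def elim!: eventually_mono\<close>)
  then show "c * (LINT x|lebesgue_on D. (norm (u x))\<^sup>2) \<le> Re (wip \<rho> D u u)" using eq by simp
  have "(LINT x|lebesgue_on D. Re (hdot (coeff_mult \<rho> u x) (u x))) \<le> (LINT x|lebesgue_on D. C * (norm (u x))\<^sup>2)"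
  proof (rule integral_mono_AE[OF int])
    show "AE x in lebesgue_on D. Re (hdot (coeff_mult \<rho> u x) (u x)) \<le> C * (norm (u x))\<^sup>2"
      using weight_bounded
    proof eventually_elim
      case (elim x)
      have "Re (hdot (coeff_mult \<rho> u x) (u x)) \<le> norm (rmat_mult (\<rho> x) (u x)) * norm (u x)"
        unfolding coeff_mult_def using norm_hdot_le complex_Re_le_cmod order_trans by blast
      also have "\<dots> \<le> C * norm (u x) * norm (u x)" using elim by (intro mult_right_mono) auto
      finally show ?case by (simp add: power2_eq_square mult.assoc)
    qed
  qed (use L2_integrable[OF u] in simp)
  then show "Re (wip \<rho> D u u) \<le> C * (LINT x|lebesgue_on D. (norm (u x))\<^sup>2)" using eq by simp
qed

lemma wip_sym:
  assumes "u \<in> L2 D" "v \<in> L2 D" shows "wip \<rho> D v u = cnj (wip \<rho> D u v)"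
proof -
  have "AE x in lebesgue_on D. hdot (coeff_mult \<rho> v x) (u x) = cnj (hdot (coeff_mult \<rho> u x) (v x))"
    using weight_hermitian unfolding coeff_mult_def by (rule eventually_mono) blast
  then have "wip \<rho> D v u = (LINT x|lebesgue_on D. cnj (hdot (coeff_mult \<rho> u x) (v x)))"
    unfolding wip_def l2_inner_def
    by (intro integral_cong_AE borel_measurable_integrable)
       (use integrable_wip[OF assms] integrable_wip[OF assms(2,1)] in simp_all)
  then show ?thesis unfolding wip_def l2_inner_def by simp
qed

lemma wip_cong_AE:
  assumes "u \<in> L2 D" "u' \<in> L2 D" "v \<in> L2 D" "v' \<in> L2 D"
    and "AE x in lebesgue_on D. u x = u' x" "AE x in lebesgue_on D. v x = v' x"
  shows "wip \<rho> D u v = wip \<rho> D u' v'"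
  unfolding wip_def l2_inner_def
  by (rule integral_cong_AE)
     (use integrable_wip assms in \<open>auto simp: coeff_mult_def elim: AE_mp\<close>)

sublocale semi_inner "L2 D" vscale "wip \<rho> D"
proof
  show "csubspace vscale (L2 D)" by (rule csubspace_L2)
  fix x y z :: vfield and a :: complex assume xy: "x \<in> L2 D" "y \<in> L2 D"
  show "wip \<rho> D (vscale a x) y = a * wip \<rho> D x y"
    by (simp add: wip_def l2_inner_def coeff_mult_def vscale_def rmat_mult_scale hdot_scale_left)
  show "wip \<rho> D y x = cnj (wip \<rho> D x y)" using wip_sym xy by blast
  show "0 \<le> Re (wip \<rho> D x x)"
    by (rule order_trans[OF mult_nonneg_nonneg wip_bounds(1)[OF xy(1)]]) (use c_pos in simp_all)
  assume z: "z \<in> L2 D"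
  show "wip \<rho> D (x - y) z = wip \<rho> D x z - wip \<rho> D y z"
    using integrable_wip[OF xy(1) z] integrable_wip[OF xy(2) z]
    by (simp add: wip_def l2_inner_def coeff_mult_def rmat_mult_diff hdot_diff_left)
qed

lemma snrm_bounds:
  assumes "u \<in> L2 D"
  shows "sqrt c * sqrt (LINT x|lebesgue_on D. (norm (u x))\<^sup>2) \<le> snrm (wip \<rho> D) u"
    and "snrm (wip \<rho> D) u \<le> sqrt C * sqrt (LINT x|lebesgue_on D. (norm (u x))\<^sup>2)"
  using wip_bounds[OF assms] by (simp_all add: snrm_def flip: real_sqrt_mult)

lemma snrm_tendsto_0_iff:
  assumes "\<And>n. u n \<in> L2 D"
  shows "(\<lambda>n. snrm (wip \<rho> D) (u n)) \<longlonglongrightarrow> 0 \<longleftrightarrow> (\<lambda>n. LINT x|lebesgue_on D. (norm (u n x))\<^sup>2) \<longlonglongrightarrow> 0"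
    (is "?W \<longleftrightarrow> ?L")
proof
  have nn: "0 \<le> (LINT x|lebesgue_on D. (norm (u n x))\<^sup>2)" for n by simp
  show ?W if ?L
  proof (rule Lim_null_comparison)
    show "(\<lambda>n. sqrt C * sqrt (LINT x|lebesgue_on D. (norm (u n x))\<^sup>2)) \<longlonglongrightarrow> 0"
      using tendsto_mult[OF tendsto_const tendsto_real_sqrt[OF that], of "sqrt C"] by simp
  qed (use snrm_bounds(2)[OF assms] snrm_nonneg[OF assms] in simp)
  show ?L if ?W
  proof (rule Lim_null_comparison)
    have "(\<lambda>n. (1/c) * (snrm (wip \<rho> D) (u n))\<^sup>2) \<longlonglongrightarrow> (1/c) * 0\<^sup>2"
      by (intro tendsto_intros that)
    then show "(\<lambda>n. (1/c) * (snrm (wip \<rho> D) (u n))\<^sup>2) \<longlonglongrightarrow> 0" by simp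
    have "(LINT x|lebesgue_on D. (norm (u n x))\<^sup>2) \<le> (1/c) * (snrm (wip \<rho> D) (u n))\<^sup>2" for n
      using wip_bounds(1)[OF assms[of n]] c_pos by (simp add: snrm_sq[OF assms] field_simps)
    then show "eventually (\<lambda>n. norm (LINT x|lebesgue_on D. (norm (u n x))\<^sup>2) \<le> (1/c) * (snrm (wip \<rho> D) (u n))\<^sup>2) sequentially"
      using nn by simp
  qed
qed

sublocale semi_hilbert "L2 D" vscale "wip \<rho> D"
proof
  fix u assume u: "\<And>n::nat. u n \<in> L2 D"
    and cauchy: "\<And>e. e > 0 \<Longrightarrow> \<exists>N. \<forall>m\<ge>N. \<forall>n\<ge>N. snrm (wip \<rho> D) (u m - u n) < e"
  have "\<exists>N. \<forall>m\<ge>N. \<forall>n\<ge>N. (LINT x|lebesgue_on D. (norm (u m x - u n x))\<^sup>2) < e" if "e > 0" for e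
  proof -
    have "0 < sqrt (c * e)" using that c_pos by simp
    from cauchy[OF this] obtain N where
      N: "\<And>m n. m \<ge> N \<Longrightarrow> n \<ge> N \<Longrightarrow> snrm (wip \<rho> D) (u m - u n) < sqrt (c * e)" by blast
    have "(LINT x|lebesgue_on D. (norm (u m x - u n x))\<^sup>2) < e" if "m \<ge> N" "n \<ge> N" for m n
    proof -
      have L: "u m - u n \<in> L2 D" by (intro L2_diff u)
      have "(snrm (wip \<rho> D) (u m - u n))\<^sup>2 < (sqrt (c * e))\<^sup>2"
        using N[OF that] snrm_nonneg[OF L] by (intro power_strict_mono) auto
      then have "Re (wip \<rho> D (u m - u n) (u m - u n)) < c * e"
        using c_pos \<open>e > 0\<close> by (simp add: snrm_sq[OF L])
      then have "c * (LINT x|lebesgue_on D. (norm ((u m - u n) x))\<^sup>2) < c * e"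
        using wip_bounds(1)[OF L] by linarith
      then show ?thesis using c_pos by (simp add: fun_diff_def)
    qed
    then show ?thesis by blast
  qed
  from L2_complete[of u, OF u this] obtain l where l: "l \<in> L2 D"
    "(\<lambda>n. LINT x|lebesgue_on D. (norm (u n x - l x))\<^sup>2) \<longlonglongrightarrow> 0" by blast
  then have "(\<lambda>n. snrm (wip \<rho> D) (u n - l)) \<longlonglongrightarrow> 0"
    using snrm_tendsto_0_iff[of "\<lambda>n. u n - l"] L2_diff[OF u l(1)] by (simp add: fun_diff_def)
  then show "\<exists>l\<in>L2 D. (\<lambda>n. snrm (wip \<rho> D) (u n - l)) \<longlonglongrightarrow> 0" using l by blast
qed

end

text \<open>Taking the identity matrix as weight makes all facts above available for the plain inner product.\<close>

interpretation L2: weight D "\<lambda>_. mat 1" 1 1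
  rewrites "wip (\<lambda>_. mat 1) D = l2_inner D" for D
proof -
  have herm: "\<forall>u v. hdot u v = cnj (hdot v u)" using hdot_sym by blast
  have pos: "\<forall>v. 1 * (norm v)\<^sup>2 \<le> Re (hdot v v)" by (simp add: hdot_self)
  show "weight D (\<lambda>_. mat 1) 1 1"
    unfolding weight_def rmat_mult_one by (intro conjI AE_I2 herm pos) simp_all
  show "wip (\<lambda>_. mat 1) D = l2_inner D" by (rule wip_one)
qed

section \<open>Piecewise constant coefficients\<close>

lemma hdot_rmat_mult: "hdot (rmat_mult A u) v = (\<Sum>i\<in>UNIV. \<Sum>j\<in>UNIV. complex_of_real (A $ i $ j) * u $ j * cnj (v $ i))"
  by (simp add: hdot_def rmat_mult_def sum_distrib_right)

lemma sym_pos_def_hermitian: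
  assumes "sym_pos_def A"
  shows "hdot (rmat_mult A u) v = cnj (hdot (rmat_mult A v) u)"
proof -
  have sym: "A $ i $ j = A $ j $ i" for i j
  proof -
    have "Finite_Cartesian_Product.transpose A $ j $ i = A $ j $ i"
      using assms by (simp only: sym_pos_def_def)
    then show ?thesis by (simp add: Finite_Cartesian_Product.transpose_def)
  qed
  have eq: "cnj (complex_of_real (A $ i $ j) * v $ j * cnj (u $ i)) = complex_of_real (A $ j $ i) * u $ i * cnj (v $ j)" for i j
    by (simp add: sym[of j i])
  have "cnj (hdot (rmat_mult A v) u) = (\<Sum>i\<in>UNIV. \<Sum>j\<in>UNIV. complex_of_real (A $ j $ i) * u $ i * cnj (v $ j))"
    by (simp only: hdot_rmat_mult cnj_sum eq)
  also have "\<dots> = hdot (rmat_mult A u) v"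
    unfolding hdot_rmat_mult by (rule sum.swap)
  finally show ?thesis by simp
qed

text \<open>
  The quadratic form has a positive minimum on the real unit sphere. For a complex vector, the real part
  of the Hermitian form is the sum of the values at the real and at the imaginary part of the vector.
\<close>

lemma sym_pos_def_coercive:
  assumes "sym_pos_def A"
  obtains c where "c > 0" "\<And>v. c * (norm v)\<^sup>2 \<le> Re (hdot (rmat_mult A v) v)"
proof -
  have "\<exists>c>0. \<forall>v\<in>sphere 0 1. c \<le> v \<bullet> (A *v v)"
  proof -
    have "continuous_on (sphere 0 1) (\<lambda>v::real^3. v \<bullet> (A *v v))"
      by (intro continuous_intros linear_continuous_on matrix_vector_mul_bounded_linear)
    from continuous_attains_inf[OF compact_sphere _ this]
    obtain w where w: "w \<in> sphere 0 1" "\<And>v. v \<in> sphere 0 1 \<Longrightarrow> w \<bullet> (A *v w) \<le> v \<bullet> (A *v v)"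
      by auto
    moreover have "w \<noteq> 0" using w(1) by auto
    ultimately have "w \<bullet> (A *v w) > 0" using assms by (simp add: sym_pos_def_def)
    then show ?thesis using w by blast
  qed
  then obtain c where c: "c > 0" "\<And>v. norm v = 1 \<Longrightarrow> c \<le> v \<bullet> (A *v v)" by auto
  have real: "c * (norm v)\<^sup>2 \<le> v \<bullet> (A *v v)" for v
  proof (cases "v = 0")
    case False
    define w where "w = v /\<^sub>R norm v"
    have v: "v = norm v *\<^sub>R w" and "norm w = 1" using False by (auto simp: w_def)
    have "v \<bullet> (A *v v) = (norm v)\<^sup>2 * (w \<bullet> (A *v w))"
      by (subst (1 2) v) (simp add: matrix_vector_mult_scaleR power2_eq_square)
    then show ?thesis using c(2)[OF \<open>norm w = 1\<close>] by (simp add: mult.commute[of c] mult_left_mono)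
  qed simp
  have "c * (norm v)\<^sup>2 \<le> Re (hdot (rmat_mult A v) v)" for v
  proof -
    define a where "a = (\<chi> i. Re (v $ i))"
    define b where "b = (\<chi> i. Im (v $ i))"
    have "(norm v)\<^sup>2 = (norm a)\<^sup>2 + (norm b)\<^sup>2"
      by (simp add: a_def b_def norm_vec_def L2_set_def sum_nonneg cmod_power2 sum.distrib)
    moreover have "Re (hdot (rmat_mult A v) v) = a \<bullet> (A *v a) + b \<bullet> (A *v b)"
      by (simp add: hdot_rmat_mult a_def b_def inner_vec_def matrix_vector_mult_def sum_distrib_left
          sum.distrib[symmetric] algebra_simps)
    ultimately show ?thesis using real[of a] real[of b] by (simp add: distrib_left)
  qed
  with c(1) show ?thesis by (rule that)
qed

lemma sym_pos_def_inverse: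
  assumes "sym_pos_def A" shows "rmat_mult A (rmat_mult (matrix_inv A) v) = v"
proof -
  have "\<forall>x. A *v x = 0 \<longrightarrow> x = 0"
    using assms unfolding sym_pos_def_def by (metis inner_zero_right less_irrefl)
  then have "\<exists>B. B ** A = mat 1" by (simp add: matrix_left_invertible_ker)
  then have "invertible A" by (simp add: invertible_left_inverse)
  then have "A ** matrix_inv A = mat 1"
    unfolding invertible_def matrix_inv_def by (rule someI2_ex) simp
  then show ?thesis by (simp add: rmat_mult_assoc rmat_mult_one)
qed

lemma lipschitz_polyhedral_domain_facts:
  assumes "lipschitz_polyhedral_domain D"
  shows "open D" "bounded D" "D \<noteq> {}" "negligible (frontier D)"
proof -
  show "open D" "bounded D" "D \<noteq> {}" using assms by (auto simp: lipschitz_polyhedral_domain_def)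
  obtain \<F> where F: "finite \<F>" "\<And>F. F \<in> \<F> \<Longrightarrow> polytope F \<and> aff_dim F = 2" "frontier D = \<Union>\<F>"
    using assms by (auto simp: lipschitz_polyhedral_domain_def)
  have "negligible F" if "F \<in> \<F>" for F
  proof -
    have "interior F = {}" using aff_dim_nonempty_interior[of F] F(2)[OF that] by auto
    then show ?thesis using F(2)[OF that] polytope_imp_convex negligible_convex_interior by blast
  qed
  then show "negligible (frontier D)" using F by (simp add: negligible_Union)
qed

text \<open>A point of the domain outside all subdomains lies on one of finitely many plane polygons.\<close>

lemma partition_AE:
  assumes "lipschitz_polyhedral_domain \<Omega>" "polyhedral_partition \<Omega> \<P>"
  shows "AE x in lebesgue_on \<Omega>. x \<in> \<Union>\<P>"
proof -
  have "negligible (\<Union>P\<in>\<P>. frontier P)"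
    using assms(2) lipschitz_polyhedral_domain_facts(4)
    by (intro negligible_Union) (auto simp: polyhedral_partition_def)
  then have "AE x in lebesgue. x \<notin> (\<Union>P\<in>\<P>. frontier P)"
    by (simp only: negligible_iff_null_sets AE_not_in)
  moreover have "x \<in> \<Union>\<P>" if "x \<in> \<Omega>" "x \<notin> (\<Union>P\<in>\<P>. frontier P)" for x
  proof -
    have "x \<in> closure \<Omega>" using that(1) closure_subset by blast
    then obtain P where P: "P \<in> \<P>" "x \<in> closure P" using assms(2) by (auto simp: polyhedral_partition_def)
    then have "open P" using assms(2) lipschitz_polyhedral_domain_facts(1) by (auto simp: polyhedral_partition_def)
    then have "x \<in> P" using P that(2) by (auto simp: frontier_def interior_open)
    then show ?thesis using P by blast
  qed
  ultimately have "AE x in lebesgue. x \<in> \<Omega> \<longrightarrow> x \<in> \<Union>\<P>" by (auto elim!: eventually_mono)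
  moreover have "\<Omega> \<in> sets lebesgue" using lipschitz_polyhedral_domain_facts(1)[OF assms(1)] by auto
  ultimately show ?thesis by (simp add: AE_restrict_space_iff)
qed

lemma piecewise_constant_measurable:
  fixes F :: "real^3 \<Rightarrow> 'b::euclidean_space"
  assumes "lipschitz_polyhedral_domain \<Omega>" "polyhedral_partition \<Omega> \<P>"
    and const: "\<And>P. P \<in> \<P> \<Longrightarrow> F constant_on P"
  shows "F \<in> borel_measurable (lebesgue_on \<Omega>)"
proof -
  have fin: "finite \<P>" and dis: "disjoint \<P>" and op: "\<And>P. P \<in> \<P> \<Longrightarrow> open P"
    using assms(2) lipschitz_polyhedral_domain_facts(1) by (auto simp: polyhedral_partition_def)
  have S: "\<Omega> \<in> sets lebesgue" using lipschitz_polyhedral_domain_facts(1)[OF assms(1)] by auto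
  obtain a where a: "\<And>P x. P \<in> \<P> \<Longrightarrow> x \<in> P \<Longrightarrow> F x = a P"
    using const unfolding constant_on_def by metis
  define G where "G x = (\<Sum>P\<in>\<P>. indicator P x *\<^sub>R a P)" for x :: "real^3"
  have G: "G x = F x" if "P \<in> \<P>" "x \<in> P" for P x
  proof -
    have "G x = (\<Sum>Q\<in>\<P>. if Q = P then a P else 0)"
      unfolding G_def using that dis by (intro sum.cong) (auto simp: indicator_def disjoint_def disjnt_def)
    then show ?thesis using fin that a by simp
  qed
  have "G \<in> borel_measurable borel"
    unfolding G_def using op by (intro borel_measurable_sum borel_measurable_scaleR borel_measurable_indicator) auto
  then have Gm: "G \<in> borel_measurable (lebesgue_on \<Omega>)"
    by (intro measurable_restrict_space1 measurable_completion) simp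
  have "AE x in lebesgue. (if x \<in> \<Omega> then G x else 0) = (if x \<in> \<Omega> then F x else 0)"
    using partition_AE[OF assms(1,2)] S G by (auto simp: AE_restrict_space_iff elim!: eventually_mono)
  from borel_measurable_AE[OF borel_measurable_if_I[OF Gm S] this]
  show ?thesis by (rule borel_measurable_if_D)
qed

text \<open>
  Almost everywhere a coefficient takes only finitely many values, so that bounds for each value
  separately are automatically uniform.
\<close>

lemma finite_piecewise_constant_range:
  assumes "polyhedral_partition \<Omega> \<P>" "\<And>P. P \<in> \<P> \<Longrightarrow> F constant_on P"
  shows "finite (F ` \<Union>\<P>)"
proof -
  have "\<exists>a. F ` P \<subseteq> {a}" if "P \<in> \<P>" for P using assms(2)[OF that] by (auto simp: constant_on_def)
  then have "finite (F ` P)" if "P \<in> \<P>" for P using that finite_subset by blast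
  then show ?thesis using assms(1) by (simp add: image_Union polyhedral_partition_def)
qed

lemma uniform_lower_bound:
  assumes "finite S" "\<And>A. A \<in> S \<Longrightarrow> \<exists>c>0::real. Q A c" "\<And>A c d. Q A c \<Longrightarrow> 0 < d \<Longrightarrow> d \<le> c \<Longrightarrow> Q A d"
  shows "\<exists>c>0. \<forall>A\<in>S. Q A c"
  using assms(1,2)
proof (induction rule: finite_induct)
  case empty
  show ?case by (intro exI[of _ 1]) simp
next
  case (insert A S)
  obtain c where c: "c > 0" "\<forall>A\<in>S. Q A c" using insert by blast
  obtain d where d: "d > 0" "Q A d" using insert.prems by blast
  show ?case
    by (rule exI[of _ "min c d"])
       (use c d assms(3)[of _ c "min c d"] assms(3)[OF d(2), of "min c d"] in auto)
qed

lemma uniform_matrix_bound: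
  assumes "finite S" shows "\<exists>C>0. \<forall>A\<in>S. \<forall>v. norm (rmat_mult A v) \<le> C * norm v"
  using assms
proof (induction rule: finite_induct)
  case empty
  show ?case by (intro exI[of _ 1]) simp
next
  case (insert A S)
  obtain C where C: "C > 0" "\<And>A v. A \<in> S \<Longrightarrow> norm (rmat_mult A v) \<le> C * norm v" using insert.IH by blast
  obtain B where B: "\<And>v. norm (rmat_mult A v) \<le> B * norm v" using rmat_mult_bound[of A] by blast
  have "norm (rmat_mult A' v) \<le> max C B * norm v" if "A' \<in> insert A S" for A' v
  proof -
    have "C * norm v \<le> max C B * norm v" "B * norm v \<le> max C B * norm v"
      by (auto intro: mult_right_mono)
    then show ?thesis using that C(2)[of A' v] B[of v] by fastforce
  qed
  then show ?case using C(1) by (intro exI[of _ "max C B"]) auto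
qed

lemma admissible_coeff_weight:
  assumes "lipschitz_polyhedral_domain \<Omega>" "polyhedral_partition \<Omega> \<P>" "admissible_coeff \<Omega> \<P> \<rho>"
  obtains c C where "weight \<Omega> \<rho> c C"
proof -
  have const: "\<And>P. P \<in> \<P> \<Longrightarrow> \<rho> constant_on P" and spd: "\<And>x. x \<in> \<Omega> \<Longrightarrow> sym_pos_def (\<rho> x)"
    using assms(3) by (auto simp: admissible_coeff_def)
  have sub: "\<Union>\<P> \<subseteq> \<Omega>" using assms(2) by (auto simp: polyhedral_partition_def)
  note fin = finite_piecewise_constant_range[OF assms(2) const]
  have "\<exists>c>0. \<forall>A\<in>\<rho> ` \<Union>\<P>. \<forall>v. c * (norm v)\<^sup>2 \<le> Re (hdot (rmat_mult A v) v)"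
  proof (rule uniform_lower_bound[OF fin])
    fix A assume "A \<in> \<rho> ` \<Union>\<P>"
    then have "sym_pos_def A" using spd sub by blast
    then show "\<exists>c>0. \<forall>v. c * (norm v)\<^sup>2 \<le> Re (hdot (rmat_mult A v) v)"
      using sym_pos_def_coercive by metis
  next
    fix A c d assume "\<forall>v. c * (norm v)\<^sup>2 \<le> Re (hdot (rmat_mult A v) v)" "0 < d" "d \<le> c"
    then show "\<forall>v. d * (norm v)\<^sup>2 \<le> Re (hdot (rmat_mult A v) v)"
      by (meson mult_right_mono order_trans zero_le_power2)
  qed
  then obtain c where c: "c > 0" "\<forall>A\<in>\<rho> ` \<Union>\<P>. \<forall>v. c * (norm v)\<^sup>2 \<le> Re (hdot (rmat_mult A v) v)" by blast
  obtain C where C: "C > 0" "\<forall>A\<in>\<rho> ` \<Union>\<P>. \<forall>v. norm (rmat_mult A v) \<le> C * norm v"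
    using uniform_matrix_bound[OF fin] by blast
  have "weight \<Omega> \<rho> c C"
  proof
    show "\<rho> \<in> borel_measurable (lebesgue_on \<Omega>)"
      by (rule piecewise_constant_measurable[OF assms(1,2) const])
    show "AE x in lebesgue_on \<Omega>. (\<forall>u v. hdot (rmat_mult (\<rho> x) u) v = cnj (hdot (rmat_mult (\<rho> x) v) u)) \<and>
      (\<forall>v. c * (norm v)\<^sup>2 \<le> Re (hdot (rmat_mult (\<rho> x) v) v)) \<and> (\<forall>v. norm (rmat_mult (\<rho> x) v) \<le> C * norm v)"
      using partition_AE[OF assms(1,2)]
    proof (rule eventually_mono)
      fix x assume x: "x \<in> \<Union>\<P>"
      then have "sym_pos_def (\<rho> x)" using sub spd by blast
      then have "\<forall>u v. hdot (rmat_mult (\<rho> x) u) v = cnj (hdot (rmat_mult (\<rho> x) v) u)"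
        using sym_pos_def_hermitian by blast
      then show "(\<forall>u v. hdot (rmat_mult (\<rho> x) u) v = cnj (hdot (rmat_mult (\<rho> x) v) u)) \<and>
        (\<forall>v. c * (norm v)\<^sup>2 \<le> Re (hdot (rmat_mult (\<rho> x) v) v)) \<and> (\<forall>v. norm (rmat_mult (\<rho> x) v) \<le> C * norm v)"
        using c(2) C(2) x by blast
    qed
  qed (use c C in auto)
  then show ?thesis by (rule that)
qed

lemma coeff_inv_mult_L2:
  assumes "lipschitz_polyhedral_domain \<Omega>" "polyhedral_partition \<Omega> \<P>" "admissible_coeff \<Omega> \<P> \<rho>"
    and u: "u \<in> L2 \<Omega>"
  shows "coeff_inv_mult \<rho> u \<in> L2 \<Omega>"
proof -
  have const: "\<And>P. P \<in> \<P> \<Longrightarrow> (\<lambda>x. matrix_inv (\<rho> x)) constant_on P"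
    using assms(3) by (fastforce simp: admissible_coeff_def constant_on_def)
  obtain C where C: "\<forall>A\<in>(\<lambda>x. matrix_inv (\<rho> x)) ` \<Union>\<P>. \<forall>v. norm (rmat_mult A v) \<le> C * norm v"
    using uniform_matrix_bound[OF finite_piecewise_constant_range[OF assms(2) const]] by blast
  show ?thesis
  proof (rule L2_dominated)
    show "coeff_inv_mult \<rho> u \<in> borel_measurable (lebesgue_on \<Omega>)"
      unfolding coeff_inv_mult_def
      by (intro measurable_rmat_mult piecewise_constant_measurable[OF assms(1,2) const] L2_measurable u)
    show "AE x in lebesgue_on \<Omega>. (norm (coeff_inv_mult \<rho> u x))\<^sup>2 \<le> C\<^sup>2 * (norm (u x))\<^sup>2"
      using partition_AE[OF assms(1,2)]
    proof (rule eventually_mono)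
      fix x assume "x \<in> \<Union>\<P>"
      then have "norm (rmat_mult (matrix_inv (\<rho> x)) (u x)) \<le> C * norm (u x)" using C by blast
      then have "(norm (rmat_mult (matrix_inv (\<rho> x)) (u x)))\<^sup>2 \<le> (C * norm (u x))\<^sup>2"
        by (intro power_mono) auto
      then show "(norm (coeff_inv_mult \<rho> u x))\<^sup>2 \<le> C\<^sup>2 * (norm (u x))\<^sup>2"
        by (simp add: coeff_inv_mult_def power_mult_distrib)
    qed
  qed (use L2_integrable[OF u] in simp)
qed

section \<open>The weak curl\<close>

lemma continuous_on_vec:
  fixes f :: "'a::topological_space \<Rightarrow> 'b::topological_space ^ 'n"
  assumes "\<And>i. continuous_on S (\<lambda>x. f x $ i)" shows "continuous_on S f"
  using continuous_on_vec_lambda[of S "\<lambda>i x. f x $ i", OF assms] by simp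

lemma has_weak_curl_zero: "has_weak_curl D (\<lambda>x. 0) (\<lambda>x. 0)"
  by (simp add: has_weak_curl_def bdot_def)

definition vcnj :: "vfield \<Rightarrow> vfield" where
  "vcnj u = (\<lambda>x. \<chi> i. cnj (u x $ i))"

lemma bdot_eq_hdot: "bdot (u x) (v x) = hdot (u x) (vcnj v x)"
  by (simp add: bdot_def hdot_def vcnj_def)

lemma test_field_component: "\<psi> \<in> test_fields D \<Longrightarrow> (\<lambda>x. \<psi> x $ i) \<in> test_functions D"
  by (simp add: test_fields_def)

lemma test_field_smooth: "\<psi> \<in> test_fields D \<Longrightarrow> C_k k (\<lambda>x. \<psi> x $ i)"
  using test_field_component test_function_smooth by blast

lemma vcnj_test_field: "\<psi> \<in> test_fields D \<Longrightarrow> vcnj \<psi> \<in> test_fields D"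
  unfolding test_fields_def test_functions_def vcnj_def by (auto intro: C_k_cnj)

lemma vcnj_vcnj: "vcnj (vcnj u) = u"
  by (simp add: vcnj_def)

lemma classical_curl_vcnj: "\<psi> \<in> test_fields D \<Longrightarrow> classical_curl (vcnj \<psi>) = vcnj (classical_curl \<psi>)"
  by (simp add: fun_eq_iff vec_eq_iff forall_3 classical_curl_def vcnj_def pderiv3_cnj[OF test_field_smooth])

text \<open>
  The defining identity of the weak curl is bilinear; the class of test fields being invariant under
  complex conjugation, it can be stated with the sesquilinear inner product.
\<close>

lemma has_weak_curl_iff_l2_inner:
  "has_weak_curl D u w \<longleftrightarrow> (\<forall>\<psi>\<in>test_fields D. l2_inner D u (classical_curl \<psi>) = l2_inner D w \<psi>)"
proof -
  have "has_weak_curl D u w \<longleftrightarrow>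
      (\<forall>\<psi>\<in>test_fields D. l2_inner D u (classical_curl (vcnj \<psi>)) = l2_inner D w (vcnj \<psi>))"
    unfolding has_weak_curl_def l2_inner_def bdot_eq_hdot by (simp add: classical_curl_vcnj)
  also have "\<dots> \<longleftrightarrow> (\<forall>\<psi>\<in>test_fields D. l2_inner D u (classical_curl \<psi>) = l2_inner D w \<psi>)"
    using vcnj_test_field vcnj_vcnj by metis
  finally show ?thesis .
qed

lemma continuous_classical_curl:
  assumes "\<And>i. C_k (Suc 0) (\<lambda>x. u x $ i)"
  shows "continuous_on UNIV u" "continuous_on UNIV (classical_curl u)"
proof -
  show "continuous_on UNIV u" by (rule continuous_on_vec) (rule C_k_continuous[OF assms])
  have "continuous_on UNIV (pderiv3 j (\<lambda>x. u x $ i))" for i j using assms[of i] by simp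
  then have "continuous_on UNIV (\<lambda>x. classical_curl u x $ i)" for i
    using exhaust_3[of i] by (auto simp: classical_curl_def intro!: continuous_on_diff)
  then show "continuous_on UNIV (classical_curl u)" by (rule continuous_on_vec)
qed

locale bounded_domain =
  fixes D :: "(real^3) set"
  assumes open_D: "open D" and bounded_D: "bounded D"
begin

lemma D_sets: "D \<in> sets lebesgue"
  using open_D by auto

lemma finite_measure_D: "finite_measure (lebesgue_on D)"
  using open_D bounded_D by (intro finite_measure_lebesgue_on bounded_set_imp_lmeasurable D_sets)

lemma continuous_L2:
  fixes u :: vfield assumes "continuous_on UNIV u" shows "u \<in> L2 D"
proof -
  have "bounded (u ` closure D)"
    using bounded_D assms by (intro compact_imp_bounded compact_continuous_image)
      (auto intro: continuous_on_subset)
  then obtain B where B: "\<And>x. x \<in> D \<Longrightarrow> norm (u x) \<le> B"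
    using closure_subset[of D] by (auto simp: bounded_iff)
  interpret finite_measure "lebesgue_on D" by (rule finite_measure_D)
  show ?thesis
  proof (rule L2_dominated)
    show "u \<in> borel_measurable (lebesgue_on D)" by (rule continuous_measurable_lebesgue_on[OF assms])
    show "AE x in lebesgue_on D. (norm (u x))\<^sup>2 \<le> B\<^sup>2"
      using B by (intro AE_I2 power_mono) auto
  qed simp
qed

lemma test_field_L2: "\<psi> \<in> test_fields D \<Longrightarrow> \<psi> \<in> L2 D"
  and classical_curl_test_field_L2: "\<psi> \<in> test_fields D \<Longrightarrow> classical_curl \<psi> \<in> L2 D"
  by (auto intro!: continuous_L2 continuous_classical_curl test_field_smooth simp del: C_k.simps)

lemma has_weak_curl_diff:
  assumes "u \<in> L2 D" "v \<in> L2 D" "w \<in> L2 D" "z \<in> L2 D" "has_weak_curl D u w" "has_weak_curl D v z"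
  shows "has_weak_curl D (u - v) (w - z)"
  using assms unfolding has_weak_curl_iff_l2_inner
  by (simp add: L2.ip_diff_left test_field_L2 classical_curl_test_field_L2)

lemma has_weak_curl_vscale:
  assumes "u \<in> L2 D" "w \<in> L2 D" "has_weak_curl D u w"
  shows "has_weak_curl D (vscale a u) (vscale a w)"
  using assms unfolding has_weak_curl_iff_l2_inner
  by (simp add: L2.ip_scale_left test_field_L2 classical_curl_test_field_L2)

text \<open>The weak curl is a closed operator: its defining identity passes to the limit on both sides.\<close>

lemma has_weak_curl_limit:
  assumes "\<And>n. u n \<in> L2 D" "\<And>n. w n \<in> L2 D" "\<And>n. has_weak_curl D (u n) (w n)" "l \<in> L2 D" "z \<in> L2 D"
    and "(\<lambda>n. snrm (l2_inner D) (u n - l)) \<longlonglongrightarrow> 0" "(\<lambda>n. snrm (l2_inner D) (w n - z)) \<longlonglongrightarrow> 0"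
  shows "has_weak_curl D l z"
  unfolding has_weak_curl_iff_l2_inner
proof
  fix \<psi> assume \<psi>: "\<psi> \<in> test_fields D"
  have *: "(\<lambda>n. l2_inner D (u n) (classical_curl \<psi>)) \<longlonglongrightarrow> l2_inner D l (classical_curl \<psi>)"
    by (rule L2.ip_tendsto_left[OF assms(1,4,6) classical_curl_test_field_L2[OF \<psi>]])
  have **: "(\<lambda>n. l2_inner D (w n) \<psi>) \<longlonglongrightarrow> l2_inner D z \<psi>"
    by (rule L2.ip_tendsto_left[OF assms(2,5,7) test_field_L2[OF \<psi>]])
  have "l2_inner D (u n) (classical_curl \<psi>) = l2_inner D (w n) \<psi>" for n
    using assms(3)[of n] \<psi> unfolding has_weak_curl_iff_l2_inner by blast
  then show "l2_inner D l (classical_curl \<psi>) = l2_inner D z \<psi>"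
    using LIMSEQ_unique[OF *] ** by simp
qed

text \<open>Test fields with a single nonzero component reduce this to the fundamental lemma.\<close>

lemma weak_curl_unique:
  assumes "w \<in> L2 D" "z \<in> L2 D" "has_weak_curl D u w" "has_weak_curl D u z"
  shows "AE x in lebesgue_on D. w x = z x"
proof -
  interpret finite_measure "lebesgue_on D" by (rule finite_measure_D)
  have wz: "w - z \<in> L2 D" by (rule L2_diff[OF assms(1,2)])
  have "AE x in lebesgue_on D. w x $ i - z x $ i = 0" for i
  proof (rule fundamental_lemma[OF open_D])
    show "integrable (lebesgue_on D) (\<lambda>x. w x $ i - z x $ i)"
    proof (rule Bochner_Integration.integrable_bound[of _ "\<lambda>x. 1 + (norm ((w - z) x))\<^sup>2"])
      show "integrable (lebesgue_on D) (\<lambda>x. 1 + (norm ((w - z) x))\<^sup>2)"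
        using L2_integrable[OF wz] by simp
      have "continuous_on UNIV (\<lambda>v::complex^3. v $ i)" by (intro continuous_intros)
      then have "(\<lambda>x. (w - z) x $ i) \<in> borel_measurable (lebesgue_on D)"
        using L2_measurable[OF wz] borel_measurable_continuous_onI measurable_compose by blast
      then show "(\<lambda>x. w x $ i - z x $ i) \<in> borel_measurable (lebesgue_on D)" by simp
      have "norm (w x $ i - z x $ i) \<le> 1 + (norm ((w - z) x))\<^sup>2" for x
      proof -
        have sq: "t \<le> 1 + t\<^sup>2" if "0 \<le> t" for t :: real
          using sum_squares_bound[of 1 t] that by simp
        have "norm (w x $ i - z x $ i) \<le> norm ((w - z) x)"
          using Finite_Cartesian_Product.norm_nth_le[of "(w - z) x" i] by simp
        also have "\<dots> \<le> 1 + (norm ((w - z) x))\<^sup>2" by (rule sq) simp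
        finally show ?thesis .
      qed
      then show "AE x in lebesgue_on D. norm (w x $ i - z x $ i) \<le> norm (1 + (norm ((w - z) x))\<^sup>2)"
        by (intro AE_I2) (simp add: abs_of_nonneg)
    qed
    fix \<phi> assume \<phi>: "\<phi> \<in> test_functions D"
    \<comment> \<open>Conjugating the test field turns the sesquilinear pairing back into the bilinear one.\<close>
    define \<psi> :: vfield where "\<psi> x = (\<chi> j. if j = i then \<phi> x else 0)" for x
    have "(\<lambda>x. 0) \<in> test_functions D"
      unfolding test_functions_def by (auto intro: C_k_const exI[of _ "{}"])
    have \<psi>: "\<psi> \<in> test_fields D"
    proof -
      have "(\<lambda>x. \<psi> x $ j) \<in> test_functions D" for j
        by (cases "j = i") (use \<phi> \<open>(\<lambda>x. 0) \<in> test_functions D\<close> in \<open>simp_all add: \<psi>_def\<close>)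
      then show ?thesis by (simp add: test_fields_def)
    qed
    then have "vcnj \<psi> \<in> test_fields D" by (rule vcnj_test_field)
    then have "l2_inner D w (vcnj \<psi>) = l2_inner D z (vcnj \<psi>)"
      using assms(3,4) unfolding has_weak_curl_iff_l2_inner by metis
    then have "l2_inner D (w - z) (vcnj \<psi>) = 0"
      using assms(1,2) test_field_L2[OF \<open>vcnj \<psi> \<in> test_fields D\<close>] by (simp add: L2.ip_diff_left)
    moreover have "hdot ((w - z) x) (vcnj \<psi> x) = (w x $ i - z x $ i) * \<phi> x" for x
      by (simp add: hdot_def vcnj_def \<psi>_def if_distrib[of cnj] if_distrib[of "\<lambda>y. _ * y"] sum.delta' cong: if_cong)
    ultimately show "(LINT x|lebesgue_on D. (w x $ i - z x $ i) * \<phi> x) = 0"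
      by (simp add: l2_inner_def)
  qed
  then have "AE x in lebesgue_on D. \<forall>i\<in>UNIV. w x $ i - z x $ i = 0"
    by (intro AE_finite_allI) auto
  then show ?thesis by (rule eventually_mono) (simp add: vec_eq_iff)
qed

lemma Hcurl_L2: "u \<in> Hcurl D \<Longrightarrow> u \<in> L2 D"
  by (simp add: Hcurl_def)

lemma curl_L2: "u \<in> Hcurl D \<Longrightarrow> curl D u \<in> L2 D"
  and has_weak_curl_curl: "u \<in> Hcurl D \<Longrightarrow> has_weak_curl D u (curl D u)"
proof -
  assume "u \<in> Hcurl D"
  then have "\<exists>w. w \<in> L2 D \<and> has_weak_curl D u w" by (auto simp: Hcurl_def)
  from someI_ex[OF this] show "curl D u \<in> L2 D" "has_weak_curl D u (curl D u)"
    unfolding curl_def by auto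
qed

lemma HcurlI: "u \<in> L2 D \<Longrightarrow> w \<in> L2 D \<Longrightarrow> has_weak_curl D u w \<Longrightarrow> u \<in> Hcurl D"
  by (auto simp: Hcurl_def)

lemma curl_AE_eq:
  assumes "u \<in> L2 D" "w \<in> L2 D" "has_weak_curl D u w"
  shows "AE x in lebesgue_on D. curl D u x = w x"
  using weak_curl_unique[OF curl_L2 assms(2) has_weak_curl_curl assms(3)] HcurlI[OF assms] by blast

lemma Hcurl_diff: "u \<in> Hcurl D \<Longrightarrow> v \<in> Hcurl D \<Longrightarrow> u - v \<in> Hcurl D"
  by (rule HcurlI[OF L2_diff[OF Hcurl_L2 Hcurl_L2] L2_diff[OF curl_L2 curl_L2]
        has_weak_curl_diff[OF Hcurl_L2 Hcurl_L2 curl_L2 curl_L2 has_weak_curl_curl has_weak_curl_curl]])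

lemma Hcurl_vscale: "u \<in> Hcurl D \<Longrightarrow> vscale a u \<in> Hcurl D"
  by (rule HcurlI[OF L2_vscale L2_vscale has_weak_curl_vscale]) (auto intro: Hcurl_L2 curl_L2 has_weak_curl_curl)

text \<open>
  \<open>curl D u\<close> is an arbitrarily chosen representative, so the curl is linear only almost everywhere;
  inner products do not see the difference.
\<close>

lemma curl_diff_AE:
  assumes "u \<in> Hcurl D" "v \<in> Hcurl D"
  shows "AE x in lebesgue_on D. curl D (u - v) x = (curl D u - curl D v) x"
  by (rule curl_AE_eq[OF L2_diff[OF Hcurl_L2 Hcurl_L2] L2_diff[OF curl_L2 curl_L2]
        has_weak_curl_diff[OF Hcurl_L2 Hcurl_L2 curl_L2 curl_L2 has_weak_curl_curl has_weak_curl_curl]])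
     (rule assms)+

lemma curl_vscale_AE:
  assumes "u \<in> Hcurl D"
  shows "AE x in lebesgue_on D. curl D (vscale a u) x = vscale a (curl D u) x"
  by (rule curl_AE_eq) (use assms in \<open>auto intro: L2_vscale has_weak_curl_vscale Hcurl_L2 curl_L2 has_weak_curl_curl\<close>)

lemma csubspace_Hcurl: "csubspace vscale (Hcurl D)"
  unfolding csubspace_def using HcurlI[OF L2_zero L2_zero has_weak_curl_zero] Hcurl_diff Hcurl_vscale by blast

lemma smooth_field_Hcurl:
  assumes "\<And>i. C_k (Suc 0) (\<lambda>x. u x $ i)"
  shows "u \<in> Hcurl D" "AE x in lebesgue_on D. curl D u x = classical_curl u x"
proof -
  have "u \<in> L2 D" "classical_curl u \<in> L2 D" using continuous_classical_curl[OF assms] continuous_L2 by auto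
  moreover have "has_weak_curl D u (classical_curl u)" by (rule has_weak_curl_classical[OF assms D_sets])
  ultimately show "u \<in> Hcurl D" "AE x in lebesgue_on D. curl D u x = classical_curl u x"
    by (rule HcurlI, rule curl_AE_eq)
qed

lemma Hcurl0_iff:
  "u \<in> Hcurl0 D \<longleftrightarrow> u \<in> Hcurl D \<and> (\<forall>\<phi>\<in>Hcurl D. l2_inner D (curl D u) \<phi> = l2_inner D u (curl D \<phi>))"
  by (auto simp: Hcurl0_def tangential_trace_def)

lemma l2_inner_curl_left:
  assumes "u \<in> Hcurl D" "w \<in> L2 D" "AE x in lebesgue_on D. curl D u x = w x" "\<phi> \<in> L2 D"
  shows "l2_inner D (curl D u) \<phi> = l2_inner D w \<phi>"
  by (rule L2.wip_cong_AE) (use assms curl_L2 in auto)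

lemma csubspace_Hcurl0: "csubspace vscale (Hcurl0 D)"
  unfolding csubspace_def
proof (intro conjI ballI allI)
  have z: "(\<lambda>x. 0) \<in> Hcurl D" by (rule HcurlI[OF L2_zero L2_zero has_weak_curl_zero])
  have "l2_inner D (curl D (\<lambda>x. 0)) \<phi> = l2_inner D (\<lambda>x. 0) (curl D \<phi>)" if "\<phi> \<in> Hcurl D" for \<phi>
    using l2_inner_curl_left[OF z L2_zero curl_AE_eq[OF L2_zero L2_zero has_weak_curl_zero] Hcurl_L2[OF that]]
    by (simp add: l2_inner_def hdot_def)
  then have "(\<lambda>x. 0) \<in> Hcurl0 D" using z Hcurl0_iff by blast
  then show "Hcurl0 D \<noteq> {}" by blast
next
  fix u v assume uv: "u \<in> Hcurl0 D" "v \<in> Hcurl0 D"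
  then have H: "u \<in> Hcurl D" "v \<in> Hcurl D" by (auto simp: Hcurl0_iff)
  have "l2_inner D (curl D (u - v)) \<phi> = l2_inner D (u - v) (curl D \<phi>)" if \<phi>: "\<phi> \<in> Hcurl D" for \<phi>
  proof -
    have "l2_inner D (curl D (u - v)) \<phi> = l2_inner D (curl D u - curl D v) \<phi>"
      by (rule l2_inner_curl_left[OF Hcurl_diff[OF H] _ curl_diff_AE[OF H] Hcurl_L2[OF \<phi>]])
         (intro L2_diff curl_L2 H)
    then show ?thesis
      using uv \<phi> H by (simp add: L2.ip_diff_left curl_L2 Hcurl_L2 Hcurl0_iff)
  qed
  then show "u - v \<in> Hcurl0 D" using Hcurl_diff[OF H] by (simp add: Hcurl0_iff)
next
  fix a u assume u: "u \<in> Hcurl0 D"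
  then have H: "u \<in> Hcurl D" by (auto simp: Hcurl0_iff)
  have "l2_inner D (curl D (vscale a u)) \<phi> = l2_inner D (vscale a u) (curl D \<phi>)" if \<phi>: "\<phi> \<in> Hcurl D" for \<phi>
  proof -
    have "l2_inner D (curl D (vscale a u)) \<phi> = l2_inner D (vscale a (curl D u)) \<phi>"
      by (rule l2_inner_curl_left[OF Hcurl_vscale[OF H] _ curl_vscale_AE[OF H] Hcurl_L2[OF \<phi>]])
         (intro L2_vscale curl_L2 H)
    then show ?thesis
      using u \<phi> H by (simp add: L2.ip_scale_left curl_L2 Hcurl_L2 Hcurl0_iff)
  qed
  then show "vscale a u \<in> Hcurl0 D" using Hcurl_vscale[OF H] by (simp add: Hcurl0_iff)
qed

end

section \<open>The energy space\<close>

lemma cauchy_schwarz_pair: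
  fixes a b c d :: real shows "a * c + b * d \<le> sqrt (a\<^sup>2 + b\<^sup>2) * sqrt (c\<^sup>2 + d\<^sup>2)"
proof -
  have "0 \<le> (a * d - b * c)\<^sup>2" by simp
  then have "(a * c + b * d)\<^sup>2 \<le> (a\<^sup>2 + b\<^sup>2) * (c\<^sup>2 + d\<^sup>2)"
    by (simp add: power2_eq_square algebra_simps)
  then have "\<bar>a * c + b * d\<bar> \<le> sqrt ((a\<^sup>2 + b\<^sup>2) * (c\<^sup>2 + d\<^sup>2))"
    using real_le_rsqrt by (metis power2_abs)
  then show ?thesis by (simp add: real_sqrt_mult)
qed

text \<open>
  The analytic consequences of the geometric setting: coercive bounded coefficients on a bounded open
  set, with pointwise inverses that preserve square-integrability.
\<close>

locale maxwell = bounded_domain \<Omega> + E: weight \<Omega> eps c\<^sub>1 C\<^sub>1 + X: weight \<Omega> chi c\<^sub>2 C\<^sub>2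
  for \<Omega> :: "(real^3) set" and eps chi :: coeff and c\<^sub>1 C\<^sub>1 c\<^sub>2 C\<^sub>2 :: real +
  fixes \<omega> :: real
  assumes \<omega>_pos: "\<omega> > 0"
    and \<Omega>_nonempty: "\<Omega> \<noteq> {}"
    and inv_eps: "\<And>x v. x \<in> \<Omega> \<Longrightarrow> rmat_mult (eps x) (rmat_mult (matrix_inv (eps x)) v) = v"
    and inv_chi: "\<And>x v. x \<in> \<Omega> \<Longrightarrow> rmat_mult (chi x) (rmat_mult (matrix_inv (chi x)) v) = v"
    and inv_eps_L2: "\<And>u. u \<in> L2 \<Omega> \<Longrightarrow> coeff_inv_mult eps u \<in> L2 \<Omega>"
    and inv_chi_L2: "\<And>u. u \<in> L2 \<Omega> \<Longrightarrow> coeff_inv_mult chi u \<in> L2 \<Omega>"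
begin

abbreviation "ipE \<equiv> wip eps \<Omega>"
abbreviation "ipX \<equiv> wip chi \<Omega>"
abbreviation "cu \<equiv> curl \<Omega>"
abbreviation "H0 \<equiv> Hcurl0 \<Omega>"
abbreviation "b \<equiv> bform eps chi \<omega> \<Omega>"

text \<open>The inner product that induces the energy norm; see \<open>energy_norm_eq\<close>.\<close>

definition eip :: "vfield \<Rightarrow> vfield \<Rightarrow> complex" where
  "eip u v = complex_of_real (\<omega>\<^sup>2) * ipE u v + ipX (cu u) (cu v)"

lemma b_eq: "b u v = - complex_of_real (\<omega>\<^sup>2) * ipE u v + ipX (cu u) (cu v)"
  by (simp add: bform_def wip_def)

lemma H0_Hcurl: "u \<in> H0 \<Longrightarrow> u \<in> Hcurl \<Omega>"
  by (simp add: Hcurl0_def)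

lemma ipX_curl_diff:
  assumes "u \<in> Hcurl \<Omega>" "v \<in> Hcurl \<Omega>" "w \<in> L2 \<Omega>"
  shows "ipX (cu (u - v)) w = ipX (cu u) w - ipX (cu v) w"
proof -
  have "ipX (cu (u - v)) w = ipX (cu u - cu v) w"
    by (rule X.wip_cong_AE[OF curl_L2[OF Hcurl_diff[OF assms(1,2)]] L2_diff[OF curl_L2[OF assms(1)] curl_L2[OF assms(2)]]
        assms(3,3) curl_diff_AE[OF assms(1,2)]]) simp
  then show ?thesis using assms by (simp add: X.ip_diff_left curl_L2)
qed

lemma ipX_curl_vscale:
  assumes "u \<in> Hcurl \<Omega>" "w \<in> L2 \<Omega>"
  shows "ipX (cu (vscale a u)) w = a * ipX (cu u) w"
proof -
  have "ipX (cu (vscale a u)) w = ipX (vscale a (cu u)) w"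
    by (rule X.wip_cong_AE[OF curl_L2[OF Hcurl_vscale[OF assms(1)]] L2_vscale[OF curl_L2[OF assms(1)]]
        assms(2,2) curl_vscale_AE[OF assms(1)]]) simp
  then show ?thesis using assms by (simp add: X.ip_scale_left curl_L2)
qed

sublocale energy: semi_inner "Hcurl \<Omega>" vscale eip
proof
  show "csubspace vscale (Hcurl \<Omega>)" by (rule csubspace_Hcurl)
  fix u v w :: vfield and a :: complex assume uv: "u \<in> Hcurl \<Omega>" "v \<in> Hcurl \<Omega>"
  note L = Hcurl_L2[OF uv(1)] Hcurl_L2[OF uv(2)] curl_L2[OF uv(1)] curl_L2[OF uv(2)]
  show "eip (vscale a u) v = a * eip u v"
    using uv L by (simp add: eip_def E.ip_scale_left ipX_curl_vscale algebra_simps)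
  show "eip v u = cnj (eip u v)"
    using E.ip_sym[OF L(1,2)] X.ip_sym[OF L(3,4)] by (simp add: eip_def)
  show "0 \<le> Re (eip u u)"
    using E.ip_nonneg[OF L(1)] X.ip_nonneg[OF L(3)] by (simp add: eip_def)
  assume w: "w \<in> Hcurl \<Omega>"
  show "eip (u - v) w = eip u w - eip v w"
    using uv L w by (simp add: eip_def E.ip_diff_left ipX_curl_diff Hcurl_L2 curl_L2 algebra_simps)
qed

lemma snrm_eip_sq:
  assumes "u \<in> Hcurl \<Omega>"
  shows "(snrm eip u)\<^sup>2 = (\<omega> * snrm ipE u)\<^sup>2 + (snrm ipX (cu u))\<^sup>2"
  using assms by (simp add: energy.snrm_sq E.snrm_sq X.snrm_sq Hcurl_L2 curl_L2 eip_def power_mult_distrib)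

lemma snrm_eip_eq:
  assumes "u \<in> Hcurl \<Omega>"
  shows "snrm eip u = sqrt ((\<omega> * snrm ipE u)\<^sup>2 + (snrm ipX (cu u))\<^sup>2)"
  using energy.snrm_nonneg[OF assms] by (simp flip: snrm_eip_sq[OF assms])

lemma energy_norm_eq: "u \<in> Hcurl \<Omega> \<Longrightarrow> energy_norm eps chi \<omega> \<Omega> u = snrm eip u"
  by (simp add: energy_norm_def snrm_eip_eq wnorm_eq_snrm power_mult_distrib)

lemma snrm_le_energy:
  assumes "u \<in> Hcurl \<Omega>"
  shows "\<omega> * snrm ipE u \<le> snrm eip u" "snrm ipX (cu u) \<le> snrm eip u"
  unfolding snrm_eip_eq[OF assms] by (auto intro: real_le_rsqrt)

text \<open>
  The graph of the curl on fields with vanishing tangential trace is closed, because the trace is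
  defined by an identity that is continuous in the field and in its curl.
\<close>

lemma H0_limit:
  assumes u: "\<And>n. u n \<in> H0" and l: "l \<in> L2 \<Omega>" "w \<in> L2 \<Omega>"
    and lim: "(\<lambda>n. snrm ipE (u n - l)) \<longlonglongrightarrow> 0" "(\<lambda>n. snrm ipX (cu (u n) - w)) \<longlonglongrightarrow> 0"
  shows "l \<in> H0" "AE x in lebesgue_on \<Omega>. cu l x = w x"
proof -
  note uH = H0_Hcurl[OF u]
  have diffs: "u n - l \<in> L2 \<Omega>" "cu (u n) - w \<in> L2 \<Omega>" for n
    using L2_diff Hcurl_L2[OF uH] curl_L2[OF uH] l by blast+
  have lim': "(\<lambda>n. snrm (l2_inner \<Omega>) (u n - l)) \<longlonglongrightarrow> 0" "(\<lambda>n. snrm (l2_inner \<Omega>) (cu (u n) - w)) \<longlonglongrightarrow> 0"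
    using lim E.snrm_tendsto_0_iff[OF diffs(1)] X.snrm_tendsto_0_iff[OF diffs(2)]
      L2.snrm_tendsto_0_iff[OF diffs(1)] L2.snrm_tendsto_0_iff[OF diffs(2)] by simp_all
  have wc: "has_weak_curl \<Omega> l w"
    by (rule has_weak_curl_limit[OF Hcurl_L2[OF uH] curl_L2[OF uH] has_weak_curl_curl[OF uH] l lim'])
  show ae: "AE x in lebesgue_on \<Omega>. cu l x = w x" by (rule curl_AE_eq[OF l wc])
  have lH: "l \<in> Hcurl \<Omega>" by (rule HcurlI[OF l wc])
  have "l2_inner \<Omega> (cu l) \<phi> = l2_inner \<Omega> l (cu \<phi>)" if \<phi>: "\<phi> \<in> Hcurl \<Omega>" for \<phi>
  proof -
    have "(\<lambda>n. l2_inner \<Omega> (u n) (cu \<phi>)) \<longlonglongrightarrow> l2_inner \<Omega> l (cu \<phi>)"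
      by (rule L2.ip_tendsto_left[OF Hcurl_L2[OF uH] l(1) lim'(1) curl_L2[OF \<phi>]])
    moreover have "l2_inner \<Omega> (u n) (cu \<phi>) = l2_inner \<Omega> (cu (u n)) \<phi>" for n
      using u[of n] \<phi> by (simp add: Hcurl0_iff)
    ultimately have *: "(\<lambda>n. l2_inner \<Omega> (cu (u n)) \<phi>) \<longlonglongrightarrow> l2_inner \<Omega> l (cu \<phi>)" by simp
    have "(\<lambda>n. l2_inner \<Omega> (cu (u n)) \<phi>) \<longlonglongrightarrow> l2_inner \<Omega> w \<phi>"
      by (rule L2.ip_tendsto_left[OF curl_L2[OF uH] l(2) lim'(2) Hcurl_L2[OF \<phi>]])
    then have "l2_inner \<Omega> w \<phi> = l2_inner \<Omega> l (cu \<phi>)" by (rule LIMSEQ_unique[OF _ *])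
    then show ?thesis using l2_inner_curl_left[OF lH l(2) ae Hcurl_L2[OF \<phi>]] by simp
  qed
  then show "l \<in> H0" using lH Hcurl0_iff by blast
qed

lemma H0_sub: "H0 \<subseteq> Hcurl \<Omega>"
  using H0_Hcurl by blast

lemma curl_diff_snrm:
  assumes "u \<in> Hcurl \<Omega>" "v \<in> Hcurl \<Omega>"
  shows "snrm ipX (cu (u - v)) = snrm ipX (cu u - cu v)"
  unfolding snrm_def
  by (subst X.wip_cong_AE[OF curl_L2[OF Hcurl_diff[OF assms]] L2_diff[OF curl_L2[OF assms(1)] curl_L2[OF assms(2)]]
      curl_L2[OF Hcurl_diff[OF assms]] L2_diff[OF curl_L2[OF assms(1)] curl_L2[OF assms(2)]]
      curl_diff_AE[OF assms] curl_diff_AE[OF assms]]) (rule refl)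

text \<open>
  A Cauchy sequence in the energy norm is Cauchy in \<open>L\<^sup>2\<close> together with its curls; the limits are related
  by the closedness of the curl.
\<close>

sublocale energy0: semi_hilbert "Hcurl0 \<Omega>" vscale eip
proof (intro semi_hilbert.intro semi_hilbert_axioms.intro)
  show "semi_inner (Hcurl0 \<Omega>) vscale eip"
    by (rule energy.semi_inner_subspace[OF csubspace_Hcurl0 H0_sub])
  fix u :: "nat \<Rightarrow> vfield"
  assume u: "\<And>n. u n \<in> H0"
    and cauchy: "\<And>e. e > 0 \<Longrightarrow> \<exists>N. \<forall>m\<ge>N. \<forall>n\<ge>N. snrm eip (u m - u n) < e"
  note uH = H0_Hcurl[OF u]
  have dH: "u m - u n \<in> Hcurl \<Omega>" for m n by (rule Hcurl_diff[OF uH uH])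
  have "\<exists>N. \<forall>m\<ge>N. \<forall>n\<ge>N. snrm ipE (u m - u n) < e" if "e > 0" for e
  proof -
    have "\<omega> * e > 0" using that \<omega>_pos by simp
    from cauchy[OF this] obtain N where N: "\<And>m n. m \<ge> N \<Longrightarrow> n \<ge> N \<Longrightarrow> snrm eip (u m - u n) < \<omega> * e" by blast
    have "snrm ipE (u m - u n) < e" if "m \<ge> N" "n \<ge> N" for m n
    proof -
      have "\<omega> * snrm ipE (u m - u n) < \<omega> * e"
        using snrm_le_energy(1)[OF dH[of m n]] N[OF that] by linarith
      then show ?thesis using \<omega>_pos by simp
    qed
    then show ?thesis by blast
  qed
  from E.complete[of u, OF Hcurl_L2[OF uH] this]
  obtain l where l: "l \<in> L2 \<Omega>" "(\<lambda>n. snrm ipE (u n - l)) \<longlonglongrightarrow> 0" by blast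
  have "\<exists>N. \<forall>m\<ge>N. \<forall>n\<ge>N. snrm ipX (cu (u m) - cu (u n)) < e" if "e > 0" for e
  proof -
    from cauchy[OF that] obtain N where N: "\<And>m n. m \<ge> N \<Longrightarrow> n \<ge> N \<Longrightarrow> snrm eip (u m - u n) < e" by blast
    have "snrm ipX (cu (u m) - cu (u n)) < e" if "m \<ge> N" "n \<ge> N" for m n
      using snrm_le_energy(2)[OF dH[of m n]] N[OF that] curl_diff_snrm[OF uH uH, of m n] by linarith
    then show ?thesis by blast
  qed
  from X.complete[of "\<lambda>n. cu (u n)", OF curl_L2[OF uH] this]
  obtain w where w: "w \<in> L2 \<Omega>" "(\<lambda>n. snrm ipX (cu (u n) - w)) \<longlonglongrightarrow> 0" by blast
  note lim = H0_limit[OF u l(1) w(1) l(2) w(2)]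
  have lH: "l \<in> Hcurl \<Omega>" by (rule H0_Hcurl[OF lim(1)])
  have "snrm ipX (cu (u n - l)) = snrm ipX (cu (u n) - w)" for n
  proof -
    have "AE x in lebesgue_on \<Omega>. (cu (u n) - cu l) x = (cu (u n) - w) x"
      using lim(2) by (rule eventually_mono) simp
    then have "ipX (cu (u n) - cu l) (cu (u n) - cu l) = ipX (cu (u n) - w) (cu (u n) - w)"
      by (intro X.wip_cong_AE L2_diff curl_L2 uH lH w)
    then show ?thesis using curl_diff_snrm[OF uH lH, of n] by (simp add: snrm_def)
  qed
  then have "snrm eip (u n - l) = sqrt ((\<omega> * snrm ipE (u n - l))\<^sup>2 + (snrm ipX (cu (u n) - w))\<^sup>2)" for n
    using snrm_eip_eq[OF Hcurl_diff[OF uH lH], of n] by simp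
  moreover have "(\<lambda>n. sqrt ((\<omega> * snrm ipE (u n - l))\<^sup>2 + (snrm ipX (cu (u n) - w))\<^sup>2)) \<longlonglongrightarrow> sqrt ((\<omega> * 0)\<^sup>2 + 0\<^sup>2)"
    by (intro tendsto_intros l w)
  ultimately have "(\<lambda>n. snrm eip (u n - l)) \<longlonglongrightarrow> 0" by simp
  then show "\<exists>l\<in>H0. (\<lambda>n. snrm eip (u n - l)) \<longlonglongrightarrow> 0" using lim(1) by blast
qed

section \<open>The sesquilinear form\<close>

lemma b_diff_left: "u \<in> Hcurl \<Omega> \<Longrightarrow> v \<in> Hcurl \<Omega> \<Longrightarrow> w \<in> Hcurl \<Omega> \<Longrightarrow> b (u - v) w = b u w - b v w"
  by (simp add: b_eq E.ip_diff_left ipX_curl_diff Hcurl_L2 curl_L2 algebra_simps)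

lemma b_vscale_left: "u \<in> Hcurl \<Omega> \<Longrightarrow> w \<in> Hcurl \<Omega> \<Longrightarrow> b (vscale a u) w = a * b u w"
  by (simp add: b_eq E.ip_scale_left ipX_curl_vscale Hcurl_L2 curl_L2 algebra_simps)

lemma b_sym: "u \<in> Hcurl \<Omega> \<Longrightarrow> v \<in> Hcurl \<Omega> \<Longrightarrow> b v u = cnj (b u v)"
  using E.ip_sym[of u v] X.ip_sym[of "cu u" "cu v"] by (simp add: b_eq Hcurl_L2 curl_L2)

lemma b_diff_right: "u \<in> Hcurl \<Omega> \<Longrightarrow> v \<in> Hcurl \<Omega> \<Longrightarrow> w \<in> Hcurl \<Omega> \<Longrightarrow> b w (u - v) = b w u - b w v"
  using b_sym[of "u - v" w] b_sym[of u w] b_sym[of v w] by (simp add: b_diff_left Hcurl_diff)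

text \<open>
  With \<open>f = u\<close> and \<open>g = curl u\<close> this is the continuity of the form; with \<open>f\<close> and \<open>g\<close> the misfits of the
  two constitutive laws it bounds the residual by the estimator.
\<close>

lemma residual_bound:
  assumes "f \<in> L2 \<Omega>" "g \<in> L2 \<Omega>" "v \<in> Hcurl \<Omega>"
  shows "cmod (complex_of_real (\<omega>\<^sup>2) * ipE f v - ipX g (cu v))
    \<le> sqrt ((\<omega> * snrm ipE f)\<^sup>2 + (snrm ipX g)\<^sup>2) * snrm eip v"
proof -
  have "cmod (complex_of_real (\<omega>\<^sup>2) * ipE f v - ipX g (cu v)) \<le> \<omega>\<^sup>2 * cmod (ipE f v) + cmod (ipX g (cu v))"
    by (rule order_trans[OF norm_triangle_ineq4]) (simp add: norm_mult norm_power)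
  also have "\<dots> \<le> \<omega>\<^sup>2 * (snrm ipE f * snrm ipE v) + snrm ipX g * snrm ipX (cu v)"
    by (intro add_mono mult_left_mono E.cauchy_schwarz X.cauchy_schwarz assms Hcurl_L2 curl_L2) simp
  also have "\<dots> = (\<omega> * snrm ipE f) * (\<omega> * snrm ipE v) + snrm ipX g * snrm ipX (cu v)"
    by (simp add: power2_eq_square)
  also have "\<dots> \<le> sqrt ((\<omega> * snrm ipE f)\<^sup>2 + (snrm ipX g)\<^sup>2) * snrm eip v"
    unfolding snrm_eip_eq[OF assms(3)] by (rule cauchy_schwarz_pair)
  finally show ?thesis .
qed

lemma b_bounded:
  assumes "u \<in> Hcurl \<Omega>" "v \<in> Hcurl \<Omega>" shows "cmod (b u v) \<le> snrm eip u * snrm eip v"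
proof -
  have "cmod (b u v) = cmod (complex_of_real (\<omega>\<^sup>2) * ipE u v - ipX (cu u) (cu v))"
    unfolding b_eq by (subst norm_minus_cancel[symmetric]) simp
  also have "\<dots> \<le> snrm eip u * snrm eip v"
    using residual_bound[OF Hcurl_L2[OF assms(1)] curl_L2[OF assms(1)] assms(2)]
    unfolding snrm_eip_eq[OF assms(1), symmetric] .
  finally show ?thesis .
qed

text \<open>Rescaling turns the infimum over the unit sphere into a stability estimate.\<close>

lemma inf_sup_stability:
  assumes \<gamma>: "\<gamma> > 0" "inf_sup eps chi \<omega> \<Omega> \<ge> 1 / \<gamma>"
    and u: "u \<in> H0" and \<beta>: "0 \<le> \<beta>" "\<And>v. v \<in> H0 \<Longrightarrow> cmod (b u v) \<le> \<beta> * snrm eip v"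
  shows "snrm eip u \<le> \<gamma> * \<beta>"
proof (cases "snrm eip u = 0")
  case True
  then show ?thesis using \<gamma>(1) \<beta>(1) by simp
next
  case False
  let ?U = "unit_sphere eps chi \<omega> \<Omega>"
  have U: "v \<in> ?U \<longleftrightarrow> v \<in> H0 \<and> snrm eip v = 1" for v
    by (auto simp: unit_sphere_def energy_norm_eq H0_Hcurl)
  define N where "N = snrm eip u"
  have N: "N > 0" using False energy0.snrm_nonneg[OF u] unfolding N_def by simp
  define z where "z = vscale (complex_of_real (1 / N)) u"
  have z: "z \<in> ?U"
    using energy0.scale_mem[OF u] energy0.snrm_scale[OF u, of "complex_of_real (1 / N)"] N
    unfolding U z_def by (simp add: N_def norm_divide)
  have bdd: "bdd_above ((\<lambda>v. cmod (b e v)) ` ?U)" if "e \<in> ?U" for e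
  proof (rule bdd_aboveI2)
    show "cmod (b e v) \<le> 1" if "v \<in> ?U" for v
      using b_bounded[of e v] that \<open>e \<in> ?U\<close> by (simp add: U H0_Hcurl)
  qed
  have "bdd_below ((\<lambda>e. SUP v\<in>?U. cmod (b e v)) ` ?U)"
  proof (rule bdd_belowI2)
    show "0 \<le> (SUP v\<in>?U. cmod (b e v))" if "e \<in> ?U" for e
      by (rule cSUP_upper2[OF bdd[OF that] that]) simp
  qed
  then have "inf_sup eps chi \<omega> \<Omega> \<le> (SUP v\<in>?U. cmod (b z v))"
    unfolding inf_sup_def by (rule cINF_lower[OF _ z])
  also have "\<dots> \<le> \<beta> / N"
  proof (rule cSUP_least)
    show "?U \<noteq> {}" using z by blast
    fix v assume v: "v \<in> ?U"
    then have "cmod (b z v) = (1 / N) * cmod (b u v)"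
      unfolding z_def using u N by (simp add: U b_vscale_left H0_Hcurl norm_mult norm_divide)
    also have "\<dots> \<le> (1 / N) * (\<beta> * 1)"
      using \<beta>(2)[of v] v N by (intro mult_left_mono) (auto simp: U)
    finally show "cmod (b z v) \<le> \<beta> / N" by simp
  qed
  finally have "1 / \<gamma> \<le> \<beta> / N" using \<gamma>(2) by linarith
  then have "N \<le> \<gamma> * \<beta>" using \<gamma>(1) N by (simp add: field_simps)
  then show ?thesis unfolding N_def .
qed

end

section \<open>The dual problem and the approximation factor\<close>

lemma wip_coeff_inv_mult:
  assumes "\<And>x v. x \<in> D \<Longrightarrow> rmat_mult (\<rho> x) (rmat_mult (matrix_inv (\<rho> x)) v) = v"
  shows "wip \<rho> D (coeff_inv_mult \<rho> w) u = l2_inner D w u"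
  unfolding wip_def l2_inner_def coeff_mult_def coeff_inv_mult_def
  by (intro Bochner_Integration.integral_cong) (use assms in auto)

text \<open>
  The field \<open>(0, x\<^sub>1, 0)\<close> has the constant curl \<open>(0, 0, 1)\<close>. It serves to show that the approximation
  factor is a supremum over a nonempty set.
\<close>

lemma (in bounded_domain) curl_rotation_field:
  obtains u where "u \<in> Hcurl D" "AE x in lebesgue_on D. curl D u x = axis 3 1"
proof -
  define u :: vfield where "u x = (\<chi> i. if i = 2 then complex_of_real (x $ 1) else 0)" for x
  have comp: "(\<lambda>x. u x $ 1) = (\<lambda>x. 0)" "(\<lambda>x. u x $ 2) = (\<lambda>x. complex_of_real (x $ 1))" "(\<lambda>x. u x $ 3) = (\<lambda>x. 0)"
    by (simp_all add: u_def)
  have smooth: "C_k (Suc 0) (\<lambda>x. u x $ i)" for i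
    using exhaust_3[of i] comp C_k_const[of "Suc 0"] C_k_coordinate[of "Suc 0" 1] by metis
  have d0: "pderiv3 i (\<lambda>x. 0) x = 0" for i x
    using pderiv3_eq[OF has_derivative_const] by simp
  have d1: "pderiv3 i (\<lambda>x. complex_of_real (x $ 1)) x = complex_of_real (axis i 1 $ 1)" for i x
    using pderiv3_eq[OF has_derivative_of_real[OF has_derivative_coordinate]] by simp
  have "classical_curl u x = axis 3 1" for x
    unfolding classical_curl_def comp d0 d1 by (simp add: vec_eq_iff forall_3 axis_def)
  then show ?thesis using smooth_field_Hcurl[of u, OF smooth] that by simp
qed

lemma coeff_inv_mult_cong:
  "AE x in M. w x = z x \<Longrightarrow> AE x in M. coeff_inv_mult \<rho> w x = coeff_inv_mult \<rho> z x"
  by (rule eventually_mono) (auto simp: coeff_inv_mult_def)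

lemma coeff_inv_mult_diff: "coeff_inv_mult \<rho> (w - z) = coeff_inv_mult \<rho> w - coeff_inv_mult \<rho> z"
  and coeff_inv_mult_vscale: "coeff_inv_mult \<rho> (vscale a w) = vscale a (coeff_inv_mult \<rho> w)"
  by (simp_all add: coeff_inv_mult_def vscale_def fun_eq_iff rmat_mult_diff rmat_mult_scale)

text \<open>
  With \<open>s\<^sup>2 = 1 + 2 g + 3 g\<^sup>2\<close> one has \<open>s \<le> (1 + g)\<^sup>2\<close>, that is, \<open>2 g\<^sup>2 \<le> s (s - 1)\<close>; so \<open>x > s \<eta>\<close> would give
  \<open>x (x - \<eta>) > s (s - 1) \<eta>\<^sup>2 \<ge> 2 t\<^sup>2\<close>.
\<close>

lemma quadratic_estimate:
  fixes x \<eta> g t :: real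
  assumes "0 \<le> x" "0 \<le> \<eta>" "0 \<le> g" "0 \<le> t" "x\<^sup>2 \<le> \<eta> * x + 2 * t\<^sup>2" "t \<le> g * \<eta>"
  shows "x \<le> sqrt (1 + 2 * g + 3 * g\<^sup>2) * \<eta>"
proof (rule ccontr)
  define s where "s = sqrt (1 + 2 * g + 3 * g\<^sup>2)"
  assume "\<not> x \<le> sqrt (1 + 2 * g + 3 * g\<^sup>2) * \<eta>"
  then have x: "s * \<eta> < x" by (simp add: s_def)
  have s2: "s\<^sup>2 = 1 + 2 * g + 3 * g\<^sup>2" using assms(3) by (simp add: s_def)
  have s1: "1 \<le> s" using assms(3) by (simp add: s_def)
  have "s \<le> (1 + g)\<^sup>2"
  proof (rule power2_le_imp_le)
    have "((1 + g)\<^sup>2)\<^sup>2 = 1 + 4 * g + 6 * g\<^sup>2 + 4 * g^3 + g^4"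
      by (simp add: power2_eq_square power3_eq_cube power4_eq_xxxx algebra_simps)
    then show "s\<^sup>2 \<le> ((1 + g)\<^sup>2)\<^sup>2" using assms(3) by (simp add: s2)
  qed simp
  then have sg: "2 * g\<^sup>2 \<le> s * (s - 1)"
    using s2 by (simp add: power2_eq_square algebra_simps)
  have t2: "t\<^sup>2 \<le> g\<^sup>2 * \<eta>\<^sup>2" using power_mono[OF assms(6,4), of 2] by (simp add: power_mult_distrib)
  have sn: "\<eta> \<le> s * \<eta>" using mult_right_mono[OF s1 assms(2)] by simp
  have "2 * t\<^sup>2 \<le> (s * (s - 1)) * \<eta>\<^sup>2"
    using t2 mult_right_mono[OF sg, of "\<eta>\<^sup>2"] by simp
  also have "\<dots> = (s * \<eta>) * (s * \<eta> - \<eta>)" by (simp add: power2_eq_square algebra_simps)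
  also have "\<dots> < x * (x - \<eta>)"
    using x sn assms(2) s1 by (intro mult_strict_mono') auto
  finally show False using assms(5) by (simp add: power2_eq_square algebra_simps)
qed

context maxwell
begin

lemmas ipE_inv = wip_coeff_inv_mult[of \<Omega> eps, OF inv_eps]
lemmas ipX_inv = wip_coeff_inv_mult[of \<Omega> chi, OF inv_chi]

text \<open>
  The chosen representatives of the curls need not form a linear space, so neither need the fields of
  \<open>\<Lambda>_space\<close>. Saturating with respect to equality almost everywhere gives a subspace, onto whose closure
  one can project.
\<close>

definition Lambda_ae :: "vfield set" where
  "Lambda_ae = {\<theta> \<in> L2 \<Omega>. \<exists>\<phi>\<in>Hcurl \<Omega>. AE x in lebesgue_on \<Omega>. \<theta> x = coeff_inv_mult eps (cu \<phi>) x}"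

lemma Lambda_ae_mem: "\<phi> \<in> Hcurl \<Omega> \<Longrightarrow> coeff_inv_mult eps (cu \<phi>) \<in> Lambda_ae"
  unfolding Lambda_ae_def using inv_eps_L2 curl_L2 by auto

lemma csubspace_Lambda_ae: "csubspace vscale Lambda_ae"
  unfolding csubspace_def
proof (intro conjI ballI allI)
  have "(\<lambda>x. 0) \<in> Hcurl \<Omega>" by (rule HcurlI[OF L2_zero L2_zero has_weak_curl_zero])
  then show "Lambda_ae \<noteq> {}" using Lambda_ae_mem by blast
next
  fix \<theta> \<theta>' assume "\<theta> \<in> Lambda_ae" "\<theta>' \<in> Lambda_ae"
  then obtain \<phi> \<phi>' where \<phi>: "\<phi> \<in> Hcurl \<Omega>" "\<phi>' \<in> Hcurl \<Omega>" and L: "\<theta> \<in> L2 \<Omega>" "\<theta>' \<in> L2 \<Omega>"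
    and ae: "AE x in lebesgue_on \<Omega>. \<theta> x = coeff_inv_mult eps (cu \<phi>) x" "AE x in lebesgue_on \<Omega>. \<theta>' x = coeff_inv_mult eps (cu \<phi>') x"
    unfolding Lambda_ae_def by blast
  have "AE x in lebesgue_on \<Omega>. (\<theta> - \<theta>') x = coeff_inv_mult eps (cu (\<phi> - \<phi>')) x"
    using ae coeff_inv_mult_cong[where z = "cu \<phi> - cu \<phi>'", OF curl_diff_AE[OF \<phi>], of eps]
    unfolding coeff_inv_mult_diff by eventually_elim simp
  then show "\<theta> - \<theta>' \<in> Lambda_ae" unfolding Lambda_ae_def using L2_diff[OF L] Hcurl_diff[OF \<phi>] by blast
next
  fix a \<theta> assume "\<theta> \<in> Lambda_ae"
  then obtain \<phi> where \<phi>: "\<phi> \<in> Hcurl \<Omega>" and L: "\<theta> \<in> L2 \<Omega>"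
    and ae: "AE x in lebesgue_on \<Omega>. \<theta> x = coeff_inv_mult eps (cu \<phi>) x"
    unfolding Lambda_ae_def by blast
  have "AE x in lebesgue_on \<Omega>. vscale a \<theta> x = coeff_inv_mult eps (cu (vscale a \<phi>)) x"
    using ae coeff_inv_mult_cong[where z = "vscale a (cu \<phi>)", OF curl_vscale_AE[OF \<phi>, of a], of eps]
    unfolding coeff_inv_mult_vscale by eventually_elim (simp add: vscale_def)
  then show "vscale a \<theta> \<in> Lambda_ae" unfolding Lambda_ae_def using L2_vscale[OF L] Hcurl_vscale[OF \<phi>] by blast
qed

lemma Lambda_ae_sub: "Lambda_ae \<subseteq> L2 \<Omega>"
  by (auto simp: Lambda_ae_def)

lemma snrm_cong_AE:
  assumes "u \<in> L2 \<Omega>" "v \<in> L2 \<Omega>" "AE x in lebesgue_on \<Omega>. u x = v x"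
  shows "snrm ipE u = snrm ipE v"
  unfolding snrm_def using E.wip_cong_AE[OF assms(1,2,1,2,3,3)] by simp

text \<open>
  Every element of \<open>Lambda_ae\<close> can be normalized within the set over which the supremum is taken, up to
  equality almost everywhere.
\<close>

lemma Lambda_ae_normalize:
  assumes "\<theta> \<in> Lambda_ae" "snrm ipE \<theta> \<noteq> 0"
  obtains \<kappa> where "\<kappa> \<in> \<Lambda>_space eps \<Omega>" "\<kappa> \<in> L2 \<Omega>" "snrm ipE \<kappa> = 1"
    "\<And>v. v \<in> L2 \<Omega> \<Longrightarrow> ipE \<theta> v = complex_of_real (snrm ipE \<theta>) * ipE \<kappa> v"
proof -
  define N where "N = snrm ipE \<theta>"
  have L: "\<theta> \<in> L2 \<Omega>" using assms(1) Lambda_ae_sub by blast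
  have N: "N > 0" using assms(2) E.snrm_nonneg[OF L] unfolding N_def by simp
  have "vscale (complex_of_real (1 / N)) \<theta> \<in> Lambda_ae" by (rule csubspace_scale[OF csubspace_Lambda_ae assms(1)])
  then obtain \<phi> where \<phi>: "\<phi> \<in> Hcurl \<Omega>"
    and ae: "AE x in lebesgue_on \<Omega>. vscale (complex_of_real (1 / N)) \<theta> x = coeff_inv_mult eps (cu \<phi>) x"
    unfolding Lambda_ae_def by blast
  define \<kappa> where "\<kappa> = coeff_inv_mult eps (cu \<phi>)"
  have \<kappa>: "\<kappa> \<in> \<Lambda>_space eps \<Omega>" "\<kappa> \<in> L2 \<Omega>"
    using \<phi> inv_eps_L2[OF curl_L2[OF \<phi>]] by (auto simp: \<Lambda>_space_def \<kappa>_def)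
  have sL: "vscale (complex_of_real (1 / N)) \<theta> \<in> L2 \<Omega>" by (rule L2_vscale[OF L])
  have "snrm ipE \<kappa> = snrm ipE (vscale (complex_of_real (1 / N)) \<theta>)"
    using snrm_cong_AE[OF sL \<kappa>(2)] ae unfolding \<kappa>_def by simp
  also have "\<dots> = 1" using E.snrm_scale[OF L, of "complex_of_real (1 / N)"] N by (simp add: N_def norm_divide)
  finally have one: "snrm ipE \<kappa> = 1" .
  have "ipE \<theta> v = complex_of_real (snrm ipE \<theta>) * ipE \<kappa> v" if v: "v \<in> L2 \<Omega>" for v
  proof -
    have "ipE \<kappa> v = ipE (vscale (complex_of_real (1 / N)) \<theta>) v"
      by (rule E.wip_cong_AE[OF \<kappa>(2) sL v v]) (use ae in \<open>auto simp: \<kappa>_def elim!: eventually_mono\<close>)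
    also have "\<dots> = complex_of_real (1 / N) * ipE \<theta> v" by (rule E.ip_scale_left[OF L v])
    finally show ?thesis using N unfolding N_def by simp
  qed
  with \<kappa> one show ?thesis by (rule that)
qed

text \<open>
  The description of \<open>\<xi>_sol\<close> by a choice operator is meaningful because the dual problem has a solution,
  which is moreover bounded by the datum.
\<close>

lemma dual_problem_solvable:
  assumes \<gamma>: "\<gamma> > 0" "inf_sup eps chi \<omega> \<Omega> \<ge> 1 / \<gamma>" and \<theta>: "\<theta> \<in> L2 \<Omega>"
  shows "\<xi>_sol eps chi \<omega> \<Omega> \<theta> \<in> H0"
    and "\<And>v. v \<in> H0 \<Longrightarrow> b (\<xi>_sol eps chi \<omega> \<Omega> \<theta>) v = complex_of_real \<omega> * ipE \<theta> v"
    and "snrm eip (\<xi>_sol eps chi \<omega> \<Omega> \<theta>) \<le> \<gamma> * snrm ipE \<theta>"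
proof -
  have bd: "cmod (complex_of_real \<omega> * ipE \<theta> v) \<le> snrm ipE \<theta> * snrm eip v" if v: "v \<in> H0" for v
  proof -
    have "cmod (complex_of_real \<omega> * ipE \<theta> v) \<le> \<omega> * (snrm ipE \<theta> * snrm ipE v)"
      using E.cauchy_schwarz[OF \<theta> Hcurl_L2[OF H0_Hcurl[OF v]]] \<omega>_pos by (simp add: norm_mult)
    also have "\<dots> = snrm ipE \<theta> * (\<omega> * snrm ipE v)" by simp
    also have "\<dots> \<le> snrm ipE \<theta> * snrm eip v"
      by (intro mult_left_mono snrm_le_energy(1) H0_Hcurl v E.snrm_nonneg \<theta>)
    finally show ?thesis .
  qed
  have "\<exists>\<xi>\<in>H0. \<forall>v\<in>H0. b \<xi> v = complex_of_real \<omega> * ipE \<theta> v"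
  proof (rule energy0.hermitian_infsup_solvable[where B = 1 and C = "snrm ipE \<theta>" and \<gamma> = \<gamma>])
    show "b (x - y) v = b x v - b y v" if "x \<in> H0" "y \<in> H0" "v \<in> H0" for x y v
      using that H0_Hcurl b_diff_left by blast
    show "b (vscale c x) v = c * b x v" if "x \<in> H0" "v \<in> H0" for c x v
      using that H0_Hcurl b_vscale_left by blast
    show "b y x = cnj (b x y)" if "x \<in> H0" "y \<in> H0" for x y
      using that H0_Hcurl b_sym by blast
    show "cmod (b x y) \<le> 1 * snrm eip x * snrm eip y" if "x \<in> H0" "y \<in> H0" for x y
      using b_bounded[OF H0_Hcurl H0_Hcurl, OF that] by simp
    show "snrm eip u \<le> \<gamma> * \<beta>" if "u \<in> H0" "0 \<le> \<beta>" "\<And>v. v \<in> H0 \<Longrightarrow> cmod (b u v) \<le> \<beta> * snrm eip v" for u \<beta>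
      by (rule inf_sup_stability[OF \<gamma> that])
    show "complex_of_real \<omega> * ipE \<theta> (x - y) = complex_of_real \<omega> * ipE \<theta> x - complex_of_real \<omega> * ipE \<theta> y"
      if "x \<in> H0" "y \<in> H0" for x y
      using that \<theta> by (simp add: E.ip_diff_right Hcurl_L2 H0_Hcurl algebra_simps)
    show "complex_of_real \<omega> * ipE \<theta> (vscale c x) = cnj c * (complex_of_real \<omega> * ipE \<theta> x)" if "x \<in> H0" for c x
      using that \<theta> by (simp add: E.ip_scale_right Hcurl_L2 H0_Hcurl algebra_simps)
    show "cmod (complex_of_real \<omega> * ipE \<theta> x) \<le> snrm ipE \<theta> * snrm eip x" if "x \<in> H0" for x
      by (rule bd[OF that])
  qed
  then have "\<exists>\<xi>. \<xi> \<in> H0 \<and> (\<forall>v\<in>H0. b \<xi> v = complex_of_real \<omega> * ipE \<theta> v)" by blast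
  from someI_ex[OF this] have s: "\<xi>_sol eps chi \<omega> \<Omega> \<theta> \<in> H0 \<and>
    (\<forall>v\<in>H0. b (\<xi>_sol eps chi \<omega> \<Omega> \<theta>) v = complex_of_real \<omega> * ipE \<theta> v)"
    unfolding \<xi>_sol_def wip_def .
  then show "\<xi>_sol eps chi \<omega> \<Omega> \<theta> \<in> H0"
    and "\<And>v. v \<in> H0 \<Longrightarrow> b (\<xi>_sol eps chi \<omega> \<Omega> \<theta>) v = complex_of_real \<omega> * ipE \<theta> v" by auto
  show "snrm eip (\<xi>_sol eps chi \<omega> \<Omega> \<theta>) \<le> \<gamma> * snrm ipE \<theta>"
    by (rule inf_sup_stability[OF \<gamma>]) (use s bd E.snrm_nonneg[OF \<theta>] in auto)
qed

text \<open>
  A real supremum bounds its family only if the family is bounded; here each infimum is at most the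
  energy norm of the dual solution itself, hence at most \<open>\<gamma>\<close>.
\<close>

lemma approximation_factor_upper:
  assumes \<gamma>: "\<gamma> > 0" "inf_sup eps chi \<omega> \<Omega> \<ge> 1 / \<gamma>"
    and W: "W \<subseteq> H0" "(\<lambda>x. 0) \<in> W"
    and \<kappa>: "\<kappa> \<in> \<Lambda>_space eps \<Omega>" "snrm ipE \<kappa> = 1"
  shows "(INF v\<in>W. snrm eip (\<xi>_sol eps chi \<omega> \<Omega> \<kappa> - v)) \<le> \<gamma>_ba eps chi \<omega> \<Omega> W"
proof -
  let ?S = "{\<theta> \<in> \<Lambda>_space eps \<Omega>. wnorm eps \<Omega> \<theta> = 1}"
  let ?xi = "\<xi>_sol eps chi \<omega> \<Omega>"
  have L: "\<theta> \<in> L2 \<Omega>" if "\<theta> \<in> ?S" for \<theta>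
    using that inv_eps_L2 curl_L2 by (auto simp: \<Lambda>_space_def)
  have xi: "?xi \<theta> - v \<in> H0" if "\<theta> \<in> ?S" "v \<in> W" for \<theta> v
    using dual_problem_solvable(1)[OF \<gamma> L[OF that(1)]] W that by (intro energy0.diff_mem) auto
  have eq: "(INF v\<in>W. energy_norm eps chi \<omega> \<Omega> (\<lambda>x. ?xi \<theta> x - v x)) = (INF v\<in>W. snrm eip (?xi \<theta> - v))"
    if "\<theta> \<in> ?S" for \<theta>
  proof (rule INF_cong[OF refl])
    fix v assume "v \<in> W"
    from energy_norm_eq[OF H0_Hcurl[OF xi[OF that this]]]
    show "energy_norm eps chi \<omega> \<Omega> (\<lambda>x. ?xi \<theta> x - v x) = snrm eip (?xi \<theta> - v)"
      by (simp add: fun_diff_def)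
  qed
  have "bdd_above ((\<lambda>\<theta>. INF v\<in>W. energy_norm eps chi \<omega> \<Omega> (\<lambda>x. ?xi \<theta> x - v x)) ` ?S)"
  proof (rule bdd_aboveI2)
    fix \<theta> assume \<theta>: "\<theta> \<in> ?S"
    have "(INF v\<in>W. snrm eip (?xi \<theta> - v)) \<le> snrm eip (?xi \<theta> - (\<lambda>x. 0))"
      by (rule cINF_lower[OF bdd_belowI2[of _ 0] W(2)]) (use energy0.snrm_nonneg[OF xi[OF \<theta>]] in auto)
    also have "?xi \<theta> - (\<lambda>x. 0) = ?xi \<theta>" by (simp add: fun_eq_iff)
    also have "snrm eip (?xi \<theta>) \<le> \<gamma> * 1"
      using dual_problem_solvable(3)[OF \<gamma> L[OF \<theta>]] \<theta> by (simp add: wnorm_eq_snrm)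
    finally show "(INF v\<in>W. energy_norm eps chi \<omega> \<Omega> (\<lambda>x. ?xi \<theta> x - v x)) \<le> \<gamma> * 1"
      by (simp only: eq[OF \<theta>])
  qed
  moreover have \<kappa>S: "\<kappa> \<in> ?S" using \<kappa> by (simp add: wnorm_eq_snrm)
  ultimately have "(INF v\<in>W. energy_norm eps chi \<omega> \<Omega> (\<lambda>x. ?xi \<kappa> x - v x)) \<le> \<gamma>_ba eps chi \<omega> \<Omega> W"
    unfolding \<gamma>_ba_def by (intro cSUP_upper)
  then show ?thesis by (simp only: eq[OF \<kappa>S])
qed

text \<open>
  Each infimum is nonnegative, but the real supremum of the empty set has no specified value: at least
  one normalized field is needed.
\<close>

lemma approximation_factor_nonneg:
  assumes \<gamma>: "\<gamma> > 0" "inf_sup eps chi \<omega> \<Omega> \<ge> 1 / \<gamma>" and W: "W \<subseteq> H0" "(\<lambda>x. 0) \<in> W"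
  shows "0 \<le> \<gamma>_ba eps chi \<omega> \<Omega> W"
proof -
  obtain u where u: "u \<in> Hcurl \<Omega>" and ae: "AE x in lebesgue_on \<Omega>. cu u x = axis 3 1"
    using curl_rotation_field by blast
  let ?\<theta> = "coeff_inv_mult eps (cu u)"
  have lm: "\<Omega> \<in> lmeasurable" using bounded_D open_D by (simp add: lmeasurable_open)
  have cL: "(\<lambda>x. axis 3 1 :: complex^3) \<in> L2 \<Omega>" by (rule continuous_L2) (rule continuous_on_const)
  have "l2_inner \<Omega> (cu u) (cu u) = l2_inner \<Omega> (\<lambda>x. axis 3 1) (\<lambda>x. axis 3 1)"
    by (rule L2.wip_cong_AE[OF curl_L2[OF u] cL curl_L2[OF u] cL ae ae])
  also have "\<dots> = complex_of_real (measure lebesgue \<Omega>)"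
  proof -
    have "hdot (axis 3 1) (axis 3 1) = 1" by (simp add: hdot_def sum_3 axis_def)
    then show ?thesis using lm by (simp add: l2_inner_def measure_restrict_space scaleR_conv_of_real)
  qed
  finally have "l2_inner \<Omega> (cu u) (cu u) \<noteq> 0"
    using lm open_not_negligible[OF open_D \<Omega>_nonempty] by (simp add: negligible_iff_measure0)
  then have "ipE ?\<theta> (cu u) \<noteq> 0" by (simp add: ipE_inv)
  then have "snrm ipE ?\<theta> \<noteq> 0"
    using E.cauchy_schwarz[OF inv_eps_L2[OF curl_L2[OF u]] curl_L2[OF u]] by auto
  from Lambda_ae_normalize[OF Lambda_ae_mem[OF u] this]
  obtain \<kappa> where \<kappa>: "\<kappa> \<in> \<Lambda>_space eps \<Omega>" "\<kappa> \<in> L2 \<Omega>" "snrm ipE \<kappa> = 1" by blast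
  have "0 \<le> (INF v\<in>W. snrm eip (\<xi>_sol eps chi \<omega> \<Omega> \<kappa> - v))"
  proof (rule cINF_greatest)
    show "0 \<le> snrm eip (\<xi>_sol eps chi \<omega> \<Omega> \<kappa> - v)" if "v \<in> W" for v
      using dual_problem_solvable(1)[OF \<gamma> \<kappa>(2)] W that by (intro energy0.snrm_nonneg energy0.diff_mem) auto
  qed (use W in blast)
  also have "\<dots> \<le> \<gamma>_ba eps chi \<omega> \<Omega> W" by (rule approximation_factor_upper[OF \<gamma> W \<kappa>(1,3)])
  finally show ?thesis .
qed

text \<open>
  The Aubin-Nitsche argument: with the dual solution \<open>\<xi>\<close> for the datum \<open>\<theta>\<close>, the quantity \<open>\<omega> (\<epsilon>\<theta>, e)\<close> is
  \<open>b(\<xi>, e)\<close>, in modulus \<open>|b(e, \<xi> - v)| \<le> \<eta> |||\<xi> - v|||\<close> for every discrete \<open>v\<close> by Galerkin orthogonality.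
\<close>

lemma duality_bound:
  assumes \<gamma>: "\<gamma> > 0" "inf_sup eps chi \<omega> \<Omega> \<ge> 1 / \<gamma>" and W: "W \<subseteq> H0" "(\<lambda>x. 0) \<in> W"
    and e: "e \<in> H0" and \<eta>: "0 \<le> \<eta>" "\<And>v. v \<in> H0 \<Longrightarrow> cmod (b e v) \<le> \<eta> * snrm eip v"
    and orth: "\<And>v. v \<in> W \<Longrightarrow> b e v = 0"
    and \<theta>: "\<theta> \<in> Lambda_ae"
  shows "\<omega> * cmod (ipE \<theta> e) \<le> \<gamma>_ba eps chi \<omega> \<Omega> W * \<eta> * snrm ipE \<theta>"
proof (cases "snrm ipE \<theta> = 0")
  case True
  have "\<theta> \<in> L2 \<Omega>" using \<theta> Lambda_ae_sub by blast
  then show ?thesis using E.cauchy_schwarz[of \<theta> e] True Hcurl_L2[OF H0_Hcurl[OF e]] by simp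
next
  case False
  obtain \<kappa> where \<kappa>: "\<kappa> \<in> \<Lambda>_space eps \<Omega>" "\<kappa> \<in> L2 \<Omega>" "snrm ipE \<kappa> = 1"
    "\<And>v. v \<in> L2 \<Omega> \<Longrightarrow> ipE \<theta> v = complex_of_real (snrm ipE \<theta>) * ipE \<kappa> v"
    using Lambda_ae_normalize[OF \<theta> False] by metis
  let ?xi = "\<xi>_sol eps chi \<omega> \<Omega> \<kappa>"
  note xi = dual_problem_solvable[OF \<gamma> \<kappa>(2)]
  have le: "\<omega> * cmod (ipE \<kappa> e) \<le> \<eta> * snrm eip (?xi - v)" if v: "v \<in> W" for v
  proof -
    have vH: "v \<in> H0" using v W by blast
    have "b e (?xi - v) = b e ?xi"
      using b_diff_right[OF H0_Hcurl[OF xi(1)] H0_Hcurl[OF vH] H0_Hcurl[OF e]] orth[OF v] by simp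
    also have "\<dots> = cnj (complex_of_real \<omega> * ipE \<kappa> e)"
      using b_sym[OF H0_Hcurl[OF xi(1)] H0_Hcurl[OF e]] xi(2)[OF e] by simp
    finally have "\<omega> * cmod (ipE \<kappa> e) = cmod (b e (?xi - v))"
      using \<omega>_pos by (simp add: norm_mult)
    also have "\<dots> \<le> \<eta> * snrm eip (?xi - v)" by (rule \<eta>(2)[OF energy0.diff_mem[OF xi(1) vH]])
    finally show ?thesis .
  qed
  have "\<omega> * cmod (ipE \<kappa> e) \<le> \<gamma>_ba eps chi \<omega> \<Omega> W * \<eta>"
  proof (cases "\<eta> = 0")
    case True
    then show ?thesis using le[OF W(2)] by simp
  next
    case False
    then have pos: "\<eta> > 0" using \<eta>(1) by simp
    have "\<omega> * cmod (ipE \<kappa> e) / \<eta> \<le> (INF v\<in>W. snrm eip (?xi - v))"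
      by (rule cINF_greatest) (use W(2) le pos in \<open>auto simp: field_simps\<close>)
    also have "\<dots> \<le> \<gamma>_ba eps chi \<omega> \<Omega> W" by (rule approximation_factor_upper[OF \<gamma> W \<kappa>(1,3)])
    finally show ?thesis using pos by (simp add: field_simps)
  qed
  then have "\<omega> * cmod (ipE \<kappa> e) * snrm ipE \<theta> \<le> \<gamma>_ba eps chi \<omega> \<Omega> W * \<eta> * snrm ipE \<theta>"
    using E.snrm_nonneg \<theta> Lambda_ae_sub by (intro mult_right_mono) auto
  moreover have "cmod (ipE \<theta> e) = cmod (ipE \<kappa> e) * snrm ipE \<theta>"
    using \<kappa>(4)[OF Hcurl_L2[OF H0_Hcurl[OF e]]] E.snrm_nonneg[of \<theta>] \<theta> Lambda_ae_sub by (auto simp: norm_mult)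
  ultimately show ?thesis by (simp add: mult.assoc)
qed

section \<open>The error estimates\<close>

text \<open>
  Orthogonality in the weighted inner product to all \<open>\<epsilon>\<^sup>-\<^sup>1 curl \<phi>\<close> means orthogonality in \<open>L\<^sup>2\<close> to all
  \<open>curl \<phi>\<close>. For test fields \<open>\<phi>\<close> this says that the weak curl vanishes, and then for general \<open>\<phi>\<close> that the
  tangential trace vanishes.
\<close>

lemma orthogonal_Lambda_curl_free:
  assumes w: "w \<in> L2 \<Omega>" and orth: "\<And>\<theta>. \<theta> \<in> Lambda_ae \<Longrightarrow> ipE w \<theta> = 0"
  shows "w \<in> H0" "AE x in lebesgue_on \<Omega>. cu w x = 0"
proof -
  have curl_orth: "l2_inner \<Omega> w (cu \<phi>) = 0" if \<phi>: "\<phi> \<in> Hcurl \<Omega>" for \<phi>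
  proof -
    have i: "coeff_inv_mult eps (cu \<phi>) \<in> L2 \<Omega>" by (rule inv_eps_L2[OF curl_L2[OF \<phi>]])
    have "l2_inner \<Omega> w (cu \<phi>) = cnj (l2_inner \<Omega> (cu \<phi>) w)"
      by (rule L2.ip_sym[OF curl_L2[OF \<phi>] w])
    also have "\<dots> = cnj (ipE (coeff_inv_mult eps (cu \<phi>)) w)" by (simp add: ipE_inv)
    also have "\<dots> = ipE w (coeff_inv_mult eps (cu \<phi>))" by (rule E.ip_sym[OF i w, symmetric])
    finally show ?thesis using orth[OF Lambda_ae_mem[OF \<phi>]] by simp
  qed
  have wc: "has_weak_curl \<Omega> w (\<lambda>x. 0)"
    unfolding has_weak_curl_iff_l2_inner
  proof
    fix \<psi> assume \<psi>: "\<psi> \<in> test_fields \<Omega>"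
    note s = smooth_field_Hcurl[OF test_field_smooth[OF \<psi>]]
    have "l2_inner \<Omega> w (classical_curl \<psi>) = l2_inner \<Omega> w (cu \<psi>)"
      by (rule L2.wip_cong_AE[OF w w classical_curl_test_field_L2[OF \<psi>] curl_L2[OF s(1)]])
         (use s(2) in \<open>auto elim!: eventually_mono\<close>)
    then show "l2_inner \<Omega> w (classical_curl \<psi>) = l2_inner \<Omega> (\<lambda>x. 0) \<psi>"
      using curl_orth[OF s(1)] by (simp add: l2_inner_def hdot_def)
  qed
  show ae: "AE x in lebesgue_on \<Omega>. cu w x = 0" by (rule curl_AE_eq[OF w L2_zero wc])
  have wH: "w \<in> Hcurl \<Omega>" by (rule HcurlI[OF w L2_zero wc])
  have "l2_inner \<Omega> (cu w) \<phi> = l2_inner \<Omega> w (cu \<phi>)" if "\<phi> \<in> Hcurl \<Omega>" for \<phi>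
    using l2_inner_curl_left[OF wH L2_zero ae Hcurl_L2[OF that]] curl_orth[OF that]
    by (simp add: l2_inner_def hdot_def)
  then show "w \<in> H0" using wH Hcurl0_iff by blast
qed

text \<open>
  With the decomposition \<open>e = \<theta> + w\<close> into orthogonal parts, \<open>w\<close> curl-free, and \<open>z = \<theta> - w\<close>:
  \<open>b(e, z) = - \<omega>\<^sup>2 (\<parallel>\<theta>\<parallel>\<^sup>2 - \<parallel>w\<parallel>\<^sup>2) + \<parallel>curl e\<parallel>\<^sup>2 = |||e|||\<^sup>2 - 2 \<omega>\<^sup>2 \<parallel>\<theta>\<parallel>\<^sup>2\<close>. Reversing the sign of the gradient-like
  part \<open>w\<close> thus compensates the indefiniteness of the form, except for \<open>\<theta>\<close>, which duality controls.
\<close>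

lemma residual_estimates:
  assumes \<gamma>: "\<gamma> > 0" "inf_sup eps chi \<omega> \<Omega> \<ge> 1 / \<gamma>" and W: "W \<subseteq> H0" "(\<lambda>x. 0) \<in> W"
    and e: "e \<in> H0" and \<eta>: "0 \<le> \<eta>" "\<And>v. v \<in> H0 \<Longrightarrow> cmod (b e v) \<le> \<eta> * snrm eip v"
    and orth: "\<And>v. v \<in> W \<Longrightarrow> b e v = 0"
  shows "snrm eip e \<le> \<gamma> * \<eta>"
    and "snrm eip e \<le> sqrt (1 + 2 * \<gamma>_ba eps chi \<omega> \<Omega> W + 3 * (\<gamma>_ba eps chi \<omega> \<Omega> W)\<^sup>2) * \<eta>"
proof -
  show "snrm eip e \<le> \<gamma> * \<eta>" by (rule inf_sup_stability[OF \<gamma> e \<eta>])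
  have eL: "e \<in> L2 \<Omega>" by (rule Hcurl_L2[OF H0_Hcurl[OF e]])
  define g where "g = \<gamma>_ba eps chi \<omega> \<Omega> W"
  have g: "0 \<le> g" unfolding g_def by (rule approximation_factor_nonneg[OF \<gamma> W])
  obtain \<theta> m where \<theta>: "\<theta> \<in> L2 \<Omega>" and m: "\<And>n::nat. m n \<in> Lambda_ae" "(\<lambda>n. snrm ipE (m n - \<theta>)) \<longlonglongrightarrow> 0"
    and perp: "\<And>y. y \<in> Lambda_ae \<Longrightarrow> ipE (e - \<theta>) y = 0"
    using E.projection_onto_closure[OF csubspace_Lambda_ae Lambda_ae_sub eL] by blast
  define w where "w = e - \<theta>"
  have wL: "w \<in> L2 \<Omega>" unfolding w_def by (rule L2_diff[OF eL \<theta>])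
  have w: "w \<in> H0" "AE x in lebesgue_on \<Omega>. cu w x = 0"
    using orthogonal_Lambda_curl_free[OF wL] perp unfolding w_def by auto
  have mL: "m n \<in> L2 \<Omega>" for n using m(1) Lambda_ae_sub by blast
  have \<theta>eq: "\<theta> = e - w" by (simp add: w_def)
  have \<theta>H: "\<theta> \<in> H0" unfolding \<theta>eq by (rule energy0.diff_mem[OF e w(1)])
  have mw: "ipE (m n) w = 0" for n
    using perp[OF m(1)[of n]] E.ip_sym[OF wL mL[of n]] unfolding w_def by simp
  have \<theta>w: "ipE \<theta> w = 0"
    using E.ip_tendsto_left[OF mL \<theta> m(2) wL] by (simp add: mw LIMSEQ_const_iff)
  then have w\<theta>: "ipE w \<theta> = 0" using E.ip_sym[OF \<theta> wL] by simp
  \<comment> \<open>The duality bound for the approximants \<open>m n\<close> passes to their limit \<open>\<theta>\<close>.\<close>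
  have t_le: "\<omega> * snrm ipE \<theta> \<le> g * \<eta>"
  proof (cases "snrm ipE \<theta> = 0")
    case True
    then show ?thesis using g \<eta>(1) by simp
  next
    case False
    have "\<omega> * cmod (ipE \<theta> e) \<le> g * \<eta> * snrm ipE \<theta>"
    proof (rule LIMSEQ_le)
      show "(\<lambda>n. \<omega> * cmod (ipE (m n) e)) \<longlonglongrightarrow> \<omega> * cmod (ipE \<theta> e)"
        by (intro tendsto_intros E.ip_tendsto_left[OF mL \<theta> m(2) eL])
      show "(\<lambda>n. g * \<eta> * snrm ipE (m n)) \<longlonglongrightarrow> g * \<eta> * snrm ipE \<theta>"
        by (intro tendsto_intros E.snrm_tendsto[OF mL \<theta> m(2)])
      show "\<exists>N. \<forall>n\<ge>N. \<omega> * cmod (ipE (m n) e) \<le> g * \<eta> * snrm ipE (m n)"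
        using duality_bound[OF \<gamma> W e \<eta> orth m(1)] unfolding g_def by blast
    qed
    moreover have "ipE \<theta> e = complex_of_real ((snrm ipE \<theta>)\<^sup>2)"
      using E.ip_diff_right[OF eL wL \<theta>] \<theta>w E.ip_self[OF \<theta>] unfolding \<theta>eq[symmetric] by simp
    ultimately have "(\<omega> * snrm ipE \<theta>) * snrm ipE \<theta> \<le> (g * \<eta>) * snrm ipE \<theta>"
      by (simp add: power2_eq_square norm_mult mult.assoc)
    moreover have "snrm ipE \<theta> > 0" using False E.snrm_nonneg[OF \<theta>] by simp
    ultimately show ?thesis by (simp only: mult_le_cancel_right_pos)
  qed
  define z where "z = \<theta> - w"
  have zH: "z \<in> H0" unfolding z_def by (rule energy0.diff_mem[OF \<theta>H w(1)])
  have eH: "e \<in> Hcurl \<Omega>" and wH: "w \<in> Hcurl \<Omega>" and \<theta>H': "\<theta> \<in> Hcurl \<Omega>" and zH': "z \<in> Hcurl \<Omega>"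
    using e w(1) \<theta>H zH H0_Hcurl by blast+
  have curl_\<theta>: "AE x in lebesgue_on \<Omega>. cu \<theta> x = cu e x"
    using curl_diff_AE[OF eH wH] w(2) unfolding \<theta>eq[symmetric] by eventually_elim simp
  have curl_z: "AE x in lebesgue_on \<Omega>. cu z x = cu e x"
    using curl_diff_AE[OF \<theta>H' wH] w(2) curl_\<theta> unfolding z_def by eventually_elim simp
  have ez: "e = \<theta> + w" by (simp add: w_def)
  have nz: "snrm ipE z = snrm ipE e"
  proof (rule power2_eq_imp_eq)
    show "(snrm ipE z)\<^sup>2 = (snrm ipE e)\<^sup>2"
      unfolding ez z_def using E.snrm_diff_sq[OF \<theta> wL] E.snrm_add_sq[OF \<theta> wL] \<theta>w by simp
  qed (use E.snrm_nonneg eL Hcurl_L2[OF zH'] in auto)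
  have cz: "ipX (cu z) (cu z) = ipX (cu e) (cu e)" "ipX (cu e) (cu z) = ipX (cu e) (cu e)"
    by (rule X.wip_cong_AE; use curl_L2[OF eH] curl_L2[OF zH'] curl_z in simp)+
  have "snrm eip z = snrm eip e"
    unfolding snrm_eip_eq[OF eH] snrm_eip_eq[OF zH'] using nz cz(1) by (simp add: snrm_def)
  moreover have "ipE e z = complex_of_real ((snrm ipE \<theta>)\<^sup>2 - (snrm ipE w)\<^sup>2)"
    unfolding z_def ez using \<theta> wL \<theta>w w\<theta>
    by (simp add: E.ip_diff_right E.ip_add_left L2_add E.ip_self)
  then have "b e z = complex_of_real ((snrm eip e)\<^sup>2 - 2 * (\<omega> * snrm ipE \<theta>)\<^sup>2)"
  proof -
    have "(snrm ipE e)\<^sup>2 = (snrm ipE \<theta>)\<^sup>2 + (snrm ipE w)\<^sup>2"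
      unfolding ez using E.snrm_add_sq[OF \<theta> wL] \<theta>w by simp
    moreover have "b e z = complex_of_real (- \<omega>\<^sup>2 * ((snrm ipE \<theta>)\<^sup>2 - (snrm ipE w)\<^sup>2) + (snrm ipX (cu e))\<^sup>2)"
      using \<open>ipE e z = _\<close> cz(2) X.ip_self[OF curl_L2[OF eH]] by (simp add: b_eq)
    ultimately show ?thesis
      unfolding snrm_eip_sq[OF eH] by (simp add: power_mult_distrib algebra_simps)
  qed
  ultimately have "(snrm eip e)\<^sup>2 - 2 * (\<omega> * snrm ipE \<theta>)\<^sup>2 \<le> \<eta> * snrm eip e"
    using \<eta>(2)[OF zH] complex_Re_le_cmod[of "b e z"] by simp
  then have "(snrm eip e)\<^sup>2 \<le> \<eta> * snrm eip e + 2 * (\<omega> * snrm ipE \<theta>)\<^sup>2" by simp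
  from quadratic_estimate[OF energy0.snrm_nonneg[OF e] \<eta>(1) g _ this t_le]
  show "snrm eip e \<le> sqrt (1 + 2 * \<gamma>_ba eps chi \<omega> \<Omega> W + 3 * (\<gamma>_ba eps chi \<omega> \<Omega> W)\<^sup>2) * \<eta>"
    using \<omega>_pos E.snrm_nonneg[OF \<theta>] unfolding g_def by simp
qed

text \<open>
  Ampere's law replaces the current by \<open>curl Hh\<close> and \<open>Dh\<close>; since the test field has vanishing tangential
  trace, the curl can be moved from \<open>Hh\<close> onto it without a boundary term.
\<close>

lemma residual_representation:
  assumes J: "J \<in> L2 \<Omega>" and Dh: "Dh \<in> L2 \<Omega>" and Hh: "Hh \<in> Hcurl \<Omega>" and E: "E \<in> H0" and Eh: "Eh \<in> H0"
    and sol: "\<And>v. v \<in> H0 \<Longrightarrow> b E v = \<i> * complex_of_real \<omega> * l2_inner \<Omega> J v"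
    and ampere: "AE x in lebesgue_on \<Omega>.
      (\<i> * complex_of_real \<omega>) *s cu Hh x = (\<i> * complex_of_real \<omega>) *s J x + (complex_of_real \<omega>)\<^sup>2 *s Dh x"
    and v: "v \<in> H0"
  shows "b (E - Eh) v = complex_of_real (\<omega>\<^sup>2) * ipE (Eh - coeff_inv_mult eps Dh) v
    - ipX (cu Eh - vscale (\<i> * complex_of_real \<omega>) (coeff_inv_mult chi Hh)) (cu v)"
proof -
  let ?i = "\<i> * complex_of_real \<omega>"
  have vH: "v \<in> Hcurl \<Omega>" and EH: "E \<in> Hcurl \<Omega>" and EhH: "Eh \<in> Hcurl \<Omega>" using v E Eh H0_Hcurl by blast+
  note vL = Hcurl_L2[OF vH]
  have "?i * l2_inner \<Omega> J v = l2_inner \<Omega> (vscale ?i J) v" by (rule L2.ip_scale_left[OF J vL, symmetric])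
  also have "\<dots> = l2_inner \<Omega> (vscale ?i (cu Hh) - vscale ((complex_of_real \<omega>)\<^sup>2) Dh) v"
  proof (rule L2.wip_cong_AE[OF L2_vscale[OF J] L2_diff[OF L2_vscale[OF curl_L2[OF Hh]] L2_vscale[OF Dh]] vL vL])
    show "AE x in lebesgue_on \<Omega>. vscale ?i J x = (vscale ?i (cu Hh) - vscale ((complex_of_real \<omega>)\<^sup>2) Dh) x"
      using ampere by (rule eventually_mono) (simp add: vscale_def)
  qed simp
  also have "\<dots> = ?i * l2_inner \<Omega> (cu Hh) v - (complex_of_real \<omega>)\<^sup>2 * l2_inner \<Omega> Dh v"
    using Dh curl_L2[OF Hh] vL by (simp add: L2.ip_diff_left L2.ip_scale_left L2_vscale)
  also have "l2_inner \<Omega> (cu Hh) v = l2_inner \<Omega> Hh (cu v)"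
  proof -
    have "l2_inner \<Omega> (cu Hh) v = cnj (l2_inner \<Omega> v (cu Hh))" by (rule L2.ip_sym[OF vL curl_L2[OF Hh]])
    also have "l2_inner \<Omega> v (cu Hh) = l2_inner \<Omega> (cu v) Hh" using v Hh by (simp add: Hcurl0_iff)
    also have "cnj \<dots> = l2_inner \<Omega> Hh (cu v)" by (rule L2.ip_sym[OF curl_L2[OF vH] Hcurl_L2[OF Hh], symmetric])
    finally show ?thesis .
  qed
  finally have J_eq: "?i * l2_inner \<Omega> J v = ?i * l2_inner \<Omega> Hh (cu v) - (complex_of_real \<omega>)\<^sup>2 * l2_inner \<Omega> Dh v" .
  have f: "ipE (Eh - coeff_inv_mult eps Dh) v = ipE Eh v - l2_inner \<Omega> Dh v"
    using E.ip_diff_left[OF Hcurl_L2[OF EhH] inv_eps_L2[OF Dh] vL] by (simp add: ipE_inv)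
  have g: "ipX (cu Eh - vscale ?i (coeff_inv_mult chi Hh)) (cu v) = ipX (cu Eh) (cu v) - ?i * l2_inner \<Omega> Hh (cu v)"
    using inv_chi_L2[OF Hcurl_L2[OF Hh]] curl_L2[OF EhH] curl_L2[OF vH]
    by (simp add: X.ip_diff_left X.ip_scale_left L2_vscale ipX_inv)
  have bE: "b (E - Eh) v = ?i * l2_inner \<Omega> J v - b Eh v"
    using b_diff_left[OF EH EhH vH] sol[OF v] by simp
  show ?thesis unfolding bE J_eq f g b_eq[of Eh v] by (simp add: algebra_simps)
qed

end

theorem theorem3p1:
  fixes \<Omega> :: "(real^3) set" and \<P> \<T> :: "(real^3) set set"
    and eps chi :: coeff and \<omega> \<gamma>_st :: real
    and W :: "vfield set" and J E Eh Dh Hh :: vfield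
  assumes "lipschitz_polyhedral_domain \<Omega>"
    and "polyhedral_partition \<Omega> \<P>"
    and "admissible_coeff \<Omega> \<P> eps" and "admissible_coeff \<Omega> \<P> chi"
    and "\<omega> > 0"
    and "\<gamma>_st > 0" and "inf_sup eps chi \<omega> \<Omega> \<ge> 1 / \<gamma>_st"
    and "conforming_tet_mesh \<Omega> \<T>"
    and "fe_space \<Omega> \<T> W"
    and "J \<in> piecewise (RT (min_degree \<T> W)) \<T> \<inter> Hdiv \<Omega>"
    and "E \<in> Hcurl0 \<Omega>"
    and "\<forall>v\<in>Hcurl0 \<Omega>. bform eps chi \<omega> \<Omega> E v = \<i> * complex_of_real \<omega> * l2_inner \<Omega> J v"
    and "Eh \<in> W"
    and "\<forall>v\<in>W. bform eps chi \<omega> \<Omega> Eh v = \<i> * complex_of_real \<omega> * l2_inner \<Omega> J v"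
    and "Dh \<in> Hdiv \<Omega>" and "Hh \<in> Hcurl \<Omega>"
    and "AE x in lebesgue_on \<Omega>.
           (\<i> * complex_of_real \<omega>) *s curl \<Omega> Hh x
             = (\<i> * complex_of_real \<omega>) *s J x + (complex_of_real \<omega>)\<^sup>2 *s Dh x"
  shows "energy_norm eps chi \<omega> \<Omega> (\<lambda>x. E x - Eh x) \<le> \<gamma>_st * \<eta>_tot eps chi \<omega> \<Omega> Eh Dh Hh
       \<and> energy_norm eps chi \<omega> \<Omega> (\<lambda>x. E x - Eh x)
           \<le> sqrt (1 + 2 * \<gamma>_ba eps chi \<omega> \<Omega> W + 3 * (\<gamma>_ba eps chi \<omega> \<Omega> W)\<^sup>2)
              * \<eta>_tot eps chi \<omega> \<Omega> Eh Dh Hh"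
proof -
  note dom = lipschitz_polyhedral_domain_facts[OF assms(1)]
  obtain c\<^sub>1 C\<^sub>1 where w1: "weight \<Omega> eps c\<^sub>1 C\<^sub>1" using admissible_coeff_weight[OF assms(1-3)] by blast
  obtain c\<^sub>2 C\<^sub>2 where w2: "weight \<Omega> chi c\<^sub>2 C\<^sub>2" using admissible_coeff_weight[OF assms(1,2,4)] by blast
  have inv: "rmat_mult (\<rho> x) (rmat_mult (matrix_inv (\<rho> x)) v) = v"
    if "admissible_coeff \<Omega> \<P> \<rho>" "x \<in> \<Omega>" for \<rho> x v
    using that by (intro sym_pos_def_inverse) (simp add: admissible_coeff_def)
  interpret M: maxwell \<Omega> eps chi c\<^sub>1 C\<^sub>1 c\<^sub>2 C\<^sub>2 \<omega>
    by (intro maxwell.intro maxwell_axioms.intro bounded_domain.intro w1 w2 dom(1-3) assms(5)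
        inv[OF assms(3)] inv[OF assms(4)] coeff_inv_mult_L2[OF assms(1-3)] coeff_inv_mult_L2[OF assms(1,2,4)])
  have W: "W \<subseteq> Hcurl0 \<Omega>" "(\<lambda>x. 0) \<in> W" using assms(9) by (auto simp: fe_space_def complex_subspace_def)
  have EhH: "Eh \<in> Hcurl0 \<Omega>" using assms(13) W by blast
  have J: "J \<in> L2 \<Omega>" and Dh: "Dh \<in> L2 \<Omega>" using assms(10,15) by (auto simp: Hdiv_def)
  define e where "e = E - Eh"
  have e: "e \<in> Hcurl0 \<Omega>" unfolding e_def by (rule M.energy0.diff_mem[OF assms(11) EhH])
  define f where "f = Eh - coeff_inv_mult eps Dh"
  define g where "g = curl \<Omega> Eh - vscale (\<i> * complex_of_real \<omega>) (coeff_inv_mult chi Hh)"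
  have fL: "f \<in> L2 \<Omega>" and gL: "g \<in> L2 \<Omega>"
    unfolding f_def g_def
    using M.Hcurl_L2 M.H0_Hcurl[OF EhH] M.curl_L2 M.inv_eps_L2[OF Dh] M.inv_chi_L2 assms(16)
    by (auto intro!: L2_diff L2_vscale)
  have \<eta>: "\<eta>_tot eps chi \<omega> \<Omega> Eh Dh Hh = sqrt ((\<omega> * snrm (wip eps \<Omega>) f)\<^sup>2 + (snrm (wip chi \<Omega>) g)\<^sup>2)"
    by (simp add: \<eta>_tot_def \<eta>_div_def \<eta>_curl_def wnorm_eq_snrm f_def g_def fun_diff_def vscale_def)
  have rep: "bform eps chi \<omega> \<Omega> e v = complex_of_real (\<omega>\<^sup>2) * wip eps \<Omega> f v - wip chi \<Omega> g (curl \<Omega> v)"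
    if "v \<in> Hcurl0 \<Omega>" for v
    unfolding e_def f_def g_def
    by (rule M.residual_representation[OF J Dh assms(16,11) EhH _ assms(17) that]) (use assms(12) in blast)
  have bound: "cmod (bform eps chi \<omega> \<Omega> e v) \<le> \<eta>_tot eps chi \<omega> \<Omega> Eh Dh Hh * snrm M.eip v" if v: "v \<in> Hcurl0 \<Omega>" for v
    unfolding rep[OF v] \<eta> by (rule M.residual_bound[OF fL gL M.H0_Hcurl[OF v]])
  have orth: "bform eps chi \<omega> \<Omega> e v = 0" if v: "v \<in> W" for v
  proof -
    have "v \<in> Hcurl0 \<Omega>" using v W by blast
    then show ?thesis unfolding e_def
      using M.b_diff_left[OF M.H0_Hcurl[OF assms(11)] M.H0_Hcurl[OF EhH] M.H0_Hcurl] assms(12,14) v by simp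
  qed
  have "0 \<le> \<eta>_tot eps chi \<omega> \<Omega> Eh Dh Hh" by (simp add: \<eta>_tot_def)
  note est = M.residual_estimates[OF assms(6,7) W e this bound orth]
  have "energy_norm eps chi \<omega> \<Omega> (\<lambda>x. E x - Eh x) = snrm M.eip e"
    using M.energy_norm_eq[OF M.H0_Hcurl[OF e]] by (simp add: e_def fun_diff_def)
  then show ?thesis using est by simp
qed

end
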